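(* Let $\mathbb K$ be a field of characteristic zero. Let $I$ be a nonzero Poisson ideal of $S(W_+)$. Then $S(W_+)/I$ has polynomial growth. Likewise, for every nonzero Poisson ideal $I$ of $S(W)$ the quotient $S(W)/I$ has polynomial growth, and for every $\kappa\in\mathbb K$ and every nonzero Poisson ideal $I$ of $R=S(Vir)/(c-\kappa)$ the quotient $R/I$ has polynomial growth.
   Context: Let $\mathbb K$ be a field of characteristic zero. The Witt algebra $W$ is the Lie algebra over $\mathbb K$ with basis $\{e_n : n\in\mathbb Z\}$ and bracket $[e_i,e_j]=(j-i)e_{i+j}$. The positive Witt algebra $W_+$ is the Lie subalgebra of $W$ spanned by $\{e_n : n\ge 1\}$. The Virasoro algebra $Vir$ is the Lie algebra with basis $\{e_n : n\in\mathbb Z\}\cup\{c\}$ and bracket $[e_i,e_j]=(j-i)e_{i+j}+\frac{i^3-i}{12}\delta_{i+j,0}\,c$, with $c$ central. For a Lie algebra $\mathfrak g$, the symmetric algebra $S(\mathfrak g)$ is a Poisson algebra with bracket extending the Lie bracket of $\mathfrak g$ by the Leibniz rule. Since $c-\kappa$ is Poisson central, the ideal $(c-\kappa)$ is Poisson and $S(Vir)/(c-\kappa)$ is a Poisson algebra. A Poisson ideal of a Poisson algebra $R$ is an ideal $I$ of the commutative algebra $R$ with $\{R,I\}\subseteq I$. The Gelfand–Kirillov dimension of a $\mathbb K$-algebra $A$ is $\sup_V \limsup_{n\to\infty}\frac{\log\dim V^n}{\log n}$, the supremum being over finite-dimensional subspaces $V$ of $A$ containing $1$; "polynomial growth" means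 finite Gelfand–Kirillov dimension. *)

theory Defs
  imports
    "HOL-Library.Poly_Mapping"
    "HOL-Library.Extended_Real"
    "HOL-Library.Liminf_Limsup"
    "HOL-Algebra.Module"
    "HOL-Algebra.QuotRing"
    "HOL-Algebra.Ideal_Product"
    "HOL-Algebra.Embedded_Algebras"
    "HOL-Algebra.Algebraic_Closure_Type"
begin

section \<open>Gelfand--Kirillov dimension of a commutative algebra\<close>

text \<open>
  Algebras over a field \<open>'k\<close> are \<^type>\<open>module\<close> records with scalars ranging over the whole
  type \<open>'k\<close>.  \<open>scalars A\<close> is the image of the field in \<open>A\<close>; dimensions over the
  field are the dimensions over this subring in the sense of
  \<^theory>\<open>HOL-Algebra.Embedded_Algebras\<close>.
\<close>

definition scalars :: "('k, 'a, 'm) module_scheme \<Rightarrow> 'a set" where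
  "scalars A = (\<lambda>c. c \<odot>\<^bsub>A\<^esub> \<one>\<^bsub>A\<^esub>) ` UNIV"

text \<open>
  \<^const>\<open>ideal_prod\<close> is defined for arbitrary subsets: it consists of the finite nonempty sums of
  products.  For two subspaces this is their product, the span of all products.
\<close>

primrec subspace_power :: "('k, 'a, 'm) module_scheme \<Rightarrow> 'a set \<Rightarrow> nat \<Rightarrow> 'a set" where
  "subspace_power A V 0 = scalars A"
| "subspace_power A V (Suc n) = ideal_prod A (subspace_power A V n) V"

text \<open>
  Being finite-dimensional in the sense of \<^const>\<open>ring.finite_dimension\<close> includes being a
  subspace of the carrier.  For the zero algebra the value is \<open>0\<close>, because \<open>ln 0 = 0\<close>;
  the values of the sequence at \<open>n = 0\<close> and \<open>n = 1\<close> are irrelevant for the limit superior.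
\<close>

definition gk_dim :: "('k, 'a, 'm) module_scheme \<Rightarrow> ereal" where
  "gk_dim A =
    (SUP V \<in> {V. ring.finite_dimension A (scalars A) V \<and> \<one>\<^bsub>A\<^esub> \<in> V}.
      limsup (\<lambda>n. ereal
        (ln (real (ring.dim A (scalars A) (subspace_power A V n))) / ln (real n))))"

definition polynomial_growth :: "('k, 'a, 'm) module_scheme \<Rightarrow> bool" where
  "polynomial_growth A \<longleftrightarrow> gk_dim A < \<infinity>"


section \<open>Poisson algebras, Poisson ideals and quotients\<close>

record ('k, 'a) poisson = "('k, 'a) module" +
  pbracket :: "'a \<Rightarrow> 'a \<Rightarrow> 'a"

definition poisson_ideal :: "('k, 'a, 'm) poisson_scheme \<Rightarrow> 'a set \<Rightarrow> bool" where
  "poisson_ideal A I \<longleftrightarrow>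
    ideal I A \<and> (\<forall>a \<in> carrier A. \<forall>x \<in> I. pbracket A a x \<in> I)"

text \<open>
  The scalar multiplication and the bracket on cosets follow the pattern of
  \<^const>\<open>rcoset_mult\<close>.  For a Poisson ideal the unions are over equal cosets, see
  \<open>poisson_quot_bracket\<close> below.
\<close>

definition poisson_quot :: "('k, 'a, 'm) poisson_scheme \<Rightarrow> 'a set \<Rightarrow> ('k, 'a set) poisson" where
  "poisson_quot A I =
    \<lparr> carrier = carrier (A Quot I),
      monoid.mult = monoid.mult (A Quot I),
      monoid.one = \<one>\<^bsub>A Quot I\<^esub>,
      ring.zero = \<zero>\<^bsub>A Quot I\<^esub>,
      ring.add = ring.add (A Quot I),
      module.smult = (\<lambda>c S. \<Union>x\<in>S. I +>\<^bsub>A\<^esub> (c \<odot>\<^bsub>A\<^esub> x)),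
      pbracket = (\<lambda>S T. \<Union>x\<in>S. \<Union>y\<in>T. I +>\<^bsub>A\<^esub> pbracket A x y) \<rparr>"


section \<open>The symmetric algebra of a Lie algebra with a given basis\<close>

text \<open>
  The symmetric algebra of a vector space with basis indexed by \<open>'i\<close> is the polynomial ring in
  indeterminates indexed by \<open>'i\<close>; an exponent vector is a finitely supported function
  \<open>'i \<Rightarrow>\<^sub>0 nat\<close>.
\<close>

type_synonym ('i, 'k) spoly = "('i \<Rightarrow>\<^sub>0 nat) \<Rightarrow>\<^sub>0 'k"

definition Const :: "'k \<Rightarrow> ('i, 'k::comm_ring_1) spoly" where
  "Const c = Poly_Mapping.single 0 c"

definition Var :: "'i \<Rightarrow> ('i, 'k::comm_ring_1) spoly" where
  "Var i = Poly_Mapping.single (Poly_Mapping.single i 1) 1"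

definition vars :: "('i, 'k::comm_ring_1) spoly \<Rightarrow> 'i set" where
  "vars p = (\<Union>m \<in> Poly_Mapping.keys p. Poly_Mapping.keys m)"

definition pdiff :: "'i \<Rightarrow> ('i, 'k::comm_ring_1) spoly \<Rightarrow> ('i, 'k) spoly" where
  "pdiff i p = (\<Sum>m \<in> Poly_Mapping.keys p.
     Poly_Mapping.single (m - Poly_Mapping.single i 1)
       (of_nat (Poly_Mapping.lookup m i) * Poly_Mapping.lookup p m))"

definition lin :: "('i \<Rightarrow>\<^sub>0 'k) \<Rightarrow> ('i, 'k::comm_ring_1) spoly" where
  "lin x = (\<Sum>i \<in> Poly_Mapping.keys x. Const (Poly_Mapping.lookup x i) * Var i)"

text \<open>
  A Lie algebra is given by its structure constants: \<open>br i j\<close> is the bracket of the \<open>i\<close>-th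
  and the \<open>j\<close>-th basis vector.  The following is the only biderivation that extends it:
  \<open>{f, g} = \<Sum>\<^sub>i\<^sub>j (\<partial>f/\<partial>x\<^sub>i) (\<partial>g/\<partial>x\<^sub>j) [x\<^sub>i, x\<^sub>j]\<close>.
\<close>

definition lie_poisson ::
  "('i \<Rightarrow> 'i \<Rightarrow> ('i \<Rightarrow>\<^sub>0 'k::comm_ring_1)) \<Rightarrow> ('i, 'k) spoly \<Rightarrow> ('i, 'k) spoly \<Rightarrow> ('i, 'k) spoly"
  where
  "lie_poisson br f g = (\<Sum>i \<in> vars f. \<Sum>j \<in> vars g. pdiff i f * pdiff j g * lin (br i j))"

text \<open>
  The symmetric algebra of the span of the basis vectors with index in \<open>J\<close>, as a subalgebra of
  the symmetric algebra of the whole Lie algebra.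
\<close>

definition sym_poisson ::
  "('i \<Rightarrow> 'i \<Rightarrow> ('i \<Rightarrow>\<^sub>0 'k::comm_ring_1)) \<Rightarrow> 'i set \<Rightarrow> ('k, ('i, 'k) spoly) poisson" where
  "sym_poisson br J =
    \<lparr> carrier = {p. vars p \<subseteq> J},
      monoid.mult = (*), monoid.one = 1, ring.zero = 0, ring.add = (+),
      module.smult = (\<lambda>c p. Const c * p),
      pbracket = lie_poisson br \<rparr>"


section \<open>The Witt and Virasoro algebras\<close>

definition witt_bracket :: "int \<Rightarrow> int \<Rightarrow> (int \<Rightarrow>\<^sub>0 'k::field_char_0)" where
  "witt_bracket i j = Poly_Mapping.single (i + j) (of_int (j - i))"

datatype vir_index = Vir_e int | Vir_c

fun vir_bracket :: "vir_index \<Rightarrow> vir_index \<Rightarrow> (vir_index \<Rightarrow>\<^sub>0 'k::field_char_0)" where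
  "vir_bracket (Vir_e i) (Vir_e j) =
     Poly_Mapping.single (Vir_e (i + j)) (of_int (j - i)) +
     (if i + j = 0 then Poly_Mapping.single Vir_c (of_int (i ^ 3 - i) / 12) else 0)"
| "vir_bracket Vir_c _ = 0"
| "vir_bracket _ Vir_c = 0"

definition S_W :: "('k::field_char_0, (int, 'k) spoly) poisson" where
  "S_W = sym_poisson witt_bracket UNIV"

definition S_Wplus :: "('k::field_char_0, (int, 'k) spoly) poisson" where
  "S_Wplus = sym_poisson witt_bracket {1..}"

definition S_Vir :: "('k::field_char_0, (vir_index, 'k) spoly) poisson" where
  "S_Vir = sym_poisson vir_bracket UNIV"

definition S_Vir_mod :: "'k \<Rightarrow> ('k::field_char_0, (vir_index, 'k) spoly set) poisson" where
  "S_Vir_mod \<kappa> = poisson_quot S_Vir (Idl\<^bsub>S_Vir\<^esub> {Var Vir_c - Const \<kappa>})"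


section \<open>The bracket is a Poisson bracket\<close>

lemma finite_vars [simp]: "finite (vars p)"
  by (simp add: vars_def)

lemma Const_simps:
  "Const (a + b) = Const a + Const b" "Const (a * b) = Const a * Const b"
  "Const (- a) = - Const a" "Const (a - b) = Const a - Const b"
  "Const 0 = 0" "Const 1 = 1"
  by (simp_all add: Const_def mult_single single_add single_uminus single_diff)

lemma spoly_single_induct:
  assumes "\<And>m c. P (Poly_Mapping.single m c)" and "\<And>p q. P p \<Longrightarrow> P q \<Longrightarrow> P (p + q)"
  shows "P (p :: 'a \<Rightarrow>\<^sub>0 'b::comm_monoid_add)"
proof (induction p rule: update_induct)
  case const
  have "P (Poly_Mapping.single undefined 0)" by (rule assms(1))
  then show ?case by simp
next
  case (update f a b)
  have "Poly_Mapping.update a b f = f + Poly_Mapping.single a b"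
    using update(1)
    by (intro poly_mapping_eqI) (auto simp: lookup_update lookup_add lookup_single in_keys_iff)
  then show ?case using assms update.IH by metis
qed

lemma spoly_induct [case_names Const Var add mult]:
  assumes C: "\<And>c. P (Const c)" and V: "\<And>i. P (Var i)"
    and A: "\<And>p q. P p \<Longrightarrow> P q \<Longrightarrow> P (p + q)"
    and M: "\<And>p q. P p \<Longrightarrow> P q \<Longrightarrow> P (p * q)"
  shows "P (p :: ('i, 'k::comm_ring_1) spoly)"
proof (induction p rule: spoly_single_induct)
  case (1 m c)
  have mon: "P (Poly_Mapping.single m 1)" for m :: "'i \<Rightarrow>\<^sub>0 nat"
  proof (induction m rule: spoly_single_induct)
    case (1 i n)
    show ?case
    proof (induction n)
      case 0
      then show ?case using C[of 1] by (simp add: Const_def)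
    next
      case (Suc n)
      have "Poly_Mapping.single (Poly_Mapping.single i (Suc n)) (1::'k) =
          Var i * Poly_Mapping.single (Poly_Mapping.single i n) 1"
        by (simp add: Var_def mult_single flip: single_add)
      then show ?case using M[OF V Suc] by simp
    qed
  next
    case (2 m m')
    have "Poly_Mapping.single (m + m') (1::'k) = Poly_Mapping.single m 1 * Poly_Mapping.single m' 1"
      by (simp add: mult_single)
    then show ?case using M[OF 2] by simp
  qed
  have "Poly_Mapping.single m c = Const c * Poly_Mapping.single m 1"
    by (simp add: Const_def mult_single)
  then show ?case using M[OF C mon] by simp
qed (rule A)

lemma pdiff_superset:
  assumes "finite S" "Poly_Mapping.keys p \<subseteq> S"
  shows "pdiff i p = (\<Sum>m \<in> S.
     Poly_Mapping.single (m - Poly_Mapping.single i 1)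
       (of_nat (Poly_Mapping.lookup m i) * Poly_Mapping.lookup p m))"
  unfolding pdiff_def using assms
  by (intro sum.mono_neutral_left) (auto simp: in_keys_iff)

lemma pdiff_single:
  "pdiff i (Poly_Mapping.single m c) =
    Poly_Mapping.single (m - Poly_Mapping.single i 1) (of_nat (Poly_Mapping.lookup m i) * c)"
  by (subst pdiff_superset[of "{m}"]) auto

lemma pdiff_add: "pdiff i (p + q) = pdiff i p + pdiff i q"
proof -
  let ?S = "Poly_Mapping.keys p \<union> Poly_Mapping.keys q"
  have "Poly_Mapping.keys (p + q) \<subseteq> ?S" by (rule keys_add)
  then show ?thesis
    by (simp add: pdiff_superset[of ?S] lookup_add distrib_left single_add sum.distrib)
qed

lemma pdiff_mult: "pdiff i (p * q) = pdiff i p * q + p * pdiff i q"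
proof -
  have mon: "pdiff i (Poly_Mapping.single m c * Poly_Mapping.single m' c') =
      pdiff i (Poly_Mapping.single m c) * Poly_Mapping.single m' c' +
      Poly_Mapping.single m c * pdiff i (Poly_Mapping.single m' c')" for m m' and c c' :: 'b
  proof -
    let ?e = "Poly_Mapping.single i (1::nat)"
    have shift: "n + n' - ?e = (n - ?e) + n'" if "Poly_Mapping.lookup n i \<noteq> 0" for n n' :: "'a \<Rightarrow>\<^sub>0 nat"
      using that by (intro poly_mapping_eqI) (auto simp: lookup_add lookup_minus lookup_single when_def)
    have A: "Poly_Mapping.single (m + m' - ?e) (of_nat (Poly_Mapping.lookup m i) * c * c') =
        Poly_Mapping.single ((m - ?e) + m') (of_nat (Poly_Mapping.lookup m i) * c * c')"
      by (cases "Poly_Mapping.lookup m i = 0") (simp_all add: shift del: One_nat_def)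
    have B: "Poly_Mapping.single (m + m' - ?e) (of_nat (Poly_Mapping.lookup m' i) * c * c') =
        Poly_Mapping.single (m + (m' - ?e)) (of_nat (Poly_Mapping.lookup m' i) * c * c')"
      using shift[of m' m] by (cases "Poly_Mapping.lookup m' i = 0") (simp_all add: add.commute del: One_nat_def)
    have "pdiff i (Poly_Mapping.single m c * Poly_Mapping.single m' c') =
        Poly_Mapping.single (m + m' - ?e) (of_nat (Poly_Mapping.lookup m i) * c * c') +
        Poly_Mapping.single (m + m' - ?e) (of_nat (Poly_Mapping.lookup m' i) * c * c')"
      by (simp add: mult_single pdiff_single lookup_add algebra_simps flip: single_add)
    then show ?thesis
      unfolding A B by (simp add: mult_single pdiff_single algebra_simps)
  qed
  show ?thesis
  proof (induction p rule: spoly_single_induct)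
    case (1 m c)
    show ?case
      by (induction q rule: spoly_single_induct) (simp_all add: mon pdiff_add algebra_simps)
  qed (simp add: pdiff_add algebra_simps)
qed

lemma pdiff_Const [simp]: "pdiff i (Const c) = 0"
  by (simp add: Const_def pdiff_single)

lemma pdiff_Var: "pdiff i (Var j) = (if i = j then 1 else 0)"
  by (simp add: Var_def pdiff_single lookup_single)

lemma pdiff_notin_vars: "i \<notin> vars p \<Longrightarrow> pdiff i p = 0"
  unfolding pdiff_def vars_def by (intro sum.neutral) (auto simp: in_keys_iff)

lemma lie_poisson_superset:
  assumes "finite S" "vars f \<subseteq> S" "finite T" "vars g \<subseteq> T"
  shows "lie_poisson br f g = (\<Sum>i \<in> S. \<Sum>j \<in> T. pdiff i f * pdiff j g * lin (br i j))"
proof -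
  have "lie_poisson br f g = (\<Sum>i \<in> vars f. \<Sum>j \<in> T. pdiff i f * pdiff j g * lin (br i j))"
    unfolding lie_poisson_def using assms
    by (intro sum.cong refl sum.mono_neutral_left) (auto simp: pdiff_notin_vars)
  also have "\<dots> = (\<Sum>i \<in> S. \<Sum>j \<in> T. pdiff i f * pdiff j g * lin (br i j))"
    using assms by (intro sum.mono_neutral_left) (auto simp: pdiff_notin_vars)
  finally show ?thesis .
qed

lemma lie_poisson_add_left: "lie_poisson br (f + f') g = lie_poisson br f g + lie_poisson br f' g"
  and lie_poisson_mult_left:
    "lie_poisson br (f * f') g = f * lie_poisson br f' g + f' * lie_poisson br f g"
proof -
  let ?S = "vars f \<union> vars f' \<union> vars (f + f') \<union> vars (f * f')"
  have *: "lie_poisson br h g = (\<Sum>i \<in> ?S. \<Sum>j \<in> vars g. pdiff i h * pdiff j g * lin (br i j))"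
    if "vars h \<subseteq> ?S" for h
    using that by (intro lie_poisson_superset) auto
  have le: "vars f \<subseteq> ?S" "vars f' \<subseteq> ?S" "vars (f + f') \<subseteq> ?S" "vars (f * f') \<subseteq> ?S" by auto
  show "lie_poisson br (f + f') g = lie_poisson br f g + lie_poisson br f' g"
    unfolding *[OF le(1)] *[OF le(2)] *[OF le(3)]
    by (simp add: pdiff_add distrib_right sum.distrib)
  show "lie_poisson br (f * f') g = f * lie_poisson br f' g + f' * lie_poisson br f g"
    unfolding *[OF le(1)] *[OF le(2)] *[OF le(4)]
    by (simp add: pdiff_mult sum_distrib_left sum.distrib [symmetric] algebra_simps)
qed

lemma lie_poisson_add_right: "lie_poisson br f (g + g') = lie_poisson br f g + lie_poisson br f g'"
  and lie_poisson_mult_right: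
    "lie_poisson br f (g * g') = g * lie_poisson br f g' + g' * lie_poisson br f g"
proof -
  let ?T = "vars g \<union> vars g' \<union> vars (g + g') \<union> vars (g * g')"
  have *: "lie_poisson br f h = (\<Sum>i \<in> vars f. \<Sum>j \<in> ?T. pdiff i f * pdiff j h * lin (br i j))"
    if "vars h \<subseteq> ?T" for h
    using that by (intro lie_poisson_superset) auto
  have le: "vars g \<subseteq> ?T" "vars g' \<subseteq> ?T" "vars (g + g') \<subseteq> ?T" "vars (g * g') \<subseteq> ?T" by auto
  show "lie_poisson br f (g + g') = lie_poisson br f g + lie_poisson br f g'"
    unfolding *[OF le(1)] *[OF le(2)] *[OF le(3)]
    by (simp add: pdiff_add distrib_right distrib_left sum.distrib)
  show "lie_poisson br f (g * g') = g * lie_poisson br f g' + g' * lie_poisson br f g"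
    unfolding *[OF le(1)] *[OF le(2)] *[OF le(4)]
    by (simp add: pdiff_mult sum_distrib_left sum.distrib [symmetric] algebra_simps)
qed

lemma lie_poisson_Const [simp]: "lie_poisson br (Const c) g = 0" "lie_poisson br f (Const c) = 0"
  by (simp_all add: lie_poisson_def)

lemma lie_poisson_Const_mult: "lie_poisson br f (Const c * g) = Const c * lie_poisson br f g"
  by (simp add: lie_poisson_mult_right)

lemma vars_Var [simp]: "vars (Var i :: ('i, 'k::comm_ring_1) spoly) = {i}"
  by (simp add: vars_def Var_def)

lemma lie_poisson_Var: "lie_poisson br (Var i) (Var j) = lin (br i j)"
  by (simp add: lie_poisson_def pdiff_Var)

lemma lin_superset:
  assumes "finite S" "Poly_Mapping.keys x \<subseteq> S"
  shows "lin x = (\<Sum>i \<in> S. Const (Poly_Mapping.lookup x i) * Var i)"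
  unfolding lin_def using assms
  by (intro sum.mono_neutral_left) (auto simp: in_keys_iff Const_simps)

lemma lin_add: "lin (x + y) = lin x + lin y"
proof -
  have "Poly_Mapping.keys (x + y) \<subseteq> Poly_Mapping.keys x \<union> Poly_Mapping.keys y" by (rule keys_add)
  then show ?thesis
    by (simp add: lin_superset[of "Poly_Mapping.keys x \<union> Poly_Mapping.keys y"] lookup_add Const_simps distrib_right sum.distrib)
qed

lemma lin_single: "lin (Poly_Mapping.single i c) = Const c * Var i"
  by (subst lin_superset[of "{i}"]) auto

lemma lin_zero [simp]: "lin 0 = 0"
  by (simp add: lin_def)

lemma lie_poisson_antisym:
  assumes "\<And>i j. lin (br i j) = - lin (br j i)"
  shows "lie_poisson br f g = - lie_poisson br g f"
proof -
  have "lie_poisson br f g = (\<Sum>i \<in> vars f. \<Sum>j \<in> vars g. - (pdiff j g * pdiff i f * lin (br j i)))"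
    unfolding lie_poisson_def by (intro sum.cong refl) (subst assms, simp add: mult.commute)
  also have "\<dots> = - lie_poisson br g f"
    unfolding lie_poisson_def by (subst sum.swap) (simp add: sum_negf)
  finally show ?thesis .
qed

lemma lie_poisson_jacobi:
  fixes br :: "'i \<Rightarrow> 'i \<Rightarrow> ('i \<Rightarrow>\<^sub>0 'k::comm_ring_1)"
  assumes anti: "\<And>i j. lin (br i j) = - lin (br j i)"
    and jac: "\<And>i j k. lie_poisson br (Var i) (lin (br j k)) + lie_poisson br (Var j) (lin (br k i)) +
      lie_poisson br (Var k) (lin (br i j)) = 0"
  shows "lie_poisson br f (lie_poisson br g h) + lie_poisson br g (lie_poisson br h f) +
    lie_poisson br h (lie_poisson br f g) = 0"
proof -
  define D where "D = lie_poisson br"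
  define J where "J f g h = D f (D g h) + D g (D h f) + D h (D f g)" for f g h
  have D_add: "D (a + b) c = D a c + D b c" "D c (a + b) = D c a + D c b" for a b c
    by (simp_all add: D_def lie_poisson_add_left lie_poisson_add_right)
  have D_mult: "D (a * b) c = a * D b c + b * D a c" "D c (a * b) = a * D c b + b * D c a" for a b c
    by (simp_all add: D_def lie_poisson_mult_left lie_poisson_mult_right)
  have D_C: "D (Const k) c = 0" "D c (Const k) = 0" "D c 0 = 0" for k c
    using lie_poisson_Const(2)[of br c 0] by (simp_all add: D_def Const_simps)
  have anti': "D a b = - D b a" for a b
    unfolding D_def by (rule lie_poisson_antisym[OF anti])
  have J_Const: "J (Const c) g h = 0" for c g h
    by (simp add: J_def D_C)
  have J_add: "J (a + b) g h = J a g h + J b g h" for a b g h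
    by (simp add: J_def D_add)
  have J_mult: "J (a * b) g h = a * J b g h + b * J a g h" for a b g h
  proof -
    have "D g a * D h b + D h b * D a g = 0" "D g b * D h a + D h a * D b g = 0"
      using anti'[of g a] anti'[of g b] by simp_all
    then show ?thesis
      by (simp add: J_def D_add D_mult algebra_simps eq_neg_iff_add_eq_0 [symmetric])
  qed
  have cyc: "J a g h = J g h a" for a g h
    by (simp add: J_def algebra_simps)
  have ext: "J a g h = 0" if "\<And>i. J (Var i) g h = 0" for a g h
    by (induction a rule: spoly_induct) (simp_all add: J_Const J_add J_mult that)
  have "J (Var i) (Var j) (Var k) = 0" for i j k
    using jac[of i j k] by (simp add: J_def D_def lie_poisson_Var)
  then have "J a (Var j) (Var k) = 0" for a j k by (rule ext)
  then have "J (Var j) (Var k) a = 0" for a j k using cyc by metis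
  then have "J b (Var k) a = 0" for b k a by (rule ext)
  then have "J (Var k) a b = 0" for b k a using cyc by metis
  then have "J f g h = 0" by (rule ext)
  then show ?thesis by (simp add: J_def D_def)
qed


lemma witt_bracket_antisym:
  "lin (witt_bracket i j :: int \<Rightarrow>\<^sub>0 'k::field_char_0) = - lin (witt_bracket j i)"
  by (simp add: witt_bracket_def lin_single add.commute Const_simps algebra_simps)

lemma witt_bracket_jacobi:
  "lie_poisson witt_bracket f (lie_poisson witt_bracket g h) +
   lie_poisson witt_bracket g (lie_poisson witt_bracket h f) +
   lie_poisson witt_bracket h (lie_poisson witt_bracket f g) =
     (0 :: (int, 'k::field_char_0) spoly)"
proof (rule lie_poisson_jacobi[OF witt_bracket_antisym])
  fix i j k :: int
  have *: "lie_poisson witt_bracket (Var a) (lin (witt_bracket b c)) =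
      Const (of_int ((c - b) * (b + c - a)) :: 'k) * Var (a + b + c)" for a b c
    unfolding witt_bracket_def[of b c] lin_single lie_poisson_Const_mult
    by (simp only: lie_poisson_Var witt_bracket_def lin_single of_int_mult Const_simps(2)
        mult.assoc add.assoc)
  have "(k - j) * (j + k - i) + (i - k) * (k + i - j) + (j - i) * (i + j - k) = 0"
    by (simp add: algebra_simps)
  then have "Const (of_int ((k - j) * (j + k - i)) :: 'k) + Const (of_int ((i - k) * (k + i - j))) +
      Const (of_int ((j - i) * (i + j - k))) = (0 :: (int, 'k) spoly)"
    unfolding Const_simps(1)[symmetric] of_int_add[symmetric] by (simp only: of_int_0 Const_simps)
  moreover have "j + k + i = i + j + k" "k + i + j = i + j + k" by simp_all
  ultimately show "lie_poisson witt_bracket (Var i) (lin (witt_bracket j k)) +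
      lie_poisson witt_bracket (Var j) (lin (witt_bracket k i)) +
      lie_poisson witt_bracket (Var k) (lin (witt_bracket i j)) = (0 :: (int, 'k) spoly)"
    unfolding * by (simp only: distrib_right[symmetric] mult_zero_left)
qed

lemma lin_vir_bracket:
  "lin (vir_bracket (Vir_e i) (Vir_e j) :: vir_index \<Rightarrow>\<^sub>0 'k::field_char_0) =
    Const (of_int (j - i)) * Var (Vir_e (i + j)) +
    Const (if i + j = 0 then of_int (i ^ 3 - i) / 12 else 0) * Var Vir_c"
  by (simp add: lin_add lin_single Const_simps)

lemma vir_bracket_c [simp]: "vir_bracket i Vir_c = 0"
  by (cases i) simp_all

lemma vir_bracket_antisym:
  "lin (vir_bracket i j :: vir_index \<Rightarrow>\<^sub>0 'k::field_char_0) = - lin (vir_bracket j i)"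
proof (cases i; cases j)
  fix a b assume [simp]: "i = Vir_e a" "j = Vir_e b"
  have "(if a + b = 0 then of_int (a ^ 3 - a) / 12 else 0) =
      - (if b + a = 0 then of_int (b ^ 3 - b) / 12 else (0 :: 'k))"
    by (auto simp: add_eq_0_iff2 field_simps)
  moreover have "of_int (b - a) = - (of_int (a - b) :: 'k)" by simp
  ultimately show ?thesis
    by (simp only: \<open>i = _\<close> \<open>j = _\<close> lin_vir_bracket Const_simps(3) add.commute[of a b]) simp
qed simp_all

lemma vir_bracket_jacobi:
  "lie_poisson vir_bracket f (lie_poisson vir_bracket g h) +
   lie_poisson vir_bracket g (lie_poisson vir_bracket h f) +
   lie_poisson vir_bracket h (lie_poisson vir_bracket f g) =
     (0 :: (vir_index, 'k::field_char_0) spoly)"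
proof (rule lie_poisson_jacobi[OF vir_bracket_antisym])
  fix x y z :: vir_index
  let ?D = "lie_poisson vir_bracket :: (vir_index, 'k) spoly \<Rightarrow> _"
  have c0: "?D (Var Vir_c) p = 0" for p
    by (simp add: lie_poisson_def pdiff_Var)
  have c0': "?D p (Var Vir_c) = 0" for p
    by (simp add: lie_poisson_def pdiff_Var)
  have z0: "?D p 0 = 0" for p
    using lie_poisson_Const(2)[of vir_bracket p 0] by (simp add: Const_simps)
  show "?D (Var x) (lin (vir_bracket y z)) + ?D (Var y) (lin (vir_bracket z x)) +
      ?D (Var z) (lin (vir_bracket x y)) = 0"
  proof (cases "Vir_c \<in> {x, y, z}")
    case True
    then show ?thesis by (auto simp: c0 z0)
  next
    case False
    then obtain i j k where [simp]: "x = Vir_e i" "y = Vir_e j" "z = Vir_e k"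
      by (metis insertCI vir_index.exhaust)
    define h where "h a s = (if s = 0 then of_int (a ^ 3 - a) / 12 else (0 :: 'k))" for a s :: int
    have *: "?D (Var (Vir_e a)) (lin (vir_bracket (Vir_e b) (Vir_e c))) =
        Const (of_int ((c - b) * (b + c - a))) * Var (Vir_e (a + b + c)) +
        Const (of_int (c - b) * h a (a + b + c)) * Var Vir_c" for a b c
      unfolding lin_vir_bracket
      by (simp only: lie_poisson_add_right lie_poisson_Const_mult c0' lie_poisson_Var lin_vir_bracket
          h_def of_int_mult Const_simps(2) distrib_left vir_bracket_c lin_zero
          mult_zero_right add_0_right mult.assoc add.assoc)
    have "(k - j) * (j + k - i) + (i - k) * (k + i - j) + (j - i) * (i + j - k) = 0"
      by (simp add: algebra_simps)
    then have 1: "Const (of_int ((k - j) * (j + k - i))) + Const (of_int ((i - k) * (k + i - j))) +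
        Const (of_int ((j - i) * (i + j - k)) :: 'k) = (0 :: (vir_index, 'k) spoly)"
      unfolding Const_simps(1)[symmetric] of_int_add[symmetric] by (simp only: of_int_0 Const_simps)
    have "of_int (k - j) * h i (i + j + k) + of_int (i - k) * h j (i + j + k) +
        of_int (j - i) * h k (i + j + k) = 0"
    proof (cases "i + j + k = 0")
      case True
      then have k: "k = - i - j" by simp
      have "(k - j) * (i ^ 3 - i) + (i - k) * (j ^ 3 - j) + (j - i) * (k ^ 3 - k) = 0"
        unfolding k by (simp add: power3_eq_cube algebra_simps)
      then have "of_int ((k - j) * (i ^ 3 - i) + (i - k) * (j ^ 3 - j) + (j - i) * (k ^ 3 - k)) / 12 = (0::'k)"
        by simp
      then show ?thesis
        using True by (simp add: h_def add_divide_distrib)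
    qed (simp add: h_def)
    then have 2: "Const (of_int (k - j) * h i (i + j + k)) + Const (of_int (i - k) * h j (i + j + k)) +
        Const (of_int (j - i) * h k (i + j + k)) = (0 :: (vir_index, 'k) spoly)"
      unfolding Const_simps(1)[symmetric] by (simp only: Const_simps)
    have 3: "j + k + i = i + j + k" "k + i + j = i + j + k" by simp_all
    have "A1 * v + B1 * w + (A2 * v + B2 * w) + (A3 * v + B3 * w) =
        (A1 + A2 + A3) * v + (B1 + B2 + B3) * w"
      for A1 A2 A3 B1 B2 B3 v w :: "(vir_index, 'k) spoly"
      by (simp add: algebra_simps)
    then show ?thesis
      using 1 2 by (simp only: \<open>x = _\<close> \<open>y = _\<close> \<open>z = _\<close> * 3) simp
  qed
qed


section \<open>Poisson algebras\<close>

locale poisson_algebra =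
  algebra "ring_of_type_algebra :: 'k ring" A
  for A :: "('k::field_char_0, 'a, 'm) poisson_scheme" (structure) +
  assumes bracket_closed [simp, intro]:
      "\<lbrakk> x \<in> carrier A; y \<in> carrier A \<rbrakk> \<Longrightarrow> pbracket A x y \<in> carrier A"
    and bracket_antisym:
      "\<lbrakk> x \<in> carrier A; y \<in> carrier A \<rbrakk> \<Longrightarrow> pbracket A x y = \<ominus>\<^bsub>A\<^esub> pbracket A y x"
    and bracket_add:
      "\<lbrakk> x \<in> carrier A; y \<in> carrier A; z \<in> carrier A \<rbrakk> \<Longrightarrow>
        pbracket A x (y \<oplus>\<^bsub>A\<^esub> z) = pbracket A x y \<oplus>\<^bsub>A\<^esub> pbracket A x z"
    and bracket_smult:
      "\<lbrakk> x \<in> carrier A; y \<in> carrier A \<rbrakk> \<Longrightarrow>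
        pbracket A x (c \<odot>\<^bsub>A\<^esub> y) = c \<odot>\<^bsub>A\<^esub> pbracket A x y"
    and leibniz:
      "\<lbrakk> x \<in> carrier A; y \<in> carrier A; z \<in> carrier A \<rbrakk> \<Longrightarrow>
        pbracket A x (y \<otimes>\<^bsub>A\<^esub> z) = y \<otimes>\<^bsub>A\<^esub> pbracket A x z \<oplus>\<^bsub>A\<^esub> z \<otimes>\<^bsub>A\<^esub> pbracket A x y"
    and jacobi:
      "\<lbrakk> x \<in> carrier A; y \<in> carrier A; z \<in> carrier A \<rbrakk> \<Longrightarrow>
        pbracket A x (pbracket A y z) \<oplus>\<^bsub>A\<^esub> pbracket A y (pbracket A z x) \<oplus>\<^bsub>A\<^esub>
        pbracket A z (pbracket A x y) = \<zero>\<^bsub>A\<^esub>"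

lemma vars_add: "vars (p + q) \<subseteq> vars p \<union> vars q"
  unfolding vars_def using keys_add[of p q] by auto

lemma vars_uminus [simp]: "vars (- p) = vars p"
  unfolding vars_def by simp

lemma vars_mult: "vars (p * q) \<subseteq> vars p \<union> vars q"
proof
  fix i assume "i \<in> vars (p * q)"
  then obtain m where m: "m \<in> Poly_Mapping.keys (p * q)" "i \<in> Poly_Mapping.keys m"
    by (auto simp: vars_def)
  then obtain a b where "m = a + b" "a \<in> Poly_Mapping.keys p" "b \<in> Poly_Mapping.keys q"
    using keys_mult[of p q] by auto
  then show "i \<in> vars p \<union> vars q"
    using m(2) keys_add[of a b] by (auto simp: vars_def)
qed

lemma vars_Const [simp]: "vars (Const c) = {}"
  by (simp add: vars_def Const_def)

lemma vars_zero [simp]: "vars 0 = {}" and vars_one [simp]: "vars 1 = {}"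
  by (simp_all add: vars_def)

lemma vars_sum: "(\<And>a. a \<in> S \<Longrightarrow> vars (f a) \<subseteq> J) \<Longrightarrow> vars (sum f S) \<subseteq> J"
proof (induction S rule: infinite_finite_induct)
  case (insert a S)
  then show ?case using vars_add[of "f a" "sum f S"] by auto
qed simp_all

lemma vars_pdiff: "vars (pdiff i p) \<subseteq> vars p"
  unfolding pdiff_def
proof (rule vars_sum)
  fix m assume m: "m \<in> Poly_Mapping.keys p"
  have "Poly_Mapping.keys (m - Poly_Mapping.single i 1) \<subseteq> Poly_Mapping.keys m"
    by (auto simp: in_keys_iff lookup_minus)
  then show "vars (Poly_Mapping.single (m - Poly_Mapping.single i 1)
      (of_nat (Poly_Mapping.lookup m i) * Poly_Mapping.lookup p m)) \<subseteq> vars p"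
    using m unfolding vars_def by (auto split: if_splits)
qed

lemma vars_lin: "vars (lin x) \<subseteq> Poly_Mapping.keys x"
  unfolding lin_def
proof (rule vars_sum)
  fix i assume "i \<in> Poly_Mapping.keys x"
  then show "vars (Const (Poly_Mapping.lookup x i) * Var i) \<subseteq> Poly_Mapping.keys x"
    using vars_mult[of "Const (Poly_Mapping.lookup x i)" "Var i"] by auto
qed

lemma vars_lie_poisson:
  assumes "vars f \<subseteq> J" "vars g \<subseteq> J"
    and "\<And>i j. i \<in> J \<Longrightarrow> j \<in> J \<Longrightarrow> Poly_Mapping.keys (br i j) \<subseteq> J"
  shows "vars (lie_poisson br f g) \<subseteq> J"
  unfolding lie_poisson_def
proof (intro vars_sum)
  fix i j assume "i \<in> vars f" "j \<in> vars g"
  then have "vars (lin (br i j)) \<subseteq> J"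
    using assms vars_lin[of "br i j"] by blast
  moreover have "vars (pdiff i f) \<subseteq> J" "vars (pdiff j g) \<subseteq> J"
    using vars_pdiff[of i f] vars_pdiff[of j g] assms by auto
  ultimately show "vars (pdiff i f * pdiff j g * lin (br i j)) \<subseteq> J"
    using vars_mult[of "pdiff i f * pdiff j g" "lin (br i j)"] vars_mult[of "pdiff i f" "pdiff j g"]
    by blast
qed

lemma sym_poisson_cring: "cring (sym_poisson br J)"
proof (rule cringI)
  show "abelian_group (sym_poisson br J)"
  proof (rule abelian_groupI)
    fix x assume "x \<in> carrier (sym_poisson br J)"
    then show "\<exists>y\<in>carrier (sym_poisson br J). y \<oplus>\<^bsub>sym_poisson br J\<^esub> x = \<zero>\<^bsub>sym_poisson br J\<^esub>"
      by (intro bexI[of _ "- x"]) (simp_all add: sym_poisson_def)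
  qed (use vars_add in \<open>fastforce simp: sym_poisson_def add_ac\<close>)+
  show "comm_monoid (sym_poisson br J)"
    by (rule comm_monoidI) (use vars_mult in \<open>fastforce simp: sym_poisson_def mult_ac\<close>)+
qed (simp add: sym_poisson_def distrib_right)

lemma sym_poisson_minus:
  assumes "x \<in> carrier (sym_poisson br J)"
  shows "\<ominus>\<^bsub>sym_poisson br J\<^esub> x = - x"
proof -
  interpret cring "sym_poisson br J" by (rule sym_poisson_cring)
  show ?thesis
    by (rule minus_equality) (use assms in \<open>simp_all add: sym_poisson_def\<close>)
qed

lemma sym_poisson_poisson_algebra:
  fixes br :: "'i \<Rightarrow> 'i \<Rightarrow> ('i \<Rightarrow>\<^sub>0 'k::field_char_0)"
  assumes J: "\<And>i j. i \<in> J \<Longrightarrow> j \<in> J \<Longrightarrow> Poly_Mapping.keys (br i j) \<subseteq> J"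
    and anti: "\<And>i j. lin (br i j) = - lin (br j i)"
    and jac: "\<And>f g h. lie_poisson br f (lie_poisson br g h) + lie_poisson br g (lie_poisson br h f) +
      lie_poisson br h (lie_poisson br f g) = 0"
  shows "poisson_algebra (sym_poisson br J)"
proof -
  interpret S: cring "sym_poisson br J" by (rule sym_poisson_cring)
  have cl: "lie_poisson br x y \<in> carrier (sym_poisson br J)"
    if "x \<in> carrier (sym_poisson br J)" "y \<in> carrier (sym_poisson br J)" for x y
    using that J by (simp add: sym_poisson_def vars_lie_poisson)
  have sm: "Const c * x \<in> carrier (sym_poisson br J)"
    if "x \<in> carrier (sym_poisson br J)" for c x
    using that vars_mult[of "Const c" x] by (auto simp: sym_poisson_def)
  have "algebra (ring_of_type_algebra :: 'k ring) (sym_poisson br J)"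
    by (rule algebraI[OF cring_from_type_algebra sym_poisson_cring])
      (use sm in \<open>auto simp: sym_poisson_def ring_of_type_algebra_def Const_simps algebra_simps\<close>)
  moreover have "poisson_algebra_axioms (sym_poisson br J)"
  proof
    fix x y assume xy: "x \<in> carrier (sym_poisson br J)" "y \<in> carrier (sym_poisson br J)"
    have "\<ominus>\<^bsub>sym_poisson br J\<^esub> lie_poisson br y x = - lie_poisson br y x"
      by (rule sym_poisson_minus[OF cl[OF xy(2,1)]])
    then show "pbracket (sym_poisson br J) x y =
        \<ominus>\<^bsub>sym_poisson br J\<^esub> pbracket (sym_poisson br J) y x"
      using lie_poisson_antisym[OF anti, where f = x and g = y] by (simp add: sym_poisson_def)
  qed (use cl in \<open>simp_all add: sym_poisson_def lie_poisson_add_right lie_poisson_mult_right jac\<close>)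
  ultimately show ?thesis by (rule poisson_algebra.intro)
qed

lemma poisson_algebra_S_W: "poisson_algebra (S_W :: ('k::field_char_0, (int, 'k) spoly) poisson)"
  unfolding S_W_def
  by (rule sym_poisson_poisson_algebra[OF _ witt_bracket_antisym witt_bracket_jacobi]) simp

lemma poisson_algebra_S_Wplus:
  "poisson_algebra (S_Wplus :: ('k::field_char_0, (int, 'k) spoly) poisson)"
  unfolding S_Wplus_def
  by (rule sym_poisson_poisson_algebra[OF _ witt_bracket_antisym witt_bracket_jacobi])
    (auto simp: witt_bracket_def)

lemma poisson_algebra_S_Vir:
  "poisson_algebra (S_Vir :: ('k::field_char_0, (vir_index, 'k) spoly) poisson)"
  unfolding S_Vir_def
  by (rule sym_poisson_poisson_algebra[OF _ vir_bracket_antisym vir_bracket_jacobi]) simp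


subsection \<open>Quotients by Poisson ideals\<close>

context poisson_algebra
begin

lemma bracket_add_left:
  assumes [simp]: "x \<in> carrier A" "y \<in> carrier A" "z \<in> carrier A"
  shows "pbracket A (x \<oplus>\<^bsub>A\<^esub> y) z = pbracket A x z \<oplus>\<^bsub>A\<^esub> pbracket A y z"
  using bracket_antisym[of "x \<oplus>\<^bsub>A\<^esub> y" z] bracket_antisym[of x z] bracket_antisym[of y z]
  by (simp add: bracket_add M.minus_add)

context
  fixes I
  assumes I: "poisson_ideal A I"
begin

interpretation I: ideal I A
  using I by (simp add: poisson_ideal_def)

lemma poisson_ideal_bracket:
  assumes "a \<in> carrier A" "x \<in> I"
  shows "pbracket A a x \<in> I" "pbracket A x a \<in> I"
proof -
  show 1: "pbracket A a x \<in> I" using I assms by (simp add: poisson_ideal_def)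
  show "pbracket A x a \<in> I"
    using bracket_antisym[of x a] 1 assms I.Icarr I.a_inv_closed by simp
qed

lemma coset_memE:
  assumes "y \<in> I +>\<^bsub>A\<^esub> x"
  obtains h where "h \<in> I" "y = h \<oplus>\<^bsub>A\<^esub> x"
  using assms unfolding a_r_coset_def' by blast

lemma coset_eqI:
  assumes "h \<in> I" "x \<in> carrier A" "y = h \<oplus>\<^bsub>A\<^esub> x"
  shows "I +>\<^bsub>A\<^esub> y = I +>\<^bsub>A\<^esub> x"
  using I.a_repr_independence'[of y x] assms by (auto simp: a_r_coset_def')

lemma poisson_quot_simps:
  "carrier (poisson_quot A I) = (\<lambda>x. I +>\<^bsub>A\<^esub> x) ` carrier A"
  "\<zero>\<^bsub>poisson_quot A I\<^esub> = I +>\<^bsub>A\<^esub> \<zero>\<^bsub>A\<^esub>"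
  "\<one>\<^bsub>poisson_quot A I\<^esub> = I +>\<^bsub>A\<^esub> \<one>\<^bsub>A\<^esub>"
  "\<lbrakk> x \<in> carrier A; y \<in> carrier A \<rbrakk> \<Longrightarrow>
    (I +>\<^bsub>A\<^esub> x) \<oplus>\<^bsub>poisson_quot A I\<^esub> (I +>\<^bsub>A\<^esub> y) = I +>\<^bsub>A\<^esub> (x \<oplus>\<^bsub>A\<^esub> y)"
  "\<lbrakk> x \<in> carrier A; y \<in> carrier A \<rbrakk> \<Longrightarrow>
    (I +>\<^bsub>A\<^esub> x) \<otimes>\<^bsub>poisson_quot A I\<^esub> (I +>\<^bsub>A\<^esub> y) = I +>\<^bsub>A\<^esub> (x \<otimes>\<^bsub>A\<^esub> y)"
  using I.rcoset_mult_add I.a_rcos_sum I.Icarr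
  by (auto simp: poisson_quot_def FactRing_def A_RCOSETS_def' a_r_coset_def')

lemma poisson_quot_smult:
  assumes [simp]: "x \<in> carrier A"
  shows "c \<odot>\<^bsub>poisson_quot A I\<^esub> (I +>\<^bsub>A\<^esub> x) = I +>\<^bsub>A\<^esub> (c \<odot>\<^bsub>A\<^esub> x)"
proof -
  have "I +>\<^bsub>A\<^esub> (c \<odot>\<^bsub>A\<^esub> y) = I +>\<^bsub>A\<^esub> (c \<odot>\<^bsub>A\<^esub> x)" if y: "y \<in> I +>\<^bsub>A\<^esub> x" for y
  proof -
    obtain h where h: "h \<in> I" "y = h \<oplus>\<^bsub>A\<^esub> x" using y by (rule coset_memE)
    have [simp]: "h \<in> carrier A" using h I.Icarr by blast
    have "c \<odot>\<^bsub>A\<^esub> h = (c \<odot>\<^bsub>A\<^esub> \<one>\<^bsub>A\<^esub>) \<otimes>\<^bsub>A\<^esub> h"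
      by (simp add: smult_assoc2 ring_of_type_algebra_def)
    then have "c \<odot>\<^bsub>A\<^esub> h \<in> I"
      using I.I_l_closed[OF h(1)] by (simp add: ring_of_type_algebra_def)
    then show ?thesis
      by (rule coset_eqI) (simp_all add: h smult_r_distr ring_of_type_algebra_def)
  qed
  then have "(\<Union>y\<in>I +>\<^bsub>A\<^esub> x. I +>\<^bsub>A\<^esub> (c \<odot>\<^bsub>A\<^esub> y)) =
      (\<Union>y\<in>I +>\<^bsub>A\<^esub> x. I +>\<^bsub>A\<^esub> (c \<odot>\<^bsub>A\<^esub> x))"
    by (intro SUP_cong refl)
  moreover have "I +>\<^bsub>A\<^esub> x \<noteq> {}" using I.a_rcos_self[of x] by auto
  ultimately show ?thesis by (simp add: poisson_quot_def)
qed

lemma poisson_quot_bracket: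
  assumes [simp]: "x \<in> carrier A" "y \<in> carrier A"
  shows "pbracket (poisson_quot A I) (I +>\<^bsub>A\<^esub> x) (I +>\<^bsub>A\<^esub> y) = I +>\<^bsub>A\<^esub> pbracket A x y"
proof -
  have "I +>\<^bsub>A\<^esub> pbracket A u v = I +>\<^bsub>A\<^esub> pbracket A x y"
    if uv: "u \<in> I +>\<^bsub>A\<^esub> x" "v \<in> I +>\<^bsub>A\<^esub> y" for u v
  proof -
    obtain h where h: "h \<in> I" "u = h \<oplus>\<^bsub>A\<^esub> x" using uv(1) by (rule coset_memE)
    obtain k where k: "k \<in> I" "v = k \<oplus>\<^bsub>A\<^esub> y" using uv(2) by (rule coset_memE)
    have [simp]: "h \<in> carrier A" "k \<in> carrier A" using h k I.Icarr by blast+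
    have "pbracket A h v \<oplus>\<^bsub>A\<^esub> pbracket A x k \<in> I"
      using h k by (intro I.a_closed poisson_ideal_bracket) simp_all
    then show ?thesis
      by (rule coset_eqI) (simp_all add: h k bracket_add bracket_add_left M.a_ac)
  qed
  then have "(\<Union>u\<in>I +>\<^bsub>A\<^esub> x. \<Union>v\<in>I +>\<^bsub>A\<^esub> y. I +>\<^bsub>A\<^esub> pbracket A u v) =
      (\<Union>u\<in>I +>\<^bsub>A\<^esub> x. \<Union>v\<in>I +>\<^bsub>A\<^esub> y. I +>\<^bsub>A\<^esub> pbracket A x y)"
    by (intro SUP_cong refl)
  moreover have "I +>\<^bsub>A\<^esub> x \<noteq> {}" "I +>\<^bsub>A\<^esub> y \<noteq> {}"
    using I.a_rcos_self[of x] I.a_rcos_self[of y] by auto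
  ultimately show ?thesis by (simp add: poisson_quot_def)
qed

lemma poisson_quot_cring: "cring (poisson_quot A I)"
proof (rule cringI)
  show "abelian_group (poisson_quot A I)"
  proof (rule abelian_groupI)
    fix S assume "S \<in> carrier (poisson_quot A I)"
    then obtain x where x: "x \<in> carrier A" "S = I +>\<^bsub>A\<^esub> x" by (auto simp: poisson_quot_simps)
    then show "\<exists>T\<in>carrier (poisson_quot A I). T \<oplus>\<^bsub>poisson_quot A I\<^esub> S = \<zero>\<^bsub>poisson_quot A I\<^esub>"
      by (intro bexI[of _ "I +>\<^bsub>A\<^esub> (\<ominus>\<^bsub>A\<^esub> x)"]) (simp_all add: poisson_quot_simps M.l_neg)
  qed (auto simp: poisson_quot_simps M.a_ac)
  show "comm_monoid (poisson_quot A I)"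
    by (rule comm_monoidI) (auto simp: poisson_quot_simps m_ac)
qed (auto simp: poisson_quot_simps l_distr)

lemma poisson_quot_minus:
  assumes "x \<in> carrier A"
  shows "\<ominus>\<^bsub>poisson_quot A I\<^esub> (I +>\<^bsub>A\<^esub> x) = I +>\<^bsub>A\<^esub> (\<ominus>\<^bsub>A\<^esub> x)"
proof -
  interpret Q: cring "poisson_quot A I" by (rule poisson_quot_cring)
  show ?thesis
    by (rule Q.minus_equality) (use assms in \<open>simp_all add: poisson_quot_simps M.l_neg\<close>)
qed

lemma poisson_algebra_quot: "poisson_algebra (poisson_quot A I)"
proof (rule poisson_algebra.intro)
  have *: "carrier (ring_of_type_algebra :: 'k ring) = UNIV"
    by (simp add: ring_of_type_algebra_def)
  show "algebra (ring_of_type_algebra :: 'k ring) (poisson_quot A I)"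
    by (rule algebraI[OF cring_from_type_algebra poisson_quot_cring])
      (auto simp: poisson_quot_simps poisson_quot_smult * smult_l_distr smult_r_distr
        smult_assoc1 smult_assoc2)
  show "poisson_algebra_axioms (poisson_quot A I)"
  proof
    fix S T assume "S \<in> carrier (poisson_quot A I)" "T \<in> carrier (poisson_quot A I)"
    then obtain x y where [simp]: "x \<in> carrier A" "y \<in> carrier A"
      and ST: "S = I +>\<^bsub>A\<^esub> x" "T = I +>\<^bsub>A\<^esub> y"
      by (auto simp: poisson_quot_simps)
    show "pbracket (poisson_quot A I) S T = \<ominus>\<^bsub>poisson_quot A I\<^esub> pbracket (poisson_quot A I) T S"
      using bracket_antisym[of x y] by (simp add: ST poisson_quot_bracket poisson_quot_minus)
  qed (auto simp: poisson_quot_simps poisson_quot_smult poisson_quot_bracket * bracket_add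
      bracket_smult leibniz jacobi)
qed

end

end

lemma poisson_ideal_central:
  "poisson_ideal S_Vir (Idl\<^bsub>S_Vir\<^esub> {Var Vir_c - Const (\<kappa> :: 'k::field_char_0)})"
proof -
  let ?S = "S_Vir :: ('k, (vir_index, 'k) spoly) poisson"
  let ?z = "Var Vir_c - Const \<kappa>"
  interpret poisson_algebra ?S by (rule poisson_algebra_S_Vir)
  have S: "carrier ?S = UNIV" "monoid.mult ?S = (*)" "pbracket ?S = lie_poisson vir_bracket"
    by (simp_all add: S_Vir_def sym_poisson_def)
  have z: "lie_poisson vir_bracket a ?z = 0" for a
  proof -
    have "?z = Var Vir_c + Const (- \<kappa>)" by (simp add: Const_simps)
    moreover have "lie_poisson vir_bracket a (Var Vir_c) = (0 :: (vir_index, 'k) spoly)"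
      by (simp add: lie_poisson_def pdiff_Var)
    ultimately show ?thesis by (simp only: lie_poisson_add_right lie_poisson_Const add_0_right)
  qed
  have eq: "Idl\<^bsub>?S\<^esub> {?z} = PIdl\<^bsub>?S\<^esub> ?z"
    by (rule cgenideal_eq_genideal[symmetric]) (simp add: S)
  have "ideal (PIdl\<^bsub>?S\<^esub> ?z) ?S"
    by (rule cgenideal_ideal) (simp add: S)
  moreover have "lie_poisson vir_bracket a (x * ?z) = lie_poisson vir_bracket a x * ?z" for a x
    by (simp add: lie_poisson_mult_right z)
  ultimately show ?thesis
    unfolding eq by (auto simp: poisson_ideal_def cgenideal_def S)
qed

lemma poisson_algebra_S_Vir_mod: "poisson_algebra (S_Vir_mod \<kappa>)"
  unfolding S_Vir_mod_def
  by (rule poisson_algebra.poisson_algebra_quot[OF poisson_algebra_S_Vir poisson_ideal_central])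

end

theory Submission
  imports Defs
begin

text \<open>
  Let \<open>I\<close> be a Poisson ideal that contains a nonzero polynomial \<open>f\<close> in the variables \<open>e\<^sub>n\<close>.  The
  quotient by \<open>I\<close> is a commutative algebra with infinitely many generators, so its
  Gelfand--Kirillov dimension is the supremum of the dimensions of its finitely generated
  subalgebras.  It is finite as soon as there is a number \<open>N\<close> such that any \<open>N + 1\<close> variables
  satisfy a nontrivial polynomial relation modulo \<open>I\<close>.  The proof has two halves: such an \<open>N\<close>
  exists, and it bounds the growth.

  For the first half let \<open>P\<close> be a prime Poisson ideal that contains \<open>I\<close>, and let \<open>g \<in> P\<close> be an
  iterated partial derivative of \<open>f\<close> not all of whose partial derivatives lie in \<open>P\<close>.  The brackets
  \<open>{e\<^sub>n, g} = \<Sum>\<^sub>i (i - n) \<partial>\<^sub>i g e\<^bsub>n+i\<^esub>\<close> (plus a central term for the Virasoro algebra) lie in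
  \<open>P\<close>.  Modulo \<open>P\<close> they are a linear recurrence for the variables, of a length that depends only on
  \<open>f\<close>, and its extreme coefficients are nonzero.  So all variables are rational functions
  of the finitely many in a window around \<open>0\<close> (\<open>localisation_generated_by_window\<close>), and more
  variables than the window contains are algebraically dependent modulo \<open>P\<close>
  (\<open>prime_ideal_meets_subring\<close>).  This passes from \<open>P\<close> to \<open>I\<close> itself because, in characteristic zero,
  a Poisson ideal that is maximal among those that contain \<open>I\<close> and avoid a given multiplicative
  set, here the nonzero polynomials in the chosen variables, is prime
  (\<open>prime_diff_ideal_exists\<close>, \<open>ideal_meets_subring\<close>).

  For the second half fix finitely many variables.  The relations between any \<open>N + 1\<close> of them
  allow one to rewrite every monomial, without raising its weighted degree, to monomials in which at
  most \<open>N\<close> exponents exceed a fixed bound (\<open>rewrite_to_sparse\<close>).  There are \<open>O(d\<^sup>N)\<close> such monomials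
  of degree at most \<open>d\<close>, which bounds the dimensions of the powers of a finite-dimensional
  subspace (\<open>polynomial_growth_if_dependent\<close>).
\<close>

section \<open>Prime differential ideals\<close>

text \<open>
  The ring is a subset of a type because the polynomials in the variables \<open>e\<^sub>n\<close> with \<open>n \<ge> 1\<close> are
  treated inside the polynomials in all \<open>e\<^sub>n\<close>.  The derivations will be the maps \<open>{a, _}\<close>, so that
  differential ideals are Poisson ideals.
\<close>

locale differential_subring =
  fixes R :: "'a::comm_ring_1 set" and \<Delta> :: "('a \<Rightarrow> 'a) set"
  assumes one_closed: "1 \<in> R"
    and add_closed: "\<lbrakk> x \<in> R; y \<in> R \<rbrakk> \<Longrightarrow> x + y \<in> R"
    and uminus_closed: "x \<in> R \<Longrightarrow> - x \<in> R"
    and mult_closed: "\<lbrakk> x \<in> R; y \<in> R \<rbrakk> \<Longrightarrow> x * y \<in> R"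
    and positive_invertible: "0 < n \<Longrightarrow> \<exists>r\<in>R. r * of_nat n = 1"
    and deriv_closed: "\<lbrakk> \<delta> \<in> \<Delta>; x \<in> R \<rbrakk> \<Longrightarrow> \<delta> x \<in> R"
    and deriv_add: "\<delta> \<in> \<Delta> \<Longrightarrow> \<delta> (x + y) = \<delta> x + \<delta> y"
    and deriv_mult: "\<delta> \<in> \<Delta> \<Longrightarrow> \<delta> (x * y) = x * \<delta> y + y * \<delta> x"
begin

lemma power_closed: "x \<in> R \<Longrightarrow> x ^ n \<in> R"
  by (induction n) (auto simp: one_closed mult_closed)

lemma of_nat_closed: "of_nat n \<in> R"
proof (induction n)
  case 0
  show ?case using add_closed[OF one_closed uminus_closed[OF one_closed]] by simp
qed (auto simp: one_closed add_closed)

lemma deriv_power: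
  assumes "\<delta> \<in> \<Delta>" shows "\<delta> (x ^ Suc n) = of_nat (Suc n) * x ^ n * \<delta> x"
  by (induction n) (simp_all add: deriv_mult[OF assms] algebra_simps)

definition diff_ideal :: "'a set \<Rightarrow> bool" where
  "diff_ideal Q \<longleftrightarrow> Q \<subseteq> R \<and> 0 \<in> Q \<and> (\<forall>x\<in>Q. \<forall>y\<in>Q. x + y \<in> Q) \<and>
    (\<forall>r\<in>R. \<forall>x\<in>Q. r * x \<in> Q) \<and> (\<forall>\<delta>\<in>\<Delta>. \<forall>x\<in>Q. \<delta> x \<in> Q)"

lemma diff_ideal_uminus: "diff_ideal Q \<Longrightarrow> x \<in> Q \<Longrightarrow> - x \<in> Q"
proof -
  assume "diff_ideal Q" "x \<in> Q"
  then have "(- 1) * x \<in> Q" using uminus_closed[OF one_closed] unfolding diff_ideal_def by blast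
  then show ?thesis by simp
qed

lemma diff_ideal_diff: "diff_ideal Q \<Longrightarrow> x \<in> Q \<Longrightarrow> y \<in> Q \<Longrightarrow> x - y \<in> Q"
  using diff_ideal_uminus[of Q y] unfolding diff_ideal_def diff_conv_add_uminus by blast

definition saturation :: "'a set \<Rightarrow> 'a \<Rightarrow> 'a set" where
  "saturation Q a = {x \<in> R. \<exists>n. a ^ n * x \<in> Q}"

definition radical :: "'a set \<Rightarrow> 'a set" where
  "radical Q = {x \<in> R. \<exists>n. x ^ n \<in> Q}"

text \<open>
  One more power of \<open>a\<close> is enough: \<open>\<delta> (a\<^bsup>m+1\<^esup> x)\<close> and \<open>a\<^bsup>m+1\<^esup> \<delta> x\<close> differ by a multiple of
  \<open>a\<^bsup>m\<^esup> x\<close>, which lies in the ideal already.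
\<close>

lemma diff_ideal_saturation:
  assumes Q: "diff_ideal Q" and a: "a \<in> R"
  shows "diff_ideal (saturation Q a)"
  unfolding diff_ideal_def
proof (intro conjI ballI)
  show "saturation Q a \<subseteq> R" by (auto simp: saturation_def)
  show "0 \<in> saturation Q a"
    using Q add_closed[OF one_closed uminus_closed[OF one_closed]]
    by (auto simp: saturation_def diff_ideal_def)
next
  fix x y assume "x \<in> saturation Q a" "y \<in> saturation Q a"
  then obtain m n where *: "x \<in> R" "y \<in> R" "a ^ m * x \<in> Q" "a ^ n * y \<in> Q"
    by (auto simp: saturation_def)
  have "a ^ (m + n) * (x + y) = a ^ n * (a ^ m * x) + a ^ m * (a ^ n * y)"
    by (simp add: power_add algebra_simps)
  also have "\<dots> \<in> Q"
    using Q * power_closed[OF a] by (simp add: diff_ideal_def)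
  finally show "x + y \<in> saturation Q a"
    using * add_closed unfolding saturation_def by blast
next
  fix r x assume "r \<in> R" "x \<in> saturation Q a"
  then obtain m where *: "x \<in> R" "r \<in> R" "a ^ m * x \<in> Q"
    by (auto simp: saturation_def)
  have "a ^ m * (r * x) = r * (a ^ m * x)" by (simp add: algebra_simps)
  also have "\<dots> \<in> Q" using Q * by (simp add: diff_ideal_def)
  finally show "r * x \<in> saturation Q a"
    using * mult_closed unfolding saturation_def by blast
next
  fix \<delta> x assume \<delta>: "\<delta> \<in> \<Delta>" and "x \<in> saturation Q a"
  then obtain m where *: "x \<in> R" "a ^ m * x \<in> Q"
    by (auto simp: saturation_def)
  then have "a ^ Suc m * x \<in> Q"
    using Q a by (auto simp: diff_ideal_def mult.assoc)
  then have "\<delta> (a ^ Suc m * x) \<in> Q" using Q \<delta> by (simp add: diff_ideal_def)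
  moreover have "(of_nat (Suc m) * \<delta> a) * (a ^ m * x) \<in> Q"
    using Q * \<delta> a deriv_closed mult_closed of_nat_closed unfolding diff_ideal_def by blast
  ultimately have "\<delta> (a ^ Suc m * x) - (of_nat (Suc m) * \<delta> a) * (a ^ m * x) \<in> Q"
    using Q by (rule diff_ideal_diff[rotated])
  also have "\<delta> (a ^ Suc m * x) - (of_nat (Suc m) * \<delta> a) * (a ^ m * x) = a ^ Suc m * \<delta> x"
    unfolding deriv_mult[OF \<delta>] deriv_power[OF \<delta>] by (simp add: algebra_simps)
  finally show "\<delta> x \<in> saturation Q a"
    using * \<delta> deriv_closed unfolding saturation_def by blast
qed

lemma subset_saturation: "diff_ideal Q \<Longrightarrow> a \<in> R \<Longrightarrow> Q \<subseteq> saturation Q a"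
  unfolding saturation_def diff_ideal_def by (auto intro!: exI[of _ 0])

text \<open>
  Differentiating trades one factor \<open>a\<close> for two factors \<open>\<delta> a\<close>, at the price of an integer factor
  that has to be cancelled; characteristic zero is essential here.
\<close>

lemma power_deriv_mem:
  assumes Q: "diff_ideal Q" and \<delta>: "\<delta> \<in> \<Delta>" and a: "a \<in> R"
  shows "a ^ n * \<delta> a ^ k \<in> Q \<Longrightarrow> \<delta> a ^ (k + 2 * n) \<in> Q"
proof (induction n arbitrary: k)
  case (Suc n)
  have da: "\<delta> a \<in> R" "\<delta> (\<delta> a) \<in> R" using a \<delta> deriv_closed by auto
  have "\<delta> (a ^ Suc n * \<delta> a ^ Suc k) \<in> Q"
  proof -
    have "\<delta> a * (a ^ Suc n * \<delta> a ^ k) \<in> Q" using Q da Suc.prems by (auto simp: diff_ideal_def)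
    then show ?thesis using Q \<delta> by (auto simp: diff_ideal_def algebra_simps)
  qed
  moreover have "(of_nat (Suc k) * \<delta> (\<delta> a)) * (a ^ Suc n * \<delta> a ^ k) \<in> Q"
    using Q da Suc.prems mult_closed of_nat_closed unfolding diff_ideal_def by blast
  ultimately have "\<delta> (a ^ Suc n * \<delta> a ^ Suc k) - (of_nat (Suc k) * \<delta> (\<delta> a)) * (a ^ Suc n * \<delta> a ^ k) \<in> Q"
    using Q by (rule diff_ideal_diff[rotated])
  also have "\<delta> (a ^ Suc n * \<delta> a ^ Suc k) - (of_nat (Suc k) * \<delta> (\<delta> a)) * (a ^ Suc n * \<delta> a ^ k) =
      of_nat (Suc n) * (a ^ n * \<delta> a ^ (k + 2))"
    unfolding deriv_mult[OF \<delta>, of "a ^ Suc n"] deriv_power[OF \<delta>] by (simp add: algebra_simps)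
  finally have *: "of_nat (Suc n) * (a ^ n * \<delta> a ^ (k + 2)) \<in> Q" .
  obtain r where r: "r \<in> R" "r * of_nat (Suc n) = 1" using positive_invertible[of "Suc n"] by auto
  have "r * (of_nat (Suc n) * (a ^ n * \<delta> a ^ (k + 2))) \<in> Q" using Q r * unfolding diff_ideal_def by blast
  then have "a ^ n * \<delta> a ^ (k + 2) \<in> Q" using r(2) by (simp only: mult.assoc[symmetric]) simp
  from Suc.IH[OF this] show ?case by simp
qed simp

lemma diff_ideal_radical:
  assumes Q: "diff_ideal Q" shows "diff_ideal (radical Q)"
  unfolding diff_ideal_def
proof (intro conjI ballI)
  show "radical Q \<subseteq> R" by (auto simp: radical_def)
  show "0 \<in> radical Q"
    using Q by (auto simp: radical_def diff_ideal_def intro!: exI[of _ 1])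
next
  fix x y assume "x \<in> radical Q" "y \<in> radical Q"
  then obtain m n where *: "x \<in> R" "y \<in> R" "x ^ m \<in> Q" "y ^ n \<in> Q"
    by (auto simp: radical_def)
  have sum_mem: "sum f A \<in> Q" if "\<And>i. i \<in> A \<Longrightarrow> f i \<in> Q" for f and A :: "nat set"
    using that Q by (induction A rule: infinite_finite_induct) (auto simp: diff_ideal_def)
  have "(x + y) ^ (m + n) = (\<Sum>k\<le>m+n. of_nat (m + n choose k) * x ^ k * y ^ (m + n - k))"
    by (rule binomial_ring)
  also have "\<dots> \<in> Q"
  proof (rule sum_mem)
    fix k
    have "\<exists>r\<in>R. of_nat (m + n choose k) * x ^ k * y ^ (m + n - k) = r * x ^ m \<or>
        of_nat (m + n choose k) * x ^ k * y ^ (m + n - k) = r * y ^ n"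
    proof (cases "m \<le> k")
      case True
      then have "x ^ k = x ^ (k - m) * x ^ m" by (simp add: power_add [symmetric])
      then show ?thesis
        using * by (intro bexI[of _ "of_nat (m + n choose k) * x ^ (k - m) * y ^ (m + n - k)"])
          (auto intro!: mult_closed power_closed of_nat_closed simp: algebra_simps)
    next
      case False
      then have "y ^ (m + n - k) = y ^ (m - k) * y ^ n" by (simp add: power_add [symmetric])
      then show ?thesis
        using * by (intro bexI[of _ "of_nat (m + n choose k) * x ^ k * y ^ (m - k)"])
          (auto intro!: mult_closed power_closed of_nat_closed simp: algebra_simps)
    qed
    then show "of_nat (m + n choose k) * x ^ k * y ^ (m + n - k) \<in> Q"
      using Q * unfolding diff_ideal_def by metis
  qed
  finally show "x + y \<in> radical Q"
    using * add_closed unfolding radical_def by blast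
next
  fix r x assume "r \<in> R" "x \<in> radical Q"
  then obtain m where *: "x \<in> R" "r \<in> R" "x ^ m \<in> Q"
    by (auto simp: radical_def)
  have "(r * x) ^ m \<in> Q" using Q * power_closed by (auto simp: diff_ideal_def power_mult_distrib)
  then show "r * x \<in> radical Q"
    using * mult_closed unfolding radical_def by blast
next
  fix \<delta> x assume \<delta>: "\<delta> \<in> \<Delta>" and "x \<in> radical Q"
  then obtain m where *: "x \<in> R" "x ^ m \<in> Q"
    by (auto simp: radical_def)
  then show "\<delta> x \<in> radical Q"
    using power_deriv_mem[OF Q \<delta>, of x m 0] \<delta> deriv_closed unfolding radical_def by auto
qed

lemma subset_radical: "diff_ideal Q \<Longrightarrow> Q \<subseteq> radical Q"
  unfolding radical_def diff_ideal_def by (auto intro!: exI[of _ 1])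

text \<open>
  Let \<open>P\<close> be maximal among the differential ideals that contain \<open>I\<close> and avoid \<open>S\<close>.  By maximality
  \<open>P\<close> is radical and saturated at every \<open>s \<in> S\<close>.  Let \<open>a b \<in> P\<close>.  If the saturation of \<open>P\<close> at \<open>a\<close>
  avoids \<open>S\<close>, it equals \<open>P\<close> and contains \<open>b\<close>; otherwise \<open>a\<^sup>n s \<in> P\<close> for some \<open>s \<in> S\<close>, so
  \<open>a\<^sup>n \<in> P\<close> and \<open>a \<in> P\<close>.
\<close>

theorem prime_diff_ideal_exists:
  assumes I: "diff_ideal I" and S1: "1 \<in> S" and Smult: "\<And>s t. s \<in> S \<Longrightarrow> t \<in> S \<Longrightarrow> s * t \<in> S"
    and SR: "S \<subseteq> R" and disj: "I \<inter> S = {}"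
  shows "\<exists>P. diff_ideal P \<and> I \<subseteq> P \<and> P \<inter> S = {} \<and> (\<forall>a\<in>R. \<forall>b\<in>R. a * b \<in> P \<longrightarrow> a \<in> P \<or> b \<in> P)"
proof -
  define \<A> where "\<A> = {Q. diff_ideal Q \<and> I \<subseteq> Q \<and> Q \<inter> S = {}}"
  have "\<exists>P\<in>\<A>. \<forall>U\<in>\<A>. P \<subseteq> U \<longrightarrow> U = P"
  proof (rule subset_Zorn_nonempty)
    show "\<A> \<noteq> {}" using I disj by (auto simp: \<A>_def)
  next
    fix \<C> assume ne: "\<C> \<noteq> {}" and "subset.chain \<A> \<C>"
    then have sub: "\<And>Q. Q \<in> \<C> \<Longrightarrow> diff_ideal Q \<and> I \<subseteq> Q \<and> Q \<inter> S = {}"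
      and tot: "\<And>Q Q'. Q \<in> \<C> \<Longrightarrow> Q' \<in> \<C> \<Longrightarrow> Q \<subseteq> Q' \<or> Q' \<subseteq> Q"
      unfolding subset.chain_def \<A>_def by blast+
    have "diff_ideal (\<Union>\<C>)"
      unfolding diff_ideal_def
    proof (intro conjI ballI)
      fix x y assume "x \<in> \<Union>\<C>" "y \<in> \<Union>\<C>"
      then obtain Q Q' where Q: "Q \<in> \<C>" "x \<in> Q" "Q' \<in> \<C>" "y \<in> Q'" by blast
      then obtain U where "U \<in> \<C>" "x \<in> U" "y \<in> U" using tot by blast
      then show "x + y \<in> \<Union>\<C>" using sub unfolding diff_ideal_def by blast
    next
      show "\<Union>\<C> \<subseteq> R" using sub by (intro Union_least) (simp add: diff_ideal_def)
      show "0 \<in> \<Union>\<C>" using sub ne unfolding diff_ideal_def by blast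
    next
      fix r x assume "r \<in> R" "x \<in> \<Union>\<C>"
      then show "r * x \<in> \<Union>\<C>" using sub unfolding diff_ideal_def by blast
    next
      fix \<delta> x assume "\<delta> \<in> \<Delta>" "x \<in> \<Union>\<C>"
      then show "\<delta> x \<in> \<Union>\<C>" using sub unfolding diff_ideal_def by blast
    qed
    moreover have "I \<subseteq> \<Union>\<C>" "\<Union>\<C> \<inter> S = {}" using sub ne by blast+
    ultimately show "\<Union>\<C> \<in> \<A>" by (simp add: \<A>_def)
  qed
  then obtain P where P: "P \<in> \<A>" and max: "\<And>U. U \<in> \<A> \<Longrightarrow> P \<subseteq> U \<Longrightarrow> U = P" by blast
  have dP: "diff_ideal P" and IP: "I \<subseteq> P" and PS: "P \<inter> S = {}" using P by (auto simp: \<A>_def)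
  have Spow: "s ^ n \<in> S" if "s \<in> S" for s n
    using that S1 Smult by (induction n) auto
  have satS: "saturation P s = P" if s: "s \<in> S" for s
  proof (rule max)
    have "saturation P s \<inter> S = {}"
      using PS Spow[OF s] Smult unfolding saturation_def by blast
    moreover have "s \<in> R" using s SR by blast
    ultimately show "saturation P s \<in> \<A>"
      using diff_ideal_saturation[OF dP, of s] subset_saturation[OF dP, of s] IP
      by (simp add: \<A>_def)
  qed (use subset_saturation[OF dP] SR s in auto)
  have "radical P = P"
  proof (rule max)
    have "radical P \<inter> S = {}" using PS Spow unfolding radical_def by blast
    then show "radical P \<in> \<A>"
      using diff_ideal_radical[OF dP] subset_radical[OF dP] IP by (simp add: \<A>_def)
  qed (rule subset_radical[OF dP])
  then have rad: "x \<in> P" if "x \<in> R" "x ^ n \<in> P" for x n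
    using that unfolding radical_def by blast
  have "a \<in> P \<or> b \<in> P" if ab: "a \<in> R" "b \<in> R" "a * b \<in> P" for a b
  proof (cases "saturation P a \<inter> S = {}")
    case True
    then have "saturation P a = P"
      using diff_ideal_saturation[OF dP ab(1)] subset_saturation[OF dP ab(1)] IP
      by (intro max) (auto simp: \<A>_def)
    moreover have "b \<in> saturation P a" using ab by (auto simp: saturation_def intro!: exI[of _ 1])
    ultimately show ?thesis by simp
  next
    case False
    then obtain s n where s: "s \<in> S" "a ^ n * s \<in> P" by (auto simp: saturation_def)
    then have "a ^ n \<in> saturation P s"
      using power_closed[OF ab(1)] by (auto simp: saturation_def algebra_simps intro!: exI[of _ 1])
    then show ?thesis using satS[OF s(1)] rad[OF ab(1)] by auto
  qed
  with dP IP PS show ?thesis by blast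
qed

end

section \<open>Weighted degrees and counting of monomials\<close>

abbreviation Mon :: "('i \<Rightarrow>\<^sub>0 nat) \<Rightarrow> ('i, 'k::comm_ring_1) spoly" where
  "Mon m \<equiv> Poly_Mapping.single m 1"

lemma spoly_eq_sum: "p = (\<Sum>m\<in>Poly_Mapping.keys p. Const (Poly_Mapping.lookup p m) * Mon m)"
  by (intro poly_mapping_eqI)
    (auto simp: Const_def mult_single lookup_sum lookup_single when_def in_keys_iff)

lemma keys_subset_vars: "m \<in> Poly_Mapping.keys p \<Longrightarrow> Poly_Mapping.keys m \<subseteq> vars p"
  by (auto simp: vars_def)

text \<open>
  The weighted degree of a monomial.  Weight \<open>1\<close> for every variable gives the total degree; other
  weights will replace monomial orders.
\<close>

definition wt :: "('i \<Rightarrow> nat) \<Rightarrow> ('i \<Rightarrow>\<^sub>0 nat) \<Rightarrow> nat" where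
  "wt w m = (\<Sum>i\<in>Poly_Mapping.keys m. w i * Poly_Mapping.lookup m i)"

lemma wt_superset:
  assumes "finite S" "Poly_Mapping.keys m \<subseteq> S"
  shows "wt w m = (\<Sum>i\<in>S. w i * Poly_Mapping.lookup m i)"
  unfolding wt_def using assms by (intro sum.mono_neutral_left) (auto simp: in_keys_iff)

lemma wt_zero [simp]: "wt w 0 = 0"
  by (simp add: wt_def)

lemma wt_single [simp]: "wt w (Poly_Mapping.single i n) = w i * n"
  by (subst wt_superset[of "{i}"]) auto

lemma wt_add: "wt w (m + m') = wt w m + wt w m'"
proof -
  let ?S = "Poly_Mapping.keys m \<union> Poly_Mapping.keys m'"
  have "Poly_Mapping.keys (m + m') \<subseteq> ?S" by (rule keys_add)
  then show ?thesis
    by (simp add: wt_superset[of ?S] lookup_add distrib_left sum.distrib)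
qed

lemma lookup_le_wt:
  assumes "1 \<le> w i" shows "Poly_Mapping.lookup m i \<le> wt w m"
proof (cases "i \<in> Poly_Mapping.keys m")
  case True
  have "Poly_Mapping.lookup m i \<le> w i * Poly_Mapping.lookup m i" using assms by simp
  also have "\<dots> \<le> wt w m" unfolding wt_def using True by (intro member_le_sum) auto
  finally show ?thesis .
qed (simp add: in_keys_iff)

definition polys_upto :: "('i \<Rightarrow> nat) \<Rightarrow> 'i set \<Rightarrow> nat \<Rightarrow> ('i, 'k::comm_ring_1) spoly set" where
  "polys_upto w G d = {p. vars p \<subseteq> G \<and> (\<forall>m\<in>Poly_Mapping.keys p. wt w m \<le> d)}"

lemma polys_upto_mono: "p \<in> polys_upto w G d \<Longrightarrow> d \<le> d' \<Longrightarrow> p \<in> polys_upto w G d'"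
  unfolding polys_upto_def using le_trans by blast

lemma polys_upto_add:
  assumes "p \<in> polys_upto w G d" "q \<in> polys_upto w G d" shows "p + q \<in> polys_upto w G d"
  using assms vars_add[of p q] keys_add[of p q] unfolding polys_upto_def by blast

lemma polys_upto_mult:
  assumes "p \<in> polys_upto w G d" "q \<in> polys_upto w G d'"
  shows "p * q \<in> polys_upto w G (d + d')"
  unfolding polys_upto_def
proof (intro CollectI conjI ballI)
  show "vars (p * q) \<subseteq> G" using assms vars_mult[of p q] by (auto simp: polys_upto_def)
  fix m assume "m \<in> Poly_Mapping.keys (p * q)"
  then obtain a b where "m = a + b" "a \<in> Poly_Mapping.keys p" "b \<in> Poly_Mapping.keys q"
    using keys_mult[of p q] by auto
  then show "wt w m \<le> d + d'" using assms by (auto simp: polys_upto_def wt_add intro: add_mono)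
qed

lemma polys_upto_Const: "Const c \<in> polys_upto w G d"
  by (auto simp: polys_upto_def Const_def vars_def split: if_splits)

lemma polys_upto_power:
  assumes "p \<in> polys_upto w G d" shows "p ^ n \<in> polys_upto w G (n * d)"
proof (induction n)
  case 0
  show ?case using polys_upto_Const[of 1] by (simp add: Const_simps)
next
  case (Suc n)
  then show ?case using polys_upto_mult[OF assms Suc] by simp
qed

lemma ex_polys_upto:
  assumes "vars p \<subseteq> G" shows "\<exists>d. p \<in> polys_upto w G d"
  using assms
  by (intro exI[of _ "\<Sum>m\<in>Poly_Mapping.keys p. wt w m"])
    (auto simp: polys_upto_def intro: member_le_sum)

definition monomials :: "'i set \<Rightarrow> ('i \<Rightarrow> nat set) \<Rightarrow> ('i \<Rightarrow>\<^sub>0 nat) set" where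
  "monomials V F = {m. Poly_Mapping.keys m \<subseteq> V \<and> (\<forall>i\<in>V. Poly_Mapping.lookup m i \<in> F i)}"

text \<open>
  The monomials with exponents in a given box are counted as functions on the finite set of
  variables.
\<close>

lemma bij_betw_monomials_PiE:
  assumes "finite V"
  shows "bij_betw (\<lambda>m. restrict (Poly_Mapping.lookup m) V) (monomials V F) (PiE V F)"
proof (rule bij_betw_imageI)
  show "inj_on (\<lambda>m. restrict (Poly_Mapping.lookup m) V) (monomials V F)"
  proof (rule inj_onI)
    fix m m' assume m: "m \<in> monomials V F" "m' \<in> monomials V F"
      and eq: "restrict (Poly_Mapping.lookup m) V = restrict (Poly_Mapping.lookup m') V"
    show "m = m'"
    proof (rule poly_mapping_eqI)
      fix i
      show "Poly_Mapping.lookup m i = Poly_Mapping.lookup m' i"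
      proof (cases "i \<in> V")
        case True
        then show ?thesis using fun_cong[OF eq, of i] by simp
      next
        case False
        then have "i \<notin> Poly_Mapping.keys m" "i \<notin> Poly_Mapping.keys m'" using m by (auto simp: monomials_def)
        then show ?thesis by (simp add: in_keys_iff)
      qed
    qed
  qed
next
  have "\<exists>m\<in>monomials V F. f = restrict (Poly_Mapping.lookup m) V" if f: "f \<in> PiE V F" for f
  proof -
    define m where "m = Abs_poly_mapping (\<lambda>i. if i \<in> V then f i else 0)"
    have "finite {i. (if i \<in> V then f i else 0) \<noteq> 0}"
      by (rule finite_subset[OF _ assms]) auto
    then have l: "Poly_Mapping.lookup m i = (if i \<in> V then f i else 0)" for i
      unfolding m_def by (subst lookup_Abs_poly_mapping) auto
    have "Poly_Mapping.keys m \<subseteq> V" by (auto simp: in_keys_iff l split: if_splits)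
    then have "m \<in> monomials V F" using f by (auto simp: monomials_def l)
    moreover have "f = restrict (Poly_Mapping.lookup m) V"
      using f by (auto simp: fun_eq_iff l PiE_def extensional_def)
    ultimately show ?thesis by blast
  qed
  then show "(\<lambda>m. restrict (Poly_Mapping.lookup m) V) ` monomials V F = PiE V F"
    by (auto simp: monomials_def)
qed

lemma card_monomials: "finite V \<Longrightarrow> card (monomials V F) = (\<Prod>i\<in>V. card (F i))"
  using bij_betw_same_card[OF bij_betw_monomials_PiE] card_PiE by metis

lemma finite_monomials: "finite V \<Longrightarrow> (\<And>i. i \<in> V \<Longrightarrow> finite (F i)) \<Longrightarrow> finite (monomials V F)"
  using bij_betw_finite[OF bij_betw_monomials_PiE] finite_PiE by metis

lemma power_count_lt:
  fixes a g t :: nat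
  assumes "g < t"
  shows "\<exists>n. (a * n + 1) ^ g < (n + 1) ^ t"
proof (intro exI)
  let ?n = "(a + 1) ^ g"
  have "(a * ?n + 1) ^ g \<le> ((a + 1) * (?n + 1)) ^ g"
    by (intro power_mono) (simp_all add: algebra_simps)
  also have "\<dots> = ?n * (?n + 1) ^ g" by (simp only: power_mult_distrib)
  also have "\<dots> < (?n + 1) * (?n + 1) ^ g" by (intro mult_strict_right_mono) simp_all
  also have "\<dots> = (?n + 1) ^ Suc g" by simp
  also have "\<dots> \<le> (?n + 1) ^ t" using assms by (intro power_increasing) auto
  finally show "(a * ?n + 1) ^ g < (?n + 1) ^ t" .
qed

section \<open>Dependence of many variables over few\<close>

text \<open>
  Gaussian elimination: the unknowns are indexed by \<open>A\<close>, the equations by \<open>B\<close>.  A family is used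
  in place of a set of vectors because the columns need not be distinct.
\<close>

lemma homogeneous_system_solvable:
  fixes M :: "'a \<Rightarrow> 'b \<Rightarrow> 'k::field"
  assumes "finite B" "finite A" "card B < card A"
  shows "\<exists>c. (\<exists>a\<in>A. c a \<noteq> 0) \<and> (\<forall>b\<in>B. (\<Sum>a\<in>A. c a * M a b) = 0)"
  using assms
proof (induction B arbitrary: A M rule: finite_induct)
  case empty
  then have "A \<noteq> {}" by auto
  then show ?case by (auto intro!: exI[of _ "\<lambda>_. 1"])
next
  case (insert b B)
  show ?case
  proof (cases "\<forall>a\<in>A. M a b = 0")
    case True
    have "card B < card A" using insert by auto
    from insert.IH[OF insert.prems(1) this, of M] obtain c where
      c: "\<exists>a\<in>A. c a \<noteq> 0" "\<forall>b\<in>B. (\<Sum>a\<in>A. c a * M a b) = 0" by blast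
    moreover have "(\<Sum>a\<in>A. c a * M a b) = 0" using True by (intro sum.neutral) simp
    ultimately show ?thesis by blast
  next
    case False
    then obtain p where p: "p \<in> A" "M p b \<noteq> 0" by blast
    define M' where "M' a b' = M a b' - M a b / M p b * M p b'" for a b'
    have "card B < card (A - {p})" using insert p by auto
    from insert.IH[OF _ this, of M'] insert.prems(1) obtain c where
      c: "\<exists>a\<in>A-{p}. c a \<noteq> 0" "\<And>b'. b' \<in> B \<Longrightarrow> (\<Sum>a\<in>A-{p}. c a * M' a b') = 0" by auto
    define s where "s = (\<Sum>a\<in>A-{p}. c a * M a b) / M p b"
    define d where "d = c(p := - s)"
    have eq: "(\<Sum>a\<in>A. d a * M a b') = (\<Sum>a\<in>A-{p}. c a * M a b') - s * M p b'" for b'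
    proof -
      have "(\<Sum>a\<in>A. d a * M a b') = d p * M p b' + (\<Sum>a\<in>A-{p}. d a * M a b')"
        using p insert.prems(1) by (simp add: sum.remove)
      also have "(\<Sum>a\<in>A-{p}. d a * M a b') = (\<Sum>a\<in>A-{p}. c a * M a b')"
        by (intro sum.cong) (auto simp: d_def)
      finally show ?thesis by (simp add: d_def)
    qed
    have "(\<Sum>a\<in>A. d a * M a b') = (\<Sum>a\<in>A-{p}. c a * M' a b')" for b'
    proof -
      have "s * M p b' = (\<Sum>a\<in>A-{p}. c a * (M a b / M p b * M p b'))"
        unfolding s_def sum_divide_distrib sum_distrib_right by (intro sum.cong) simp_all
      then show ?thesis
        unfolding eq M'_def right_diff_distrib sum_subtractf by simp
    qed
    moreover have "M' a b = 0" for a using p by (simp add: M'_def)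
    ultimately have "\<forall>b'\<in>insert b B. (\<Sum>a\<in>A. d a * M a b') = 0" using c(2) by auto
    moreover have "\<exists>a\<in>A. d a \<noteq> 0" using c(1) by (auto simp: d_def)
    ultimately show ?thesis by blast
  qed
qed

text \<open>
  Suppose that modulo the prime ideal \<open>P\<close> every variable in \<open>T\<close> becomes a polynomial in the
  variables in \<open>G\<close> after inverting \<open>H\<close>.  The ring \<open>K[T]\<close> then maps into a localisation of \<open>K[G]\<close>,
  and for \<open>card G < card T\<close> this map cannot be injective.  In place of a theory of transcendence
  degrees, monomials are counted: those in \<open>T\<close> with exponents at most \<open>n\<close> number
  \<open>(n + 1)\<^bsup>card T\<^esup>\<close>, and after multiplication by a common power of \<open>H\<close> they are congruent to
  polynomials of degree \<open>O(n)\<close> in \<open>card G\<close> variables.  For large \<open>n\<close> a linear relation between the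
  latter gives a multiple of some \<open>q \<in> K[T]\<close> by a power of \<open>H\<close> that lies in \<open>P\<close>; since \<open>P\<close> is
  prime, \<open>q \<in> P\<close>.
\<close>

lemma prime_ideal_meets_subring:
  fixes P :: "('i, 'k::field) spoly set" and H :: "('i, 'k) spoly"
  assumes P0: "0 \<in> P" and Padd: "\<And>x y. x \<in> P \<Longrightarrow> y \<in> P \<Longrightarrow> x + y \<in> P"
    and Pmult: "\<And>r x. vars r \<subseteq> J \<Longrightarrow> x \<in> P \<Longrightarrow> r * x \<in> P"
    and Pprime: "\<And>a b. vars a \<subseteq> J \<Longrightarrow> vars b \<subseteq> J \<Longrightarrow> a * b \<in> P \<Longrightarrow> a \<in> P \<or> b \<in> P"
    and one: "1 \<notin> P"
    and G: "finite G" "G \<subseteq> J" and H: "vars H \<subseteq> G" "H \<notin> P"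
    and T: "finite T" "T \<subseteq> J" "card G < card T"
    and frac: "\<And>i. i \<in> T \<Longrightarrow> \<exists>r p. vars p \<subseteq> G \<and> H ^ r * Var i - p \<in> P"
  shows "\<exists>q. q \<noteq> 0 \<and> vars q \<subseteq> T \<and> q \<in> P"
proof -
  let ?w = "\<lambda>_::'i. 1::nat"
  have VarJ: "vars (Var i :: ('i,'k) spoly) \<subseteq> J" if "i \<in> T" for i using that T by auto
  have vpow: "vars (p ^ n) \<subseteq> K" if "vars p \<subseteq> K" for p :: "('i,'k) spoly" and n K
    using that vars_mult by (induction n) (simp, fastforce)
  have pow: "H ^ n \<notin> P" for n
  proof (induction n)
    case (Suc n)
    then show ?case using Pprime[of H "H ^ n"] vpow[of H J n] H G by auto
  qed (use one in simp)
  obtain r p where rp: "\<And>i. i \<in> T \<Longrightarrow> vars (p i) \<subseteq> G \<and> H ^ r i * Var i - p i \<in> P"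
    using frac by metis
  \<comment> \<open>A common denominator for all variables in \<open>T\<close>.\<close>
  define s where "s = (\<Sum>i\<in>T. r i)"
  define h where "h = H ^ s"
  have h: "vars h \<subseteq> G" "h \<notin> P" using pow vpow H by (auto simp: h_def)
  have "\<exists>p. vars p \<subseteq> G \<and> h * Var i - p \<in> P" if i: "i \<in> T" for i
  proof -
    have "r i \<le> s" using i T unfolding s_def by (intro member_le_sum) auto
    then have "h = H ^ (s - r i) * H ^ r i" by (simp add: h_def power_add [symmetric])
    then have "h * Var i - H ^ (s - r i) * p i = H ^ (s - r i) * (H ^ r i * Var i - p i)"
      by (simp add: algebra_simps)
    also have "\<dots> \<in> P" using rp[OF i] vpow[of H J] H G by (intro Pmult) auto
    finally show ?thesis
      using vars_mult[of "H ^ (s - r i)" "p i"] vpow[of H G "s - r i"] H rp[OF i] by blast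
  qed
  then obtain p where p: "\<And>i. i \<in> T \<Longrightarrow> vars (p i) \<subseteq> G" "\<And>i. i \<in> T \<Longrightarrow> h * Var i - p i \<in> P"
    by metis
  have "\<forall>i\<in>T. \<exists>d. p i \<in> polys_upto ?w G d" using ex_polys_upto[OF p(1)] by blast
  from bchoice[OF this] obtain d where d: "\<And>i. i \<in> T \<Longrightarrow> p i \<in> polys_upto ?w G (d i)" by blast
  obtain d' where d': "h \<in> polys_upto ?w G d'" using ex_polys_upto h by blast
  define D where "D = (\<Sum>i\<in>T. d i) + d'"
  have pD: "p i \<in> polys_upto ?w G D" if "i \<in> T" for i
    using d[OF that] member_le_sum[of i T d] T that
    by (elim polys_upto_mono) (auto simp: D_def)
  have hD: "h \<in> polys_upto ?w G D" using d' by (rule polys_upto_mono) (simp add: D_def)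
  \<comment> \<open>Each of the \<open>N\<close> factors \<open>h\<close> absorbs the denominator of one variable of the monomial, so
    a monomial of degree at most \<open>N\<close> costs degree at most \<open>N * D\<close>.\<close>
  have red: "\<exists>q\<in>polys_upto ?w G (N * D). h ^ N * Mon m - q \<in> P"
    if "Poly_Mapping.keys m \<subseteq> T" "wt ?w m \<le> N" for N m
    using that
  proof (induction N arbitrary: m)
    case 0
    have "m = 0"
    proof (rule poly_mapping_eqI)
      fix i show "Poly_Mapping.lookup m i = Poly_Mapping.lookup 0 i"
        using lookup_le_wt[of ?w i m] 0 by simp
    qed
    then show ?case
      using P0 polys_upto_Const[of 1 ?w G 0] by (intro bexI[of _ 1]) (simp_all add: Const_simps)
  next
    case (Suc N)
    show ?case
    proof (cases "m = 0")
      case True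
      then show ?thesis
        using P0 polys_upto_power[OF hD, of "Suc N"] by (intro bexI[of _ "h ^ Suc N"]) simp_all
    next
      case False
      then obtain i where i: "i \<in> Poly_Mapping.keys m" by (metis keys_eq_empty all_not_in_conv)
      define m' where "m' = m - Poly_Mapping.single i 1"
      have m: "m = m' + Poly_Mapping.single i 1"
        using i unfolding m'_def
        by (intro poly_mapping_eqI) (auto simp: lookup_add lookup_minus lookup_single when_def in_keys_iff)
      have iT: "i \<in> T" using i Suc.prems by auto
      have "Poly_Mapping.keys m' \<subseteq> Poly_Mapping.keys m"
        by (auto simp: m'_def in_keys_iff lookup_minus)
      moreover have "wt ?w m' \<le> N" using Suc.prems(2) unfolding m wt_add by simp
      ultimately obtain q where q: "q \<in> polys_upto ?w G (N * D)" "h ^ N * Mon m' - q \<in> P"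
        using Suc.IH[of m'] Suc.prems(1) by blast
      have mm: "(Mon m :: ('i,'k) spoly) = Mon m' * Var i" by (simp add: m Var_def mult_single)
      have "h ^ Suc N * Mon m - p i * q = (h * Var i) * (h ^ N * Mon m' - q) + q * (h * Var i - p i)"
        unfolding mm by (simp add: algebra_simps)
      also have "\<dots> \<in> P"
      proof (intro Padd Pmult q(2) p(2) iT)
        show "vars (h * Var i) \<subseteq> J" using vars_mult[of h "Var i"] h G VarJ[OF iT] by blast
        show "vars q \<subseteq> J" using q(1) G by (auto simp: polys_upto_def)
      qed
      finally show ?thesis
        using polys_upto_mult[OF pD[OF iT] q(1)] by (intro bexI[of _ "p i * q"]) simp_all
    qed
  qed
  obtain n where n: "(card T * D * n + 1) ^ card G < (n + 1) ^ card T"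
    using power_count_lt[OF T(3)] by blast
  define N where "N = card T * n"
  let ?A = "monomials T (\<lambda>_. {..n})" and ?B = "monomials G (\<lambda>_. {..N * D})"
  have fin: "finite ?A" "finite ?B" using T G by (auto intro: finite_monomials)
  have "card ?B < card ?A"
    using n T G by (simp add: card_monomials N_def algebra_simps)
  have "\<exists>q\<in>polys_upto ?w G (N * D). h ^ N * Mon m - q \<in> P" if m: "m \<in> ?A" for m
  proof (rule red)
    show k: "Poly_Mapping.keys m \<subseteq> T" using m by (auto simp: monomials_def)
    have "wt ?w m = (\<Sum>i\<in>T. Poly_Mapping.lookup m i)" using wt_superset[OF T(1) k, of ?w] by simp
    also have "\<dots> \<le> (\<Sum>i\<in>T. n)" using m by (intro sum_mono) (auto simp: monomials_def)
    finally show "wt ?w m \<le> N" by (simp add: N_def)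
  qed
  then obtain Q where Q: "\<And>m. m \<in> ?A \<Longrightarrow> Q m \<in> polys_upto ?w G (N * D)"
    "\<And>m. m \<in> ?A \<Longrightarrow> h ^ N * Mon m - Q m \<in> P" by metis
  obtain c where c: "\<exists>a\<in>?A. c a \<noteq> 0" "\<And>b. b \<in> ?B \<Longrightarrow> (\<Sum>a\<in>?A. c a * Poly_Mapping.lookup (Q a) b) = 0"
    using homogeneous_system_solvable[OF fin(2,1) \<open>card ?B < card ?A\<close>,
        of "\<lambda>a b. Poly_Mapping.lookup (Q a) b"] by blast
  have keysQ: "Poly_Mapping.keys (Q a) \<subseteq> ?B" if "a \<in> ?A" for a
    using Q(1)[OF that] lookup_le_wt[of ?w]
    by (fastforce simp: polys_upto_def monomials_def vars_def intro: order_trans)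
  have zero: "(\<Sum>a\<in>?A. Const (c a) * Q a) = 0"
  proof (rule poly_mapping_eqI)
    fix b
    have l: "Poly_Mapping.lookup (Const k * q) b = k * Poly_Mapping.lookup q b" for k and q :: "('i,'k) spoly"
    proof -
      have "Const k * q = Poly_Mapping.map ((*) k) q"
        unfolding Const_def by (rule mult_map_scale_conv_mult[symmetric])
      then show ?thesis by (simp add: Poly_Mapping.map.rep_eq when_def)
    qed
    have "Poly_Mapping.lookup (\<Sum>a\<in>?A. Const (c a) * Q a) b = (\<Sum>a\<in>?A. c a * Poly_Mapping.lookup (Q a) b)"
      by (simp add: lookup_sum l)
    also have "\<dots> = 0"
    proof (cases "b \<in> ?B")
      case False
      then have "Poly_Mapping.lookup (Q a) b = 0" if "a \<in> ?A" for a
        using keysQ[OF that] by (meson in_keys_iff subsetD)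
      then show ?thesis by (intro sum.neutral) simp
    qed (rule c(2))
    finally show "Poly_Mapping.lookup (\<Sum>a\<in>?A. Const (c a) * Q a) b = Poly_Mapping.lookup 0 b" by simp
  qed
  define q where "q = (\<Sum>a\<in>?A. Const (c a) * Mon a)"
  have lq: "Poly_Mapping.lookup q a = c a" if "a \<in> ?A" for a
    using that fin(1) by (simp add: q_def Const_def mult_single lookup_sum lookup_single when_def)
  have vq: "vars q \<subseteq> T"
    unfolding q_def by (rule vars_sum) (auto simp: Const_def mult_single vars_def monomials_def split: if_splits)
  have Psum: "sum f A \<in> P" if "\<And>a. a \<in> A \<Longrightarrow> f a \<in> P" for f and A :: "('i \<Rightarrow>\<^sub>0 nat) set"
    using that by (induction A rule: infinite_finite_induct) (auto simp: P0 Padd)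
  have "h ^ N * q = (\<Sum>a\<in>?A. Const (c a) * (h ^ N * Mon a - Q a)) + (\<Sum>a\<in>?A. Const (c a) * Q a)"
    unfolding q_def sum.distrib[symmetric] sum_distrib_left
    by (intro sum.cong refl) (simp add: algebra_simps)
  also have "\<dots> \<in> P" unfolding zero using Q(2) by (auto intro!: Psum Pmult)
  finally have "q \<in> P"
    using Pprime[of "h ^ N" q] pow[of "s * N"] vpow[of H J] H G vq T
    unfolding h_def power_mult[symmetric] by blast
  moreover have "q \<noteq> 0" using c(1) lq by force
  ultimately show ?thesis using vq by blast
qed

section \<open>The recurrence coming from the Witt bracket\<close>

lemma lookup_pdiff:
  fixes p :: "('i, 'k::comm_ring_1) spoly"
  shows "Poly_Mapping.lookup (pdiff i p) m =
    of_nat (Poly_Mapping.lookup m i + 1) * Poly_Mapping.lookup p (m + Poly_Mapping.single i 1)"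
proof -
  let ?e = "Poly_Mapping.single i (1::nat)"
  have "Poly_Mapping.lookup (pdiff i p) m = (\<Sum>m'\<in>Poly_Mapping.keys p.
      if m' = m + ?e then of_nat (Poly_Mapping.lookup m' i) * Poly_Mapping.lookup p m' else 0)"
    unfolding pdiff_def lookup_sum
  proof (intro sum.cong refl)
    fix m'
    show "Poly_Mapping.lookup (Poly_Mapping.single (m' - ?e)
        (of_nat (Poly_Mapping.lookup m' i) * Poly_Mapping.lookup p m')) m =
      (if m' = m + ?e then of_nat (Poly_Mapping.lookup m' i) * Poly_Mapping.lookup p m' else 0)"
    proof (cases "Poly_Mapping.lookup m' i = 0")
      case True
      then show ?thesis unfolding True by simp
    next
      case False
      have "m' - ?e = m \<longleftrightarrow> m' = m + ?e"
      proof
        assume "m' - ?e = m"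
        moreover have "m' = (m' - ?e) + ?e"
          using False
          by (intro poly_mapping_eqI) (auto simp: lookup_add lookup_minus lookup_single when_def)
        ultimately show "m' = m + ?e" by simp
      qed simp
      then show ?thesis by (simp add: lookup_single when_def)
    qed
  qed
  also have "\<dots> = of_nat (Poly_Mapping.lookup m i + 1) * Poly_Mapping.lookup p (m + ?e)"
    by (auto simp: sum.delta' in_keys_iff lookup_add)
  finally show ?thesis .
qed

lemma pdiff_nonzero:
  fixes p :: "('i, 'k::field_char_0) spoly"
  assumes "i \<in> vars p" shows "pdiff i p \<noteq> 0"
proof -
  obtain m where m: "m \<in> Poly_Mapping.keys p" "i \<in> Poly_Mapping.keys m"
    using assms by (auto simp: vars_def)
  define m' where "m' = m - Poly_Mapping.single i 1"
  have "m = m' + Poly_Mapping.single i 1"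
    using m(2) unfolding m'_def
    by (intro poly_mapping_eqI) (auto simp: lookup_add lookup_minus lookup_single when_def in_keys_iff)
  then have "Poly_Mapping.lookup p (m' + Poly_Mapping.single i 1) \<noteq> 0"
    using m(1) by (auto simp: in_keys_iff)
  moreover have "of_nat (Poly_Mapping.lookup m' i + 1) \<noteq> (0::'k)"
    unfolding of_nat_eq_0_iff by simp
  ultimately have "Poly_Mapping.lookup (pdiff i p) m' \<noteq> 0"
    unfolding lookup_pdiff by (rule no_zero_divisors[rotated])
  then show ?thesis by auto
qed

lemma vars_empty_imp_Const:
  assumes "vars p = {}" shows "p = Const (Poly_Mapping.lookup p 0)"
proof (rule poly_mapping_eqI)
  fix m
  have "Poly_Mapping.keys p \<subseteq> {0}" using assms by (auto simp: vars_def)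
  then show "Poly_Mapping.lookup p m = Poly_Mapping.lookup (Const (Poly_Mapping.lookup p 0)) m"
    by (auto simp: Const_def lookup_single when_def in_keys_iff)
qed

text \<open>
  Differentiating a nonzero polynomial repeatedly leads to a nonzero constant, so some derivative
  is the last one in \<open>P\<close>.
\<close>

lemma ex_derivative_leaving:
  fixes f :: "('i, 'k::field_char_0) spoly"
  assumes "f \<in> P" "f \<noteq> 0" and "\<And>c. c \<noteq> 0 \<Longrightarrow> Const c \<notin> P"
  shows "\<exists>g i. g \<in> P \<and> vars g \<subseteq> vars f \<and> pdiff i g \<notin> P"
proof -
  let ?w = "\<lambda>_::'i. 1::nat"
  obtain d where "f \<in> polys_upto ?w (vars f) d" using ex_polys_upto by blast
  then show ?thesis using assms(1,2)
  proof (induction d arbitrary: f rule: less_induct)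
    case (less d)
    have "vars f \<noteq> {}"
    proof
      assume "vars f = {}"
      then have "f = Const (Poly_Mapping.lookup f 0)" by (rule vars_empty_imp_Const)
      then show False using less.prems(2,3) assms(3) by (metis Const_simps(5))
    qed
    then obtain i where i: "i \<in> vars f" by blast
    show ?case
    proof (cases "pdiff i f \<in> P")
      case False
      then show ?thesis using less.prems by blast
    next
      case True
      have lt: "wt ?w m < d" if m: "m \<in> Poly_Mapping.keys (pdiff i f)" for m
      proof -
        have "m + Poly_Mapping.single i 1 \<in> Poly_Mapping.keys f"
          using m by (auto simp: in_keys_iff lookup_pdiff)
        then have "wt ?w (m + Poly_Mapping.single i 1) \<le> d"
          using less.prems(1) by (auto simp: polys_upto_def)
        then show ?thesis by (simp add: wt_add)
      qed
      have nz: "pdiff i f \<noteq> 0" using pdiff_nonzero[OF i] .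
      then obtain m where "m \<in> Poly_Mapping.keys (pdiff i f)" by (metis keys_eq_empty all_not_in_conv)
      then have "d - 1 < d" using lt by fastforce
      moreover have "pdiff i f \<in> polys_upto ?w (vars (pdiff i f)) (d - 1)"
        using lt by (fastforce simp: polys_upto_def)
      ultimately show ?thesis
        using less.IH[OF _ _ True nz] vars_pdiff[of i f] by blast
    qed
  qed
qed

text \<open>
  The common features of the three Lie algebras.  The basis vectors \<open>\<epsilon> n\<close> with \<open>n \<in> N\<close> obey the
  Witt relation up to a term in the variables with index in \<open>C\<close>, which is empty or consists of
  the central charge.  The last two assumptions hold for the integers and for the positive integers;
  \<open>k - i\<close> is the index \<open>n\<close> for which \<open>{\<epsilon> n, \<epsilon> i}\<close> is a multiple of \<open>\<epsilon> k\<close> up to such a term.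
\<close>

locale witt_type =
  fixes br :: "'i \<Rightarrow> 'i \<Rightarrow> ('i \<Rightarrow>\<^sub>0 'k::field_char_0)"
    and \<epsilon> :: "int \<Rightarrow> 'i" and N :: "int set" and C :: "'i set"
  assumes inj_\<epsilon>: "inj \<epsilon>" and finite_C: "finite C"
    and bracket: "\<lbrakk> n \<in> N; i \<in> N \<rbrakk> \<Longrightarrow>
      \<exists>z. vars z \<subseteq> C \<and> lin (br (\<epsilon> n) (\<epsilon> i)) = Const (of_int (i - n)) * Var (\<epsilon> (n + i)) + z"
    and bracket_closed: "\<lbrakk> x \<in> C \<union> \<epsilon> ` N; y \<in> C \<union> \<epsilon> ` N \<rbrakk> \<Longrightarrow> Poly_Mapping.keys (br x y) \<subseteq> C \<union> \<epsilon> ` N"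
    and N_add: "\<lbrakk> n \<in> N; i \<in> N \<rbrakk> \<Longrightarrow> n + i \<in> N"
    and N_diff: "\<lbrakk> k \<in> N; i \<in> N; 2 * \<bar>i\<bar> < \<bar>k\<bar> \<rbrakk> \<Longrightarrow> k - i \<in> N"
begin

definition indices :: "'i set" where "indices = C \<union> \<epsilon> ` N"

text \<open>
  With \<open>M\<close> the sum below, all variables of \<open>f\<close> have index in \<open>[- M, M]\<close>.  Solving a recurrence for
  \<open>\<epsilon> k\<close> uses \<open>n = k - i\<close> with \<open>\<bar>i\<bar> \<le> M\<close>, and \<open>\<bar>k\<bar> > 2 M\<close> guarantees both that the coefficient
  \<open>i - n\<close> of \<open>\<epsilon> k\<close> is nonzero and that the other indices in the recurrence have the same sign as
  \<open>k\<close>.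
\<close>

definition window :: "('i, 'k) spoly \<Rightarrow> 'i set" where
  "window f = C \<union> \<epsilon> ` {k \<in> N. \<bar>k\<bar> \<le> 2 * (\<Sum>i | \<epsilon> i \<in> vars f. \<bar>i\<bar>)}"

lemma finite_vars_preimage: "finite {i. \<epsilon> i \<in> vars f}"
  using finite_vimageI[OF finite_vars inj_\<epsilon>, of f] by (simp add: vimage_def)

lemma finite_window: "finite (window f)"
proof -
  have "finite {k. \<bar>k\<bar> \<le> n}" for n :: int
    by (rule finite_subset[of _ "{-n..n}"]) auto
  then show ?thesis by (simp add: window_def finite_C)
qed

lemma window_subset: "window f \<subseteq> indices"
  by (auto simp: window_def indices_def)

lemma vars_subset_window:
  assumes "vars f \<subseteq> \<epsilon> ` N" shows "vars f \<subseteq> window f"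
proof
  fix x assume x: "x \<in> vars f"
  then obtain i where i: "i \<in> N" "x = \<epsilon> i" using assms by auto
  have "\<bar>i\<bar> \<le> (\<Sum>i | \<epsilon> i \<in> vars f. \<bar>i\<bar>)"
    using finite_vars_preimage x i by (intro member_le_sum) auto
  then show "x \<in> window f" using i by (auto simp: window_def)
qed

lemma bracket_Var:
  assumes n: "n \<in> N" and S: "finite S" "S \<subseteq> N" "vars g \<subseteq> \<epsilon> ` S"
  shows "\<exists>z. (\<forall>i. vars (z i) \<subseteq> C) \<and> lie_poisson br (Var (\<epsilon> n)) g =
    (\<Sum>i\<in>S. pdiff (\<epsilon> i) g * (Const (of_int (i - n)) * Var (\<epsilon> (n + i)) + z i))"
proof -
  have "\<forall>i. \<exists>z. vars z \<subseteq> C \<and> (i \<in> N \<longrightarrow>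
      lin (br (\<epsilon> n) (\<epsilon> i)) = Const (of_int (i - n)) * Var (\<epsilon> (n + i)) + z)"
    using bracket[OF n] vars_zero by (metis empty_subsetI)
  then obtain z where z: "\<And>i. vars (z i) \<subseteq> C"
    "\<And>i. i \<in> N \<Longrightarrow> lin (br (\<epsilon> n) (\<epsilon> i)) = Const (of_int (i - n)) * Var (\<epsilon> (n + i)) + z i"
    by metis
  have "lie_poisson br (Var (\<epsilon> n)) g =
      (\<Sum>x\<in>{\<epsilon> n}. \<Sum>j\<in>\<epsilon> ` S. pdiff x (Var (\<epsilon> n)) * pdiff j g * lin (br x j))"
    using S by (intro lie_poisson_superset) auto
  also have "\<dots> = (\<Sum>j\<in>\<epsilon> ` S. pdiff j g * lin (br (\<epsilon> n) j))"
    by (simp add: pdiff_Var)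
  also have "\<dots> = (\<Sum>i\<in>S. pdiff (\<epsilon> i) g * lin (br (\<epsilon> n) (\<epsilon> i)))"
    using inj_\<epsilon> by (subst sum.reindex) (auto intro: inj_on_subset)
  also have "\<dots> = (\<Sum>i\<in>S. pdiff (\<epsilon> i) g * (Const (of_int (i - n)) * Var (\<epsilon> (n + i)) + z i))"
    using S z(2) by (intro sum.cong refl) auto
  finally show ?thesis using z(1) by blast
qed

text \<open>
  This is the heart of the argument.  Choose \<open>g \<in> P\<close>, an iterated derivative of \<open>f\<close>, that has a
  partial derivative outside \<open>P\<close>, and let \<open>a\<close> and \<open>b\<close> be the least and the greatest index \<open>i\<close> with
  \<open>\<partial>\<^sub>i g \<notin> P\<close>.  Modulo \<open>P\<close> and up to terms in the window the elements
  \<open>{\<epsilon> n, g} = \<Sum>\<^sub>i (i - n) \<partial>\<^sub>i g \<epsilon>(n + i)\<close> of \<open>P\<close> form a linear recurrence for the variables \<open>\<epsilon> k\<close>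
  whose extreme coefficients are, up to integers, \<open>\<partial>\<^sub>a g\<close> and \<open>\<partial>\<^sub>b g\<close>.  Once \<open>H = \<partial>\<^sub>a g \<partial>\<^sub>b g\<close> is
  inverted, the recurrence can be solved upwards with \<open>b\<close> and downwards with \<open>a\<close>, and every
  variable is expressed through those in the window.
\<close>

lemma localisation_generated_by_window:
  fixes P :: "('i, 'k) spoly set"
  assumes PJ: "\<And>x. x \<in> P \<Longrightarrow> vars x \<subseteq> indices"
    and P0: "0 \<in> P" and Padd: "\<And>x y. x \<in> P \<Longrightarrow> y \<in> P \<Longrightarrow> x + y \<in> P"
    and Pmult: "\<And>r x. vars r \<subseteq> indices \<Longrightarrow> x \<in> P \<Longrightarrow> r * x \<in> P"
    and Pprime: "\<And>a b. vars a \<subseteq> indices \<Longrightarrow> vars b \<subseteq> indices \<Longrightarrow> a * b \<in> P \<Longrightarrow> a \<in> P \<or> b \<in> P"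
    and one: "1 \<notin> P"
    and Pbr: "\<And>a x. vars a \<subseteq> indices \<Longrightarrow> x \<in> P \<Longrightarrow> lie_poisson br a x \<in> P"
    and f: "f \<in> P" "f \<noteq> 0" "vars f \<subseteq> \<epsilon> ` N"
  shows "\<exists>H. vars H \<subseteq> window f \<and> H \<notin> P \<and>
    (\<forall>j\<in>indices. \<exists>r p. vars p \<subseteq> window f \<and> H ^ r * Var j - p \<in> P)"
proof -
  let ?G = "window f"
  have CJ: "vars p \<subseteq> indices" if "vars p \<subseteq> ?G" for p using that window_subset by blast
  have Const_notin: "Const c \<notin> P" if "c \<noteq> 0" for c
  proof
    assume "Const c \<in> P"
    then have "Const (inverse c) * Const c \<in> P" by (intro Pmult) simp
    then show False using one that by (simp add: Const_simps(2)[symmetric] Const_simps(6))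
  qed
  obtain g i0 where g: "g \<in> P" "vars g \<subseteq> vars f" "pdiff i0 g \<notin> P"
    using ex_derivative_leaving[OF f(1,2) Const_notin] by blast
  define S where "S = {i. \<epsilon> i \<in> vars g}"
  define S' where "S' = {i \<in> S. pdiff (\<epsilon> i) g \<notin> P}"
  have vgN: "vars g \<subseteq> \<epsilon> ` N" using g f by blast
  have S: "finite S" "S \<subseteq> N" "vars g \<subseteq> \<epsilon> ` S"
    using finite_vars_preimage vgN inj_\<epsilon> by (auto simp: S_def inj_def)
  have "i0 \<in> vars g" using g(3) pdiff_notin_vars P0 by metis
  then obtain i1 where "i1 \<in> S'" using S(3) g(3) by (auto simp: S'_def)
  then have S': "finite S'" "S' \<noteq> {}" "S' \<subseteq> S" using S(1) by (auto simp: S'_def)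
  define a b where "a = Min S'" and "b = Max S'"
  have ab: "a \<in> S'" "b \<in> S'" "\<And>i. i \<in> S' \<Longrightarrow> a \<le> i \<and> i \<le> b"
    using S' by (auto simp: a_def b_def)
  define M where "M = (\<Sum>i | \<epsilon> i \<in> vars f. \<bar>i\<bar>)"
  have SM: "\<bar>i\<bar> \<le> M" if "i \<in> S" for i
    using that g(2) unfolding M_def
    by (intro member_le_sum finite_vars_preimage) (auto simp: S_def)
  define D where "D i = pdiff (\<epsilon> i) g" for i
  have vD: "vars (D i) \<subseteq> ?G" for i
    using vars_pdiff[of "\<epsilon> i" g] g(2) vars_subset_window[OF f(3)] unfolding D_def by blast
  define H where "H = D a * D b"
  have vH: "vars H \<subseteq> ?G" using vars_mult[of "D a" "D b"] vD unfolding H_def by blast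
  have HP: "H \<notin> P"
    using Pprime[of "D a" "D b"] ab(1,2) CJ[OF vD] by (auto simp: H_def D_def S'_def)
  have vpow: "vars (H ^ n) \<subseteq> ?G" for n
  proof (induction n)
    case (Suc n)
    then show ?case using vars_mult[of H "H ^ n"] vH by auto
  qed simp
  \<comment> \<open>The elements that become polynomials in the window once \<open>H\<close> is inverted modulo \<open>P\<close>.  They
    form a subring that contains \<open>P\<close> and is closed under division by \<open>H\<close>.\<close>
  define \<Lambda> where "\<Lambda> = {x. vars x \<subseteq> indices \<and> (\<exists>r p. vars p \<subseteq> ?G \<and> H ^ r * x - p \<in> P)}"
  have \<Lambda>P: "x \<in> \<Lambda>" if "x \<in> P" for x
    using that PJ by (auto simp: \<Lambda>_def intro!: exI[of _ 0])
  have \<Lambda>G: "x \<in> \<Lambda>" if "vars x \<subseteq> ?G" for x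
    using that CJ P0 by (auto simp: \<Lambda>_def intro!: exI[of _ 0] exI[of _ x])
  have \<Lambda>add: "x + y \<in> \<Lambda>" if "x \<in> \<Lambda>" "y \<in> \<Lambda>" for x y
  proof -
    obtain r p s q where *: "vars x \<subseteq> indices" "vars y \<subseteq> indices"
      "vars p \<subseteq> ?G" "H ^ r * x - p \<in> P" "vars q \<subseteq> ?G" "H ^ s * y - q \<in> P"
      using \<open>x \<in> \<Lambda>\<close> \<open>y \<in> \<Lambda>\<close> by (auto simp: \<Lambda>_def)
    have "H ^ (r + s) * (x + y) - (H ^ s * p + H ^ r * q) =
        H ^ s * (H ^ r * x - p) + H ^ r * (H ^ s * y - q)"
      by (simp add: power_add algebra_simps)
    also have "\<dots> \<in> P" using * by (intro Padd Pmult CJ vpow)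
    moreover have "vars (H ^ s * p + H ^ r * q) \<subseteq> ?G"
      using vars_add[of "H ^ s * p" "H ^ r * q"] vars_mult[of "H ^ s" p] vars_mult[of "H ^ r" q]
        vpow * by blast
    moreover have "vars (x + y) \<subseteq> indices" using vars_add[of x y] * by blast
    ultimately show ?thesis unfolding \<Lambda>_def by (metis (mono_tags, lifting) mem_Collect_eq)
  qed
  have \<Lambda>mult: "x * y \<in> \<Lambda>" if "x \<in> \<Lambda>" "y \<in> \<Lambda>" for x y
  proof -
    obtain r p s q where *: "vars x \<subseteq> indices" "vars y \<subseteq> indices"
      "vars p \<subseteq> ?G" "H ^ r * x - p \<in> P" "vars q \<subseteq> ?G" "H ^ s * y - q \<in> P"
      using \<open>x \<in> \<Lambda>\<close> \<open>y \<in> \<Lambda>\<close> by (auto simp: \<Lambda>_def)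
    have "H ^ (r + s) * (x * y) - p * q =
        (H ^ s * y) * (H ^ r * x - p) + p * (H ^ s * y - q)"
      by (simp add: power_add algebra_simps)
    also have "\<dots> \<in> P"
    proof (intro Padd Pmult)
      show "vars (H ^ s * y) \<subseteq> indices" using vars_mult[of "H ^ s" y] CJ[OF vpow] * by blast
    qed (use * CJ[of p] in auto)
    moreover have "vars (p * q) \<subseteq> ?G" using vars_mult[of p q] * by blast
    moreover have "vars (x * y) \<subseteq> indices" using vars_mult[of x y] * by blast
    ultimately show ?thesis unfolding \<Lambda>_def by (metis (mono_tags, lifting) mem_Collect_eq)
  qed
  have \<Lambda>sum: "sum u A \<in> \<Lambda>" if "\<And>i. i \<in> A \<Longrightarrow> u i \<in> \<Lambda>" for u and A :: "int set"
    using that by (induction A rule: infinite_finite_induct) (auto intro: \<Lambda>add \<Lambda>G)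
  have \<Lambda>H: "x \<in> \<Lambda>" if "H * x \<in> \<Lambda>" "vars x \<subseteq> indices" for x
  proof -
    obtain r p where "vars p \<subseteq> ?G" "H ^ r * (H * x) - p \<in> P" using \<open>H * x \<in> \<Lambda>\<close> by (auto simp: \<Lambda>_def)
    then show ?thesis
      using that(2) unfolding \<Lambda>_def by (auto simp: algebra_simps intro!: exI[of _ "Suc r"])
  qed
  have \<Lambda>neg: "- x \<in> \<Lambda>" if "x \<in> \<Lambda>" for x
    using \<Lambda>mult[OF \<Lambda>G that, of "- 1"] by simp
  have main: "Var (\<epsilon> k) \<in> \<Lambda>" if "k \<in> N" for k
    using that
  proof (induction "nat \<bar>k\<bar>" arbitrary: k rule: less_induct)
    case less
    show ?case
    proof (cases "\<bar>k\<bar> \<le> 2 * M")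
      case True
      then show ?thesis using less.prems by (intro \<Lambda>G) (auto simp: window_def M_def)
    next
      case False
      \<comment> \<open>Solve upwards for positive \<open>k\<close> and downwards for negative \<open>k\<close>: all other terms of the
        recurrence then have smaller absolute index.\<close>
      obtain c where c: "c \<in> S'" "c = a \<or> c = b" "\<And>i. i \<in> S' \<Longrightarrow> i \<noteq> c \<Longrightarrow> \<bar>k - c + i\<bar> < \<bar>k\<bar>"
      proof (cases "0 \<le> k")
        case True
        have "\<bar>k - b + i\<bar> < \<bar>k\<bar>" if "i \<in> S'" "i \<noteq> b" for i
        proof -
          have "\<bar>i\<bar> \<le> M" "\<bar>b\<bar> \<le> M" "i \<le> b" using that S'(3) ab SM by blast+
          then show ?thesis using that(2) True False by linarith
        qed
        then show thesis using that ab by blast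
      next
        case k: False
        have "\<bar>k - a + i\<bar> < \<bar>k\<bar>" if "i \<in> S'" "i \<noteq> a" for i
        proof -
          have "\<bar>i\<bar> \<le> M" "\<bar>a\<bar> \<le> M" "a \<le> i" using that S'(3) ab SM by blast+
          then show ?thesis using that(2) k False by linarith
        qed
        then show thesis using that ab by blast
      qed
      have cN: "c \<in> N" using c S' S by blast
      define n where "n = k - c"
      have cM: "\<bar>c\<bar> \<le> M" using c S' SM by blast
      have n: "n \<in> N" unfolding n_def using cM False by (intro N_diff less.prems cN) simp
      obtain z where z: "\<And>i. vars (z i) \<subseteq> C" and br: "lie_poisson br (Var (\<epsilon> n)) g =
          (\<Sum>i\<in>S. D i * (Const (of_int (i - n)) * Var (\<epsilon> (n + i)) + z i))"
        using bracket_Var[OF n S] unfolding D_def by blast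
      have zG: "z i \<in> \<Lambda>" for i using z[of i] by (intro \<Lambda>G) (auto simp: window_def)
      have "lie_poisson br (Var (\<epsilon> n)) g \<in> P"
        using n g(1) by (intro Pbr) (auto simp: indices_def)
      then have brL: "lie_poisson br (Var (\<epsilon> n)) g \<in> \<Lambda>" by (rule \<Lambda>P)
      define u where "u i = D i * (Const (of_int (i - n)) * Var (\<epsilon> (n + i)) + z i)" for i
      have uL: "u i \<in> \<Lambda>" if i: "i \<in> S - {c}" for i
      proof (cases "i \<in> S'")
        case True
        have "n + i \<in> N" using n i S by (auto intro: N_add)
        then have "Var (\<epsilon> (n + i)) \<in> \<Lambda>"
          using c(3)[OF True] i by (intro less.hyps) (auto simp: n_def)
        then show ?thesis
          unfolding u_def by (intro \<Lambda>mult \<Lambda>add zG \<Lambda>G[OF vD] \<Lambda>G[of "Const _"]) simp_all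
      next
        case False
        then have Di: "D i \<in> P" using i by (auto simp: S'_def D_def)
        have "vars (Const (of_int (i - n)) * Var (\<epsilon> (n + i)) + z i :: ('i,'k) spoly) \<subseteq> indices"
        proof -
          have "\<epsilon> (n + i) \<in> indices" using n i S N_add by (auto simp: indices_def)
          moreover have "vars (z i) \<subseteq> indices" using z by (auto simp: indices_def)
          ultimately show ?thesis
            using vars_add[of "Const (of_int (i - n)) * Var (\<epsilon> (n + i))" "z i"]
              vars_mult[of "Const (of_int (i - n)) :: ('i,'k) spoly" "Var (\<epsilon> (n + i))"] by fastforce
        qed
        from Pmult[OF this Di] show ?thesis by (intro \<Lambda>P) (simp add: u_def mult.commute)
      qed
      define l where "l = (of_int (c - n) :: 'k)"
      have "c \<noteq> n" using cM False by (auto simp: n_def)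
      then have l: "l \<noteq> 0" by (simp add: l_def)
      have "lie_poisson br (Var (\<epsilon> n)) g = u c + (\<Sum>i\<in>S - {c}. u i)"
        unfolding br u_def[symmetric] using c S' S by (intro sum.remove) auto
      moreover have "u c = D c * (Const l * Var (\<epsilon> k)) + D c * z c"
        by (simp add: u_def l_def n_def algebra_simps)
      ultimately have "D c * (Const l * Var (\<epsilon> k)) =
          lie_poisson br (Var (\<epsilon> n)) g + - (\<Sum>i\<in>S - {c}. u i) + - (D c * z c)"
        by (simp add: algebra_simps)
      also have "\<dots> \<in> \<Lambda>"
        by (intro \<Lambda>add \<Lambda>neg brL \<Lambda>sum uL \<Lambda>mult zG \<Lambda>G vD)
      finally have Dc: "D c * (Const l * Var (\<epsilon> k)) \<in> \<Lambda>" .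
      obtain D' where D': "D' \<in> \<Lambda>" "H = D' * D c"
        using c(2) \<Lambda>G[OF vD] mult.commute[of "D a" "D b"] unfolding H_def by blast
      have "H * Var (\<epsilon> k) = (Const (inverse l) * D') * (D c * (Const l * Var (\<epsilon> k)))"
      proof -
        have li: "Const (inverse l) * Const l = (1 :: ('i,'k) spoly)"
          using l by (simp add: Const_simps(2)[symmetric] Const_simps(6))
        have "(Const (inverse l) * D') * (D c * (Const l * Var (\<epsilon> k))) =
            (Const (inverse l) * Const l) * (D' * D c * Var (\<epsilon> k))"
          by (simp only: mult_ac)
        then show ?thesis unfolding li D'(2) by simp
      qed
      also have "\<dots> \<in> \<Lambda>" by (intro \<Lambda>mult Dc D' \<Lambda>G) simp
      finally show ?thesis by (rule \<Lambda>H) (use less.prems in \<open>simp add: indices_def\<close>)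
    qed
  qed
  have "Var j \<in> \<Lambda>" if "j \<in> indices" for j
    using that main \<Lambda>G[of "Var j"] by (auto simp: indices_def window_def)
  then show ?thesis using vH HP unfolding \<Lambda>_def by blast
qed

lemma lie_poisson_differential_subring:
  "differential_subring {p. vars p \<subseteq> indices} {lie_poisson br a |a. vars a \<subseteq> indices}"
proof
  fix n :: nat assume "0 < n"
  then have "Const (inverse (of_nat n)) * Const (of_nat n) = (1 :: ('i,'k) spoly)"
    by (simp add: Const_simps(2)[symmetric] Const_simps(6))
  moreover have "Const (of_nat n) = (of_nat n :: ('i,'k) spoly)"
    by (simp add: Const_def)
  ultimately have "Const (inverse (of_nat n)) * of_nat n = (1 :: ('i,'k) spoly)" by metis
  then show "\<exists>r\<in>{p. vars p \<subseteq> indices}. r * of_nat n = (1 :: ('i,'k) spoly)"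
    by (rule bexI) simp
next
  fix \<delta> :: "('i,'k) spoly \<Rightarrow> _" and x assume "\<delta> \<in> {lie_poisson br a |a. vars a \<subseteq> indices}"
    "x \<in> {p :: ('i,'k) spoly. vars p \<subseteq> indices}"
  then show "\<delta> x \<in> {p. vars p \<subseteq> indices}"
    using vars_lie_poisson[where br = br, OF _ _ bracket_closed[folded indices_def]] by auto
next
  fix x y :: "('i,'k) spoly"
  assume "x \<in> {p. vars p \<subseteq> indices}" "y \<in> {p. vars p \<subseteq> indices}"
  then show "x + y \<in> {p. vars p \<subseteq> indices}" "x * y \<in> {p. vars p \<subseteq> indices}"
    using vars_add[of x y] vars_mult[of x y] by blast+
qed (auto simp: lie_poisson_add_right lie_poisson_mult_right)

end

section \<open>Rewriting to sparse monomials\<close>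

text \<open>
  A new coordinate that gets a weight larger than all the values reached so far separates by itself
  the vectors in which it occurs.
\<close>

lemma ex_separating_weight:
  fixes \<Delta> :: "('i \<Rightarrow> int) set"
  assumes "finite V" "finite \<Delta>" "\<And>\<delta>. \<delta> \<in> \<Delta> \<Longrightarrow> \<exists>i\<in>V. \<delta> i \<noteq> 0"
  shows "\<exists>w. (\<forall>i. 1 \<le> w i) \<and> (\<forall>\<delta>\<in>\<Delta>. (\<Sum>i\<in>V. int (w i) * \<delta> i) \<noteq> 0)"
  using assms
proof (induction V arbitrary: \<Delta> rule: finite_induct)
  case empty
  then have "\<Delta> = {}" by blast
  then show ?case by (auto intro: exI[of _ "\<lambda>_. 1"])
next
  case (insert x V)
  define \<Delta>' where "\<Delta>' = {\<delta>\<in>\<Delta>. \<exists>i\<in>V. \<delta> i \<noteq> 0}"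
  have "finite \<Delta>'" "\<And>\<delta>. \<delta> \<in> \<Delta>' \<Longrightarrow> \<exists>i\<in>V. \<delta> i \<noteq> 0"
    using insert.prems(1) by (auto simp: \<Delta>'_def)
  from insert.IH[OF this] obtain w where w: "\<And>i. 1 \<le> w i"
      "\<And>\<delta>. \<delta> \<in> \<Delta>' \<Longrightarrow> (\<Sum>i\<in>V. int (w i) * \<delta> i) \<noteq> 0"
    by blast
  define s where "s \<delta> = (\<Sum>i\<in>V. int (w i) * \<delta> i)" for \<delta>
  define n where "n = Suc (nat (\<Sum>\<delta>\<in>\<Delta>. \<bar>s \<delta>\<bar>))"
  have n: "\<bar>s \<delta>\<bar> < int n" if "\<delta> \<in> \<Delta>" for \<delta>
  proof -
    have "\<bar>s \<delta>\<bar> \<le> (\<Sum>\<delta>\<in>\<Delta>. \<bar>s \<delta>\<bar>)" using insert.prems(1) that by (intro member_le_sum) auto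
    then show ?thesis by (simp add: n_def)
  qed
  have eq: "(\<Sum>i\<in>insert x V. int ((w(x := n)) i) * \<delta> i) = int n * \<delta> x + s \<delta>" for \<delta>
  proof -
    have "(\<Sum>i\<in>V. int ((w(x := n)) i) * \<delta> i) = s \<delta>"
      unfolding s_def using insert.hyps by (intro sum.cong) auto
    then show ?thesis using insert.hyps by simp
  qed
  have "int n * \<delta> x + s \<delta> \<noteq> 0" if \<delta>: "\<delta> \<in> \<Delta>" for \<delta>
  proof (cases "\<delta> x = 0")
    case True
    then have "\<exists>i\<in>V. \<delta> i \<noteq> 0" using insert.prems(2)[OF \<delta>] by auto
    then have "\<delta> \<in> \<Delta>'" using \<delta> by (simp add: \<Delta>'_def)
    then show ?thesis using w(2)[of \<delta>] True by (simp add: s_def)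
  next
    case False
    then have "int n * 1 \<le> int n * \<bar>\<delta> x\<bar>" by (intro mult_left_mono) auto
    then have "int n \<le> \<bar>int n * \<delta> x\<bar>" by (simp add: abs_mult)
    then show ?thesis using n[OF \<delta>] by linarith
  qed
  moreover have "\<forall>i. 1 \<le> (w(x := n)) i" using w(1) by (simp add: n_def)
  ultimately show ?case unfolding eq[symmetric] by blast
qed

text \<open>
  A weight that is injective on a given finite set of monomials serves as a monomial order there.
  It makes sense without any order on the variables, its values are natural numbers, and bounding
  it also bounds all exponents.
\<close>

lemma ex_weight_inj_on:
  fixes K :: "('i \<Rightarrow>\<^sub>0 nat) set"
  assumes "finite K" shows "\<exists>w. (\<forall>i. 1 \<le> w i) \<and> inj_on (wt w) K"
proof -
  define V where "V = (\<Union>m\<in>K. Poly_Mapping.keys m)"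
  have V: "finite V" "\<And>m. m \<in> K \<Longrightarrow> Poly_Mapping.keys m \<subseteq> V" using assms by (auto simp: V_def)
  define df where "df = (\<lambda>(m :: 'i \<Rightarrow>\<^sub>0 nat, m') i. int (Poly_Mapping.lookup m i) - int (Poly_Mapping.lookup m' i))"
  have ne: "\<exists>i\<in>V. df (m, m') i \<noteq> 0" if mm: "m \<in> K" "m' \<in> K" "m \<noteq> m'" for m m'
  proof -
    obtain i where i: "Poly_Mapping.lookup m i \<noteq> Poly_Mapping.lookup m' i"
      using mm(3) by (metis poly_mapping_eqI)
    then have "i \<in> Poly_Mapping.keys m \<union> Poly_Mapping.keys m'" by (auto simp: in_keys_iff)
    then show ?thesis using V(2) mm i by (auto simp: df_def)
  qed
  have "\<exists>w. (\<forall>i. 1 \<le> w i) \<and>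
      (\<forall>\<delta>\<in>df ` {(m, m') \<in> K \<times> K. m \<noteq> m'}. (\<Sum>i\<in>V. int (w i) * \<delta> i) \<noteq> 0)"
  proof (rule ex_separating_weight[OF V(1)])
    show "finite (df ` {(m, m') \<in> K \<times> K. m \<noteq> m'})"
      by (rule finite_imageI, rule finite_subset[of _ "K \<times> K"]) (use assms in auto)
  qed (use ne in auto)
  then obtain w where w: "\<And>i. 1 \<le> w i"
    "\<And>m m'. m \<in> K \<Longrightarrow> m' \<in> K \<Longrightarrow> m \<noteq> m' \<Longrightarrow> (\<Sum>i\<in>V. int (w i) * df (m, m') i) \<noteq> 0"
    by blast
  have "wt w m \<noteq> wt w m'" if "m \<in> K" "m' \<in> K" "m \<noteq> m'" for m m'
  proof -
    have "(\<Sum>i\<in>V. int (w i) * df (m, m') i) = int (wt w m) - int (wt w m')"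
      using V that by (simp add: df_def wt_superset[of V] right_diff_distrib sum_subtractf)
    then show ?thesis using w(2)[OF that] by auto
  qed
  then show ?thesis using w(1) by (auto simp: inj_on_def)
qed

lemma ex_leading_monomial:
  assumes "p \<noteq> 0" "inj_on (wt w) (Poly_Mapping.keys p)"
  obtains m where "m \<in> Poly_Mapping.keys p"
    "\<And>m'. m' \<in> Poly_Mapping.keys p \<Longrightarrow> m' \<noteq> m \<Longrightarrow> wt w m' < wt w m"
proof -
  let ?L = "Max (wt w ` Poly_Mapping.keys p)"
  have "?L \<in> wt w ` Poly_Mapping.keys p" using assms(1) by (intro Max_in) auto
  then obtain m where m: "m \<in> Poly_Mapping.keys p" "wt w m = ?L" by auto
  have "wt w m' < wt w m" if m': "m' \<in> Poly_Mapping.keys p" "m' \<noteq> m" for m'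
  proof -
    have "wt w m' \<le> ?L" using m' by (intro Max_ge) auto
    moreover have "wt w m' \<noteq> wt w m" using inj_onD[OF assms(2) _ m'(1) m(1)] m'(2) by blast
    ultimately show ?thesis using m(2) by simp
  qed
  with m(1) show thesis by (rule that)
qed

lemma spoly_mult_nonzero:
  fixes p q :: "('i, 'k::idom) spoly"
  assumes "p \<noteq> 0" "q \<noteq> 0" shows "p * q \<noteq> 0"
proof -
  obtain w where w: "inj_on (wt w) (Poly_Mapping.keys p \<union> Poly_Mapping.keys q)"
    using ex_weight_inj_on[of "Poly_Mapping.keys p \<union> Poly_Mapping.keys q"] by auto
  obtain a where a: "a \<in> Poly_Mapping.keys p"
    "\<And>m. m \<in> Poly_Mapping.keys p \<Longrightarrow> m \<noteq> a \<Longrightarrow> wt w m < wt w a"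
    using ex_leading_monomial[OF assms(1) inj_on_subset[OF w]] by blast
  obtain b where b: "b \<in> Poly_Mapping.keys q"
    "\<And>m. m \<in> Poly_Mapping.keys q \<Longrightarrow> m \<noteq> b \<Longrightarrow> wt w m < wt w b"
    using ex_leading_monomial[OF assms(2) inj_on_subset[OF w]] by blast
  let ?c = "\<lambda>m m'. Poly_Mapping.lookup p m * Poly_Mapping.lookup q m'"
  have uniq: "m + m' = a + b \<longleftrightarrow> m = a \<and> m' = b"
    if m: "m \<in> Poly_Mapping.keys p" "m' \<in> Poly_Mapping.keys q" for m m'
  proof
    assume eq: "m + m' = a + b"
    have "wt w m + wt w m' = wt w a + wt w b" using arg_cong[OF eq, of "wt w"] by (simp add: wt_add)
    then show "m = a \<and> m' = b" using a(2)[OF m(1)] b(2)[OF m(2)] by (cases "m = a"; cases "m' = b") auto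
  qed simp
  have "p * q = (\<Sum>m\<in>Poly_Mapping.keys p. \<Sum>m'\<in>Poly_Mapping.keys q. Poly_Mapping.single (m + m') (?c m m'))"
    by (subst spoly_eq_sum[of p], subst spoly_eq_sum[of q])
      (simp add: sum_product Const_def mult_single)
  then have "Poly_Mapping.lookup (p * q) (a + b) =
      (\<Sum>m\<in>Poly_Mapping.keys p. \<Sum>m'\<in>Poly_Mapping.keys q. if m + m' = a + b then ?c m m' else 0)"
    by (simp add: lookup_sum lookup_single when_def)
  also have "\<dots> = (\<Sum>m\<in>Poly_Mapping.keys p. \<Sum>m'\<in>Poly_Mapping.keys q.
      if m = a then if m' = b then ?c m m' else 0 else 0)"
    by (intro sum.cong refl) (simp add: uniq)
  also have "\<dots> = (\<Sum>m\<in>Poly_Mapping.keys p. if m = a then \<Sum>m'\<in>Poly_Mapping.keys q. if m' = b then ?c m m' else 0 else 0)"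
    by (intro sum.cong refl) simp
  also have "\<dots> = ?c a b" using a(1) b(1) by (simp add: sum.delta)
  finally have "Poly_Mapping.lookup (p * q) (a + b) \<noteq> 0" using a(1) b(1) by (simp add: in_keys_iff)
  then show ?thesis by auto
qed

definition sparse_monomials :: "'i set \<Rightarrow> nat \<Rightarrow> nat \<Rightarrow> ('i \<Rightarrow>\<^sub>0 nat) set" where
  "sparse_monomials V k N =
    {m. Poly_Mapping.keys m \<subseteq> V \<and> card {i \<in> V. k \<le> Poly_Mapping.lookup m i} \<le> N}"

lemma sum_le_of_mem:
  assumes "finite A" "a \<in> A" shows "f a \<le> (\<Sum>x\<in>A. f x :: nat)"
  using assms by (intro member_le_sum) auto

text \<open>
  A monomial that is not sparse has exponents at least \<open>k\<close> on some \<open>N + 1\<close> variables.  If \<open>k\<close> bounds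
  all exponents in the given relations, the monomial is divisible by the leading monomial of the
  relation for these variables, and subtracting the corresponding multiple of the relation replaces
  it by monomials of smaller weight.
\<close>

lemma rewrite_to_sparse:
  fixes Z :: "('i, 'k::field) spoly set"
  assumes V: "finite V"
    and Z0: "0 \<in> Z" and Zadd: "\<And>x y. x \<in> Z \<Longrightarrow> y \<in> Z \<Longrightarrow> x + y \<in> Z"
    and Zmult: "\<And>r x. vars r \<subseteq> V \<Longrightarrow> x \<in> Z \<Longrightarrow> r * x \<in> Z"
    and rel: "\<And>T. T \<subseteq> V \<Longrightarrow> card T = Suc N \<Longrightarrow> \<exists>f. f \<noteq> 0 \<and> vars f \<subseteq> T \<and> f \<in> Z"
  obtains w k where "\<And>i. 1 \<le> w i" "0 < k"
    "\<And>p d. p \<in> polys_upto w V d \<Longrightarrow>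
      \<exists>q\<in>polys_upto w V d. Poly_Mapping.keys q \<subseteq> sparse_monomials V k N \<and> p - q \<in> Z"
proof -
  define \<T> where "\<T> = {T. T \<subseteq> V \<and> card T = Suc N}"
  have fT: "finite \<T>" using V by (auto simp: \<T>_def)
  obtain f where f: "\<And>T. T \<in> \<T> \<Longrightarrow> f T \<noteq> 0 \<and> vars (f T) \<subseteq> T \<and> f T \<in> Z"
    using rel unfolding \<T>_def mem_Collect_eq by metis
  define K where "K = (\<Union>T\<in>\<T>. Poly_Mapping.keys (f T))"
  have fK: "finite K" using fT by (simp add: K_def)
  have KV: "Poly_Mapping.keys m \<subseteq> V" if mK: "m \<in> K" for m
  proof -
    obtain T where T: "T \<in> \<T>" "m \<in> Poly_Mapping.keys (f T)" using mK unfolding K_def by blast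
    then have "Poly_Mapping.keys m \<subseteq> T" using keys_subset_vars[OF T(2)] f by blast
    then show ?thesis using T(1) by (auto simp: \<T>_def)
  qed
  obtain w where w: "\<And>i. 1 \<le> w i" and inj: "inj_on (wt w) K"
    using ex_weight_inj_on[OF fK] by blast
  define k where "k = Suc (\<Sum>m\<in>K. wt w m)"
  have expK: "Poly_Mapping.lookup m i \<le> k" if "m \<in> K" for m i
  proof -
    have "Poly_Mapping.lookup m i \<le> wt w m" by (rule lookup_le_wt[of w, OF w])
    also have "\<dots> \<le> (\<Sum>m\<in>K. wt w m)" by (rule sum_le_of_mem[OF fK that])
    finally show ?thesis by (simp add: k_def)
  qed
  let ?nf = "\<lambda>d. {q \<in> polys_upto w V d. Poly_Mapping.keys q \<subseteq> sparse_monomials V k N}"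
  have nf_add: "p + q \<in> ?nf d" if "p \<in> ?nf d" "q \<in> ?nf d" for p q :: "('i,'k) spoly" and d
    using that polys_upto_add keys_add[of p q] by blast
  have nf_0: "0 \<in> ?nf d" for d by (simp add: polys_upto_def)
  have nf_sum: "sum g A \<in> ?nf d" if "\<And>a. a \<in> A \<Longrightarrow> g a \<in> ?nf d"
    for g :: "('i \<Rightarrow>\<^sub>0 nat) \<Rightarrow> ('i,'k) spoly" and A d
    using that
  proof (induction A rule: infinite_finite_induct)
    case (insert a A)
    then show ?case using nf_add[of "g a" d "sum g A"] by simp
  qed (use nf_0 in simp_all)
  have nf_Const: "Const c * q \<in> ?nf d" if "q \<in> ?nf d" for c d and q :: "('i,'k) spoly"
    using polys_upto_mult[OF polys_upto_Const[of c w V 0], of q d]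
      keys_mult[of "Const c" q] that by (fastforce simp: Const_def split: if_splits)
  have Zsum: "sum g A \<in> Z" if "\<And>a. a \<in> A \<Longrightarrow> g a \<in> Z"
    for g :: "('i \<Rightarrow>\<^sub>0 nat) \<Rightarrow> ('i,'k) spoly" and A
    using that by (induction A rule: infinite_finite_induct) (auto intro: Zadd Z0)
  have nf_mono: "q \<in> ?nf d'" if "q \<in> ?nf d" "d \<le> d'" for q :: "('i,'k) spoly" and d d'
    using that polys_upto_mono by blast
  have mon: "\<exists>q\<in>?nf (wt w m). Mon m - q \<in> Z" if "Poly_Mapping.keys m \<subseteq> V" for m
    using that
  proof (induction "wt w m" arbitrary: m rule: less_induct)
    case less
    show ?case
    proof (cases "m \<in> sparse_monomials V k N")
      case True
      then have "Mon m \<in> ?nf (wt w m)"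
        using less.prems by (auto simp: polys_upto_def vars_def)
      then show ?thesis using Z0 by (intro bexI[of _ "Mon m"]) auto
    next
      case False
      then have "Suc N \<le> card {i \<in> V. k \<le> Poly_Mapping.lookup m i}"
        using less.prems by (simp add: sparse_monomials_def)
      then obtain T where T: "T \<subseteq> {i \<in> V. k \<le> Poly_Mapping.lookup m i}" "card T = Suc N"
        by (metis obtain_subset_with_card_n)
      then have TT: "T \<in> \<T>" by (auto simp: \<T>_def)
      note fT = f[OF TT]
      have keysK: "Poly_Mapping.keys (f T) \<subseteq> K" using TT by (auto simp: K_def)
      have "f T \<noteq> 0" using fT by blast
      then obtain m0 where m0: "m0 \<in> Poly_Mapping.keys (f T)" and
        lt': "\<And>m'. m' \<in> Poly_Mapping.keys (f T) \<Longrightarrow> m' \<noteq> m0 \<Longrightarrow> wt w m' < wt w m0"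
        by (rule ex_leading_monomial[OF _ inj_on_subset[OF inj keysK]]) blast
      then have lt: "wt w m' < wt w m0" if "m' \<in> Poly_Mapping.keys (f T) - {m0}" for m'
        using that by blast
      define m1 where "m1 = m - m0"
      have m: "m = m0 + m1"
      proof (rule poly_mapping_eqI)
        fix i
        have "Poly_Mapping.lookup m0 i \<le> Poly_Mapping.lookup m i"
        proof (cases "i \<in> T")
          case True
          then have "k \<le> Poly_Mapping.lookup m i" using T(1) by blast
          moreover have "Poly_Mapping.lookup m0 i \<le> k" using expK m0 keysK by blast
          ultimately show ?thesis by simp
        next
          case False
          then have "i \<notin> Poly_Mapping.keys m0" using keys_subset_vars[OF m0] fT by blast
          then show ?thesis by (simp add: in_keys_iff)
        qed
        then show "Poly_Mapping.lookup m i = Poly_Mapping.lookup (m0 + m1) i"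
          by (simp add: m1_def lookup_add lookup_minus)
      qed
      have m1V: "Poly_Mapping.keys m1 \<subseteq> V"
        using less.prems by (auto simp: m1_def in_keys_iff lookup_minus)
      let ?R = "Poly_Mapping.keys (f T) - {m0}"
      define l where "l = Poly_Mapping.lookup (f T) m0"
      have l: "l \<noteq> 0" using m0 by (simp add: l_def in_keys_iff)
      have "\<exists>q\<in>?nf (wt w m). Mon (m' + m1) - q \<in> Z" if m': "m' \<in> ?R" for m'
      proof -
        have lt': "wt w (m' + m1) < wt w m" using lt[OF m'] by (simp add: m wt_add)
        moreover have "Poly_Mapping.keys (m' + m1) \<subseteq> V"
          using keys_add[of m' m1] m1V KV[of m'] keysK m' by blast
        ultimately obtain q where "q \<in> ?nf (wt w (m' + m1))" "Mon (m' + m1) - q \<in> Z"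
          using less.hyps by blast
        then show ?thesis using nf_mono[of q "wt w (m' + m1)" "wt w m"] lt' by auto
      qed
      then have "\<forall>m'\<in>?R. \<exists>q. q \<in> ?nf (wt w m) \<and> Mon (m' + m1) - q \<in> Z" by blast
      from bchoice[OF this] obtain q where q: "\<And>m'. m' \<in> ?R \<Longrightarrow> q m' \<in> ?nf (wt w m)"
        "\<And>m'. m' \<in> ?R \<Longrightarrow> Mon (m' + m1) - q m' \<in> Z" by blast
      define c where "c m' = - (inverse l * Poly_Mapping.lookup (f T) m')" for m'
      define Q where "Q = (\<Sum>m'\<in>?R. Const (c m') * q m')"
      have fsum: "f T = Const l * Mon m0 +
          (\<Sum>m'\<in>?R. Const (Poly_Mapping.lookup (f T) m') * Mon m')"
        using spoly_eq_sum[of "f T"] m0 by (simp add: sum.remove l_def)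
      have li: "Const (inverse l) * Const l = (1 :: ('i,'k) spoly)"
        using l by (simp add: Const_simps(2)[symmetric] Const_simps(6))
      have "(Const (inverse l) * Mon m1) * f T =
          (Const (inverse l) * Const l) * (Mon m1 * Mon m0) +
          (\<Sum>m'\<in>?R. (Const (inverse l) * Const (Poly_Mapping.lookup (f T) m')) * (Mon m' * Mon m1))"
        by (subst fsum) (simp add: distrib_left sum_distrib_left mult_ac)
      also have "\<dots> = Mon m - (\<Sum>m'\<in>?R. Const (c m') * Mon (m' + m1))"
        unfolding li by (simp add: m mult_single add.commute c_def Const_simps(3) sum_negf
            flip: Const_simps(2))
      finally have eq: "Mon m - Q = (Const (inverse l) * Mon m1) * f T +
          (\<Sum>m'\<in>?R. Const (c m') * (Mon (m' + m1) - q m'))"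
        by (simp add: Q_def right_diff_distrib sum_subtractf)
      have "Mon m - Q \<in> Z"
        unfolding eq
      proof (intro Zadd Zmult Zsum q(2))
        show "vars (Const (inverse l) * Mon m1) \<subseteq> V"
        proof -
          have "vars (Mon m1 :: ('i,'k) spoly) \<subseteq> V" using m1V by (simp add: vars_def)
          then show ?thesis using vars_mult[of "Const (inverse l)" "Mon m1"] by auto
        qed
      qed (use fT in auto)
      moreover have "Q \<in> ?nf (wt w m)"
        unfolding Q_def by (intro nf_sum nf_Const q(1))
      ultimately show ?thesis by blast
    qed
  qed
  show thesis
  proof (rule that[of w k])
    fix p :: "('i,'k) spoly" and d assume p: "p \<in> polys_upto w V d"
    have "\<exists>q\<in>?nf d. Mon m - q \<in> Z" if m: "m \<in> Poly_Mapping.keys p" for m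
    proof -
      have "Poly_Mapping.keys m \<subseteq> V" "wt w m \<le> d" using p m by (auto simp: polys_upto_def vars_def)
      then obtain q where "q \<in> ?nf (wt w m)" "Mon m - q \<in> Z" using mon[of m] by blast
      then show ?thesis using nf_mono[of q "wt w m" d] \<open>wt w m \<le> d\<close> by blast
    qed
    then have "\<forall>m\<in>Poly_Mapping.keys p. \<exists>q. q \<in> ?nf d \<and> Mon m - q \<in> Z" by blast
    from bchoice[OF this] obtain q where q: "\<And>m. m \<in> Poly_Mapping.keys p \<Longrightarrow> q m \<in> ?nf d"
      "\<And>m. m \<in> Poly_Mapping.keys p \<Longrightarrow> Mon m - q m \<in> Z" by blast
    define Q where "Q = (\<Sum>m\<in>Poly_Mapping.keys p. Const (Poly_Mapping.lookup p m) * q m)"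
    have "p - Q = (\<Sum>m\<in>Poly_Mapping.keys p. Const (Poly_Mapping.lookup p m) * (Mon m - q m))"
      by (subst (1) spoly_eq_sum) (simp add: Q_def right_diff_distrib sum_subtractf)
    also have "\<dots> \<in> Z" by (intro Zsum Zmult q(2)) simp_all
    finally have "p - Q \<in> Z" .
    moreover have "Q \<in> ?nf d" unfolding Q_def by (intro nf_sum nf_Const q(1))
    ultimately show "\<exists>q\<in>polys_upto w V d. Poly_Mapping.keys q \<subseteq> sparse_monomials V k N \<and> p - q \<in> Z"
      by blast
  qed (use w in \<open>auto simp: k_def\<close>)
qed

text \<open>
  Only the at most \<open>N\<close> large exponents vary with \<open>d\<close>, so the count is \<open>O(d\<^sup>N)\<close>.
\<close>

lemma card_sparse_monomials:
  assumes V: "finite V" and w: "\<And>i. 1 \<le> w i" and k: "0 < k"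
  shows "finite {m \<in> sparse_monomials V k N. wt w m \<le> d}"
    "card {m \<in> sparse_monomials V k N. wt w m \<le> d} \<le> 2 ^ card V * k ^ card V * (d + 1) ^ N"
proof -
  define \<S> where "\<S> = {S. S \<subseteq> V \<and> card S \<le> N}"
  define F where "F S i = (if i \<in> S then {..d} else {..<k})" for S :: "'a set" and i
  have sub: "{m \<in> sparse_monomials V k N. wt w m \<le> d} \<subseteq> (\<Union>S\<in>\<S>. monomials V (F S))"
  proof
    fix m assume m: "m \<in> {m \<in> sparse_monomials V k N. wt w m \<le> d}"
    define S where "S = {i \<in> V. k \<le> Poly_Mapping.lookup m i}"
    have "S \<in> \<S>" using m by (auto simp: \<S>_def S_def sparse_monomials_def)
    moreover have "Poly_Mapping.lookup m i \<le> d" for i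
      using lookup_le_wt[of w i m, OF w] m by simp
    then have "m \<in> monomials V (F S)"
      using m by (auto simp: monomials_def F_def S_def sparse_monomials_def)
    ultimately show "m \<in> (\<Union>S\<in>\<S>. monomials V (F S))" by blast
  qed
  have fS: "finite \<S>" "card \<S> \<le> 2 ^ card V"
  proof -
    have "\<S> \<subseteq> Pow V" by (auto simp: \<S>_def)
    then show "finite \<S>" "card \<S> \<le> 2 ^ card V"
      using V card_mono[of "Pow V" \<S>] by (auto simp: card_Pow intro: finite_subset)
  qed
  have fin: "finite (monomials V (F S))" for S by (rule finite_monomials[OF V]) (simp add: F_def)
  have card: "card (monomials V (F S)) \<le> k ^ card V * (d + 1) ^ N" if S: "S \<in> \<S>" for S
  proof -
    have SV: "S \<subseteq> V" "card S \<le> N" using S by (auto simp: \<S>_def)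
    have "card (monomials V (F S)) = (\<Prod>i\<in>V. if i \<in> S then d + 1 else k)"
      unfolding card_monomials[OF V] by (intro prod.cong) (auto simp: F_def)
    also have "\<dots> = (d + 1) ^ card S * k ^ card (V - S)"
      using V SV by (simp add: prod.If_cases Int_absorb1 Int_absorb2 Diff_eq[symmetric])
    also have "\<dots> \<le> (d + 1) ^ N * k ^ card V"
      using SV V k by (intro mult_mono power_increasing) (auto intro: card_mono)
    finally show ?thesis by (simp add: mult.commute)
  qed
  show "finite {m \<in> sparse_monomials V k N. wt w m \<le> d}"
    by (rule finite_subset[OF sub]) (use fS fin in auto)
  have "card {m \<in> sparse_monomials V k N. wt w m \<le> d} \<le> card (\<Union>S\<in>\<S>. monomials V (F S))"
    using sub fS fin by (intro card_mono) auto
  also have "\<dots> \<le> (\<Sum>S\<in>\<S>. card (monomials V (F S)))" by (rule card_UN_le[OF fS(1)])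
  also have "\<dots> \<le> (\<Sum>S\<in>\<S>. k ^ card V * (d + 1) ^ N)" by (intro sum_mono card)
  also have "\<dots> \<le> 2 ^ card V * (k ^ card V * (d + 1) ^ N)" using fS(2) by simp
  finally show "card {m \<in> sparse_monomials V k N. wt w m \<le> d} \<le> 2 ^ card V * k ^ card V * (d + 1) ^ N"
    by (simp add: mult.assoc)
qed

section \<open>Growth of algebras presented by polynomials\<close>

lemma (in ring) dimension_Span_le:
  assumes K: "subfield K R" and "set Us \<subseteq> carrier R"
  shows "\<exists>n\<le>length Us. dimension n K (Span K Us)"
  using assms(2)
proof (induction Us)
  case Nil
  show ?case by auto
next
  case (Cons u Us)
  then obtain n where n: "n \<le> length Us" "dimension n K (Span K Us)" by auto
  show ?case
  proof (cases "u \<in> Span K Us")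
    case True
    have "Span K (u # Us) \<subseteq> Span K Us"
    proof (rule subalgebra_Span_incl[OF K])
      show "subalgebra K (Span K Us) R" using Span_is_subalgebra[OF K] Cons.prems by simp
      show "set (u # Us) \<subseteq> Span K Us" using Span_base_incl[OF K] Cons.prems True by simp
    qed
    moreover have "Span K Us \<subseteq> Span K (u # Us)" using mono_Span[OF K] Cons.prems by simp
    ultimately show ?thesis using n by (metis le_SucI length_Cons subset_antisym)
  next
    case False
    then have "dimension (Suc n) K (line_extension K u (Span K Us))"
      using n Cons.prems by (intro Suc_dim) auto
    then show ?thesis using n by auto
  qed
qed

lemma (in ring) dim_le_length:
  assumes K: "subfield K R" and V: "subalgebra K V R"
    and Us: "set Us \<subseteq> carrier R" "V \<subseteq> Span K Us"
  shows "dim K V \<le> length Us"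
proof -
  obtain n where n: "n \<le> length Us" "dimension n K (Span K Us)"
    using dimension_Span_le[OF K Us(1)] by blast
  have "finite_dimension K V"
    by (rule subalbegra_incl_imp_finite_dimension[OF K finite_dimensionI[OF n(2)] V Us(2)])
  then have d: "dimension (dim K V) K V" using finite_dimensionE[OF K] by (simp add: over_def)
  obtain Vs where Vs: "independent K Vs" "length Vs = dim K V" "Span K Vs = V" "set Vs \<subseteq> carrier R"
    using exists_base[OF K d] by blast
  have "set Vs \<subseteq> Span K Us" using Span_base_incl[OF K Vs(4)] Vs(3) Us(2) by blast
  then have "length Vs \<le> n" by (rule independent_length_le_dimension[OF K n(2) Vs(1)])
  then show ?thesis using n Vs by simp
qed

text \<open>
  In the zero ring the scalars are not a field, and the dimension has to be computed by hand.
\<close>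

lemma (in ring) dim_zero_ring:
  assumes "\<one> = \<zero>" shows "dim K {\<zero>} = 0"
proof -
  have c: "carrier R = {\<zero>}" using assms one_zeroD by blast
  have "n = 0 \<and> E = {\<zero>}" if "dimension n K' E" for n K' E
    using that by (induction rule: dimension.induct) (use c in auto)
  then have "dimension n K {\<zero>} \<longleftrightarrow> n = 0" for n by auto
  then show ?thesis by (simp add: dim_def)
qed

lemma (in cring) subalgebra_ideal_prod:
  assumes U: "subalgebra K U R" and V: "subalgebra K V R" and K: "K \<subseteq> carrier R"
  shows "subalgebra K (ideal_prod R U V) R"
proof -
  interpret U: subalgebra K U R by (rule U)
  interpret V: subalgebra K V R by (rule V)
  have car: "x \<in> carrier R" if "x \<in> ideal_prod R U V" for x
    using that by (induction rule: ideal_prod.induct) (use U.subset V.subset in auto)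
  have Km: "k \<otimes> x \<in> ideal_prod R U V" if "k \<in> K" "x \<in> ideal_prod R U V" for k x
    using that(2)
  proof (induction rule: ideal_prod.induct)
    case (prod i j)
    have "k \<otimes> (i \<otimes> j) = (k \<otimes> i) \<otimes> j"
      using K that(1) prod U.subset V.subset by (intro m_assoc[symmetric]) auto
    then show ?case using prod U.smult_closed[OF that(1)] by (auto intro: ideal_prod.prod)
  next
    case (sum s t)
    have "k \<otimes> (s \<oplus> t) = k \<otimes> s \<oplus> k \<otimes> t" using K that(1) sum car by (auto simp: r_distr)
    then show ?case using sum by (auto intro: ideal_prod.sum)
  qed
  have neg: "\<ominus> x \<in> ideal_prod R U V" if "x \<in> ideal_prod R U V" for x
    using that
  proof (induction rule: ideal_prod.induct)
    case (prod i j)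
    have "\<ominus> (i \<otimes> j) = (\<ominus> i) \<otimes> j" using prod U.subset V.subset by (intro l_minus[symmetric]) auto
    moreover have "\<ominus> i \<in> U" using U.m_inv_closed[OF prod(1)] by (simp add: a_inv_def)
    ultimately show ?case using prod by (auto intro: ideal_prod.prod)
  next
    case (sum s t)
    have "\<ominus> (s \<oplus> t) = \<ominus> s \<oplus> \<ominus> t" using sum car by (auto simp: minus_add)
    then show ?case using sum by (auto intro: ideal_prod.sum)
  qed
  have zero: "\<zero> \<in> ideal_prod R U V"
    using ideal_prod.prod[of \<zero> U \<zero> V R] U.one_closed V.one_closed by simp
  have "subgroup (ideal_prod R U V) (add_monoid R)"
    using car zero neg by (intro add.subgroupI) (auto simp: a_inv_def intro: ideal_prod.sum)
  then show ?thesis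
    using Km by (intro subalgebra.intro subalgebra_axioms.intro) auto
qed

text \<open>
  \<open>A\<close> is a quotient, through \<open>\<phi>\<close>, of the algebra of polynomials in the variables with index in \<open>J\<close>.
\<close>

locale polynomial_presentation = A?: cring A
  for A :: "('k::field, 'a, 'm) module_scheme" (structure)
    and \<phi> :: "('i, 'k) spoly \<Rightarrow> 'a" and J :: "'i set" +
  assumes onto: "carrier A = \<phi> ` {p. vars p \<subseteq> J}"
    and add_hom: "\<lbrakk> vars p \<subseteq> J; vars q \<subseteq> J \<rbrakk> \<Longrightarrow> \<phi> (p + q) = \<phi> p \<oplus> \<phi> q"
    and mult_hom: "\<lbrakk> vars p \<subseteq> J; vars q \<subseteq> J \<rbrakk> \<Longrightarrow> \<phi> (p * q) = \<phi> p \<otimes> \<phi> q"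
    and one_hom: "\<phi> 1 = \<one>"
    and Const_hom: "\<phi> (Const c) = c \<odot> \<one>"
begin

lemma phi_closed: "vars p \<subseteq> J \<Longrightarrow> \<phi> p \<in> carrier A"
  using onto by blast

lemma zero_hom: "\<phi> 0 = \<zero>"
proof -
  have "\<phi> 0 = \<phi> 0 \<oplus> \<phi> 0" using add_hom[of 0 0] by simp
  then show ?thesis using phi_closed[of 0] by (simp add: A.add.r_cancel_one')
qed

lemma uminus_hom: "vars p \<subseteq> J \<Longrightarrow> \<phi> (- p) = \<ominus> \<phi> p"
  using add_hom[of "- p" p] phi_closed[of p] phi_closed[of "- p"]
  by (intro A.minus_equality[symmetric]) (simp_all add: zero_hom)

lemma scalars_eq: "scalars A = (\<lambda>c. \<phi> (Const c)) ` UNIV"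
  by (simp add: scalars_def Const_hom)

lemma scalars_subset: "scalars A \<subseteq> carrier A"
  unfolding scalars_eq using phi_closed by auto

lemma subfield_scalars:
  assumes "\<one> \<noteq> \<zero>" shows "subfield (scalars A) A"
proof -
  let ?k = "ring_of_type_algebra :: 'k ring"
  interpret k: Ring.field ?k by (rule field_from_type_algebra)
  have "ring_hom_ring ?k A (\<lambda>c. \<phi> (Const c))"
  proof (rule ring_hom_ringI[OF k.ring_axioms A.ring_axioms])
    show "\<phi> (Const x) \<in> carrier A" for x by (rule phi_closed) simp
    show "\<phi> (Const (x \<otimes>\<^bsub>?k\<^esub> y)) = \<phi> (Const x) \<otimes> \<phi> (Const y)" for x y
      by (simp add: ring_of_type_algebra_def Const_simps mult_hom)
    show "\<phi> (Const (x \<oplus>\<^bsub>?k\<^esub> y)) = \<phi> (Const x) \<oplus> \<phi> (Const y)" for x y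
      by (simp add: ring_of_type_algebra_def Const_simps add_hom)
    show "\<phi> (Const \<one>\<^bsub>?k\<^esub>) = \<one>"
      by (simp add: ring_of_type_algebra_def Const_simps one_hom)
  qed
  from ring_hom_ring.img_is_subfield(2)[OF this k.carrier_is_subfield assms]
  show ?thesis by (simp add: scalars_eq ring_of_type_algebra_def)
qed

lemma sum_hom:
  assumes "\<And>a. a \<in> S \<Longrightarrow> vars (f a) \<subseteq> J" and W: "subalgebra (scalars A) W A"
    and "\<And>a. a \<in> S \<Longrightarrow> \<phi> (f a) \<in> W"
  shows "\<phi> (sum f S) \<in> W"
proof -
  interpret W: subalgebra "scalars A" W A by (rule W)
  have z: "\<zero> \<in> W" and a: "x \<oplus> y \<in> W" if "x \<in> W" "y \<in> W" for x y
    using W.one_closed W.m_closed that by simp_all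
  have z: "\<zero> \<in> W" using W.one_closed by simp
  show ?thesis
    using assms(1,3)
  proof (induction S rule: infinite_finite_induct)
    case (insert s S)
    have "vars (sum f S) \<subseteq> J" using insert by (intro vars_sum) auto
    then show ?case using insert a by (simp add: add_hom)
  qed (simp_all add: zero_hom z)
qed

lemma subalgebra_image:
  assumes "V \<subseteq> J"
  shows "subalgebra (scalars A) (\<phi> ` polys_upto w V d) A"
proof -
  have J: "vars p \<subseteq> J" if "p \<in> polys_upto w V d" for p
    using that assms by (auto simp: polys_upto_def)
  have "subgroup (\<phi> ` polys_upto w V d) (add_monoid A)"
  proof (rule A.add.subgroupI)
    show "\<phi> ` polys_upto w V d \<subseteq> carrier A" using phi_closed[OF J] by blast
    show "\<phi> ` polys_upto w V d \<noteq> {}" using polys_upto_Const by blast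
  next
    fix x assume "x \<in> \<phi> ` polys_upto w V d"
    then obtain p where p: "p \<in> polys_upto w V d" "x = \<phi> p" by auto
    have "- p \<in> polys_upto w V d" using p by (simp add: polys_upto_def)
    moreover have "\<ominus> x = \<phi> (- p)" using uminus_hom[OF J[OF p(1)]] p(2) by simp
    ultimately show "\<ominus> x \<in> \<phi> ` polys_upto w V d" by simp
  next
    fix x y assume "x \<in> \<phi> ` polys_upto w V d" "y \<in> \<phi> ` polys_upto w V d"
    then obtain p q where pq: "p \<in> polys_upto w V d" "x = \<phi> p" "q \<in> polys_upto w V d" "y = \<phi> q" by auto
    then have "x \<oplus> y = \<phi> (p + q)" using add_hom[OF J J] by simp
    moreover have "p + q \<in> polys_upto w V d" using pq by (simp add: polys_upto_add)
    ultimately show "x \<oplus> y \<in> \<phi> ` polys_upto w V d" by blast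
  qed
  moreover have "k \<otimes> v \<in> \<phi> ` polys_upto w V d" if "k \<in> scalars A" "v \<in> \<phi> ` polys_upto w V d" for k v
  proof -
    obtain c p where cp: "k = \<phi> (Const c)" "p \<in> polys_upto w V d" "v = \<phi> p"
      using \<open>k \<in> scalars A\<close> \<open>v \<in> \<phi> ` polys_upto w V d\<close> by (auto simp: scalars_eq)
    then have "k \<otimes> v = \<phi> (Const c * p)" using mult_hom[OF _ J] by simp
    moreover have "Const c * p \<in> polys_upto w V d"
      using polys_upto_mult[OF polys_upto_Const[of c w V 0] cp(2)] by simp
    ultimately show ?thesis by blast
  qed
  ultimately show ?thesis by (intro subalgebra.intro subalgebra_axioms.intro)
qed

lemma subspace_power_subset:
  assumes "V \<subseteq> J" "U \<subseteq> \<phi> ` polys_upto w V c"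
  shows "subspace_power A U n \<subseteq> \<phi> ` polys_upto w V (n * c)"
proof (induction n)
  case 0
  show ?case using polys_upto_Const by (simp add: scalars_eq) blast
next
  case (Suc n)
  interpret W: subalgebra "scalars A" "\<phi> ` polys_upto w V (Suc n * c)" A
    by (rule subalgebra_image[OF assms(1)])
  show ?case
  proof
    fix x assume "x \<in> subspace_power A U (Suc n)"
    then have "x \<in> ideal_prod A (subspace_power A U n) U" by simp
    then show "x \<in> \<phi> ` polys_upto w V (Suc n * c)"
    proof (induction rule: ideal_prod.induct)
      case (prod i j)
      obtain p q where pq: "p \<in> polys_upto w V (n * c)" "i = \<phi> p" "q \<in> polys_upto w V c" "j = \<phi> q"
        using prod Suc assms(2) by blast
      have "vars p \<subseteq> J" "vars q \<subseteq> J" using pq assms(1) by (auto simp: polys_upto_def)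
      then have "i \<otimes> j = \<phi> (p * q)" using pq by (simp add: mult_hom)
      moreover have "p * q \<in> polys_upto w V (Suc n * c)"
        using polys_upto_mult[OF pq(1,3)] by (simp add: add.commute)
      ultimately show ?case by blast
    next
      case (sum s t)
      then show ?case using W.m_closed by simp
    qed
  qed
qed

lemma ex_polys_of_finite_dimension:
  assumes nz: "\<one> \<noteq> \<zero>" and U: "finite_dimension (scalars A) U"
  obtains V where "finite V" "V \<subseteq> J"
    "\<And>w. \<exists>c. U \<subseteq> \<phi> ` polys_upto w V c" "subalgebra (scalars A) U A"
proof -
  note K = subfield_scalars[OF nz]
  obtain n where "dimension n (scalars A) U" using U by blast
  then obtain Us where Us: "set Us \<subseteq> carrier A" "Span (scalars A) Us = U"
    using exists_base[OF K] by blast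
  obtain p where p: "\<And>u. u \<in> set Us \<Longrightarrow> vars (p u) \<subseteq> J \<and> \<phi> (p u) = u"
  proof -
    have "\<forall>u\<in>set Us. \<exists>p. vars p \<subseteq> J \<and> \<phi> p = u" using Us(1) onto by auto
    from bchoice[OF this] show thesis using that by blast
  qed
  define V where "V = (\<Union>u\<in>set Us. vars (p u))"
  have V: "finite V" "V \<subseteq> J" using p by (auto simp: V_def)
  have "\<exists>c. U \<subseteq> \<phi> ` polys_upto w V c" for w
  proof -
    have "\<exists>d. p u \<in> polys_upto w V d" if "u \<in> set Us" for u
      using ex_polys_upto[of "p u" V w] that by (auto simp: V_def)
    then obtain d where d: "\<And>u. u \<in> set Us \<Longrightarrow> p u \<in> polys_upto w V (d u)" by metis
    define c where "c = (\<Sum>u\<in>set Us. d u)"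
    have "set Us \<subseteq> \<phi> ` polys_upto w V c"
    proof
      fix u assume u: "u \<in> set Us"
      have "d u \<le> c" unfolding c_def by (rule sum_le_of_mem) (use u in auto)
      then have "p u \<in> polys_upto w V c" using polys_upto_mono[OF d[OF u]] by blast
      then show "u \<in> \<phi> ` polys_upto w V c" using p[OF u] by force
    qed
    then have "U \<subseteq> \<phi> ` polys_upto w V c"
      using subalgebra_Span_incl[OF K subalgebra_image[OF V(2)]] Us(2) by blast
    then show ?thesis by blast
  qed
  moreover have "subalgebra (scalars A) U A" by (rule finite_dimension_imp_subalgebra[OF K U])
  ultimately show thesis using that V by blast
qed

lemma subalgebra_subspace_power:
  assumes "\<one> \<noteq> \<zero>" "subalgebra (scalars A) U A"
  shows "subalgebra (scalars A) (subspace_power A U n) A"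
proof (induction n)
  case 0
  have K: "subfield (scalars A) A" by (rule subfield_scalars[OF assms(1)])
  note props = subringE[OF subfieldE(1)[OF K]]
  have "subgroup (scalars A) (add_monoid A)"
    using props by (intro A.add.subgroupI) (auto simp: a_inv_def)
  then show ?case using props by (simp add: subalgebra_def subalgebra_axioms_def)
next
  case (Suc n)
  show ?case using A.subalgebra_ideal_prod[OF Suc assms(2) scalars_subset] by simp
qed

text \<open>
  A finite-dimensional subspace \<open>U\<close> lies in the image of the polynomials in a finite set \<open>V\<close> of variables with
  bounded weight, for whatever weight.  Its \<open>n\<close>-th power then lies in the image of the polynomials whose
  weight is bounded by a multiple of \<open>n\<close>, and these are spanned by the images of sparse monomials of
  the same weight.  The degree \<open>N\<close> of the bound does not depend on \<open>U\<close>.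
\<close>

lemma dim_subspace_power_bound:
  assumes rel: "\<And>T. T \<subseteq> J \<Longrightarrow> card T = Suc N \<Longrightarrow> \<exists>f. f \<noteq> 0 \<and> vars f \<subseteq> T \<and> \<phi> f = \<zero>"
    and U: "finite_dimension (scalars A) U" "\<one> \<in> U"
  shows "\<exists>b c. \<forall>n. dim (scalars A) (subspace_power A U n) \<le> b * (n * c + 1) ^ N"
proof (cases "\<one> = \<zero>")
  case True
  then have car: "carrier A = {\<zero>}" using A.one_zeroD by blast
  have "scalars A \<noteq> {}" by (simp add: scalars_def)
  then have sc: "scalars A = {\<zero>}" using scalars_subset unfolding car by blast
  have "U \<subseteq> carrier A"
  proof -
    obtain m where "dimension m (scalars A) U" using U(1) by blast
    then show ?thesis
      by (induction rule: dimension.induct) (use car sc in \<open>auto simp: line_extension_mem_iff\<close>)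
  qed
  then have UU: "U = {\<zero>}" using U(2) car True by auto
  have "subspace_power A U n = {\<zero>}" for n
  proof (induction n)
    case (Suc n)
    have "x = \<zero>" if "x \<in> ideal_prod A {\<zero>} {\<zero>}" for x
      using that by (induction rule: ideal_prod.induct) auto
    moreover have "\<zero> \<in> ideal_prod A {\<zero>} {\<zero>}" using ideal_prod.prod[of \<zero> "{\<zero>}" \<zero> "{\<zero>}" A] by simp
    ultimately show ?case using Suc UU by auto
  qed (simp add: sc)
  then show ?thesis using A.dim_zero_ring[OF True] by simp
next
  case nz: False
  note K = subfield_scalars[OF nz]
  obtain V where V: "finite V" "V \<subseteq> J"
    and UV: "\<And>w. \<exists>c. U \<subseteq> \<phi> ` polys_upto w V c" and subU: "subalgebra (scalars A) U A"
    using ex_polys_of_finite_dimension[OF nz U(1)] by blast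
  define Z where "Z = {f. vars f \<subseteq> V \<and> \<phi> f = \<zero>}"
  have ZJ: "vars f \<subseteq> J" if "f \<in> Z" for f using that V by (auto simp: Z_def)
  obtain w k where w: "\<And>i. 1 \<le> w i" and k: "0 < k"
    and rw: "\<And>p d. p \<in> polys_upto w V d \<Longrightarrow>
      \<exists>q\<in>polys_upto w V d. Poly_Mapping.keys q \<subseteq> sparse_monomials V k N \<and> p - q \<in> Z"
  proof (rule rewrite_to_sparse[OF V(1), of Z N])
    show "0 \<in> Z" by (simp add: Z_def zero_hom)
  next
    fix x y :: "('i,'k) spoly" assume xy: "x \<in> Z" "y \<in> Z"
    have "\<phi> (x + y) = \<zero>" using xy ZJ by (simp add: add_hom Z_def)
    then show "x + y \<in> Z" using xy vars_add[of x y] by (auto simp: Z_def)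
  next
    fix r x :: "('i,'k) spoly" assume rx: "vars r \<subseteq> V" "x \<in> Z"
    have "\<phi> (r * x) = \<phi> r \<otimes> \<phi> x" using rx ZJ V by (intro mult_hom) auto
    also have "\<dots> = \<zero>" using rx phi_closed[of r] V by (simp add: Z_def)
    finally show "r * x \<in> Z" using rx vars_mult[of r x] by (auto simp: Z_def)
  next
    fix T assume T: "T \<subseteq> V" "card T = Suc N"
    then obtain f where "f \<noteq> 0" "vars f \<subseteq> T" "\<phi> f = \<zero>" using rel[of T] V by blast
    then show "\<exists>f. f \<noteq> 0 \<and> vars f \<subseteq> T \<and> f \<in> Z" using T(1) unfolding Z_def by blast
  qed blast
  obtain c where c: "U \<subseteq> \<phi> ` polys_upto w V c" using UV by blast
  have "dim (scalars A) (subspace_power A U n) \<le> 2 ^ card V * k ^ card V * (n * c + 1) ^ N" for n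
  proof -
    define B where "B = {m \<in> sparse_monomials V k N. wt w m \<le> n * c}"
    have B: "finite B" "card B \<le> 2 ^ card V * k ^ card V * (n * c + 1) ^ N"
      unfolding B_def by (intro card_sparse_monomials V(1) w k)+
    obtain ms where ms: "set ms = B" "length ms = card B"
      using B(1) by (metis finite_distinct_list distinct_card)
    define Us where "Us = map (\<lambda>m. \<phi> (Mon m)) ms"
    have vm: "vars (Mon m :: ('i,'k) spoly) \<subseteq> J" if "m \<in> B" for m
      using that V(2) by (auto simp: B_def sparse_monomials_def vars_def)
    have Us: "set Us \<subseteq> carrier A" using vm ms phi_closed by (auto simp: Us_def)
    have sub: "subalgebra (scalars A) (Span (scalars A) Us) A" by (rule Span_is_subalgebra[OF K Us])
    interpret S: subalgebra "scalars A" "Span (scalars A) Us" A by (rule sub)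
    have "\<phi> ` polys_upto w V (n * c) \<subseteq> Span (scalars A) Us"
    proof
      fix x assume "x \<in> \<phi> ` polys_upto w V (n * c)"
      then obtain p where p: "p \<in> polys_upto w V (n * c)" "x = \<phi> p" by blast
      obtain q where q: "q \<in> polys_upto w V (n * c)"
        "Poly_Mapping.keys q \<subseteq> sparse_monomials V k N" "p - q \<in> Z"
        using rw[OF p(1)] by blast
      have vq: "vars q \<subseteq> J" using q(1) V by (auto simp: polys_upto_def)
      have kB: "m \<in> B" if "m \<in> Poly_Mapping.keys q" for m
        using q(1,2) that by (auto simp: B_def polys_upto_def)
      have "x = \<phi> ((p - q) + q)" using p by simp
      also have "\<dots> = \<phi> (p - q) \<oplus> \<phi> q" by (rule add_hom[OF ZJ[OF q(3)] vq])
      also have "\<dots> = \<phi> q" using q(3) phi_closed[OF vq] by (simp add: Z_def)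
      also have "q = (\<Sum>m\<in>Poly_Mapping.keys q. Const (Poly_Mapping.lookup q m) * Mon m)"
        by (rule spoly_eq_sum)
      also have "\<phi> \<dots> \<in> Span (scalars A) Us"
      proof (rule sum_hom[OF _ sub])
        fix m assume m: "m \<in> Poly_Mapping.keys q"
        show "vars (Const (Poly_Mapping.lookup q m) * Mon m) \<subseteq> J"
          using vars_mult[of "Const (Poly_Mapping.lookup q m)" "Mon m"] vm[OF kB[OF m]] by auto
        have "\<phi> (Const (Poly_Mapping.lookup q m) * Mon m) = \<phi> (Const (Poly_Mapping.lookup q m)) \<otimes> \<phi> (Mon m)"
          using vm[OF kB[OF m]] by (intro mult_hom) auto
        moreover have "\<phi> (Mon m) \<in> Span (scalars A) Us"
          using Span_base_incl[OF K Us] kB[OF m] ms(1) by (auto simp: Us_def)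
        moreover have "\<phi> (Const (Poly_Mapping.lookup q m)) \<in> scalars A" by (auto simp: scalars_eq)
        ultimately show "\<phi> (Const (Poly_Mapping.lookup q m) * Mon m) \<in> Span (scalars A) Us"
          using S.smult_closed by simp
      qed
      finally show "x \<in> Span (scalars A) Us" .
    qed
    then have "subspace_power A U n \<subseteq> Span (scalars A) Us"
      using subspace_power_subset[OF V(2) c] by blast
    then have "dim (scalars A) (subspace_power A U n) \<le> length Us"
      by (intro dim_le_length[OF K subalgebra_subspace_power[OF nz subU] Us])
    also have "\<dots> = card B" by (simp add: Us_def ms)
    finally show ?thesis using B by simp
  qed
  then show ?thesis by blast
qed

end

text \<open>
  The constant factor \<open>b (c + 1)\<^sup>N\<close> is absorbed by one more factor \<open>n\<close>, which is harmless where only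
  finiteness matters.
\<close>

lemma limsup_log_ratio_le:
  fixes d :: "nat \<Rightarrow> nat"
  assumes "\<And>n. d n \<le> b * (n * c + 1) ^ N"
  shows "limsup (\<lambda>n. ereal (ln (real (d n)) / ln (real n))) \<le> ereal (real (Suc N))"
proof (rule Limsup_bounded)
  have "ln (real (d n)) / ln (real n) \<le> real (Suc N)" if n: "2 \<le> n" "b * (c + 1) ^ N \<le> n" for n
  proof -
    have ln: "0 < ln (real n)" using n by simp
    have "b * (n * c + 1) ^ N \<le> b * ((c + 1) * n) ^ N"
      using n by (intro mult_left_mono power_mono) (auto simp: algebra_simps)
    also have "\<dots> = b * (c + 1) ^ N * n ^ N" by (simp only: power_mult_distrib mult.assoc)
    also have "\<dots> \<le> n * n ^ N" using n by (intro mult_right_mono) auto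
    finally have "d n \<le> n ^ Suc N" using assms[of n] by simp
    then have le: "real (d n) \<le> real n ^ Suc N" by (metis of_nat_le_iff of_nat_power)
    have "ln (real (d n)) \<le> real (Suc N) * ln (real n)"
    proof (cases "d n = 0")
      case False
      then have "ln (real (d n)) \<le> ln (real n ^ Suc N)" using le n by (intro ln_mono) auto
      also have "\<dots> = real (Suc N) * ln (real n)" by (rule ln_realpow)
      finally show ?thesis .
    qed (use ln in simp)
    then show ?thesis using ln by (simp add: pos_divide_le_eq)
  qed
  then show "\<forall>\<^sub>F n in sequentially. ereal (ln (real (d n)) / ln (real n)) \<le> ereal (real (Suc N))"
    by (intro eventually_sequentiallyI[of "max 2 (b * (c + 1) ^ N)"]) simp
qed

theorem (in polynomial_presentation) polynomial_growth_if_dependent: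
  assumes "\<And>T. T \<subseteq> J \<Longrightarrow> card T = Suc N \<Longrightarrow> \<exists>f. f \<noteq> 0 \<and> vars f \<subseteq> T \<and> \<phi> f = \<zero>"
  shows "polynomial_growth A"
proof -
  have "gk_dim A \<le> ereal (real (Suc N))"
    unfolding gk_dim_def
  proof (rule SUP_least)
    fix U assume "U \<in> {U. finite_dimension (scalars A) U \<and> \<one> \<in> U}"
    then obtain b c where "\<And>n. dim (scalars A) (subspace_power A U n) \<le> b * (n * c + 1) ^ N"
      using dim_subspace_power_bound[OF assms] by blast
    then show "limsup (\<lambda>n. ereal (ln (real (dim (scalars A) (subspace_power A U n))) / ln (real n)))
        \<le> ereal (real (Suc N))"
      by (rule limsup_log_ratio_le)
  qed
  then show ?thesis unfolding polynomial_growth_def by (rule order.strict_trans1) simp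
qed

section \<open>Uniform algebraic dependence modulo a Poisson ideal\<close>

context witt_type
begin

text \<open>
  If \<open>I\<close> avoided \<open>K[T] - {0}\<close>, so would some prime Poisson ideal \<open>P\<close> that contains \<open>I\<close>.  But
  modulo \<open>P\<close> every variable lies in a localisation of the polynomials in the window of \<open>f\<close>, which
  has fewer elements than \<open>T\<close>.  The size of \<open>T\<close> depends on \<open>f\<close> alone; this uniformity is what bounds
  the growth.
\<close>

theorem ideal_meets_subring:
  fixes I :: "('i, 'k) spoly set"
  assumes IJ: "\<And>x. x \<in> I \<Longrightarrow> vars x \<subseteq> indices"
    and I0: "0 \<in> I" and Iadd: "\<And>x y. x \<in> I \<Longrightarrow> y \<in> I \<Longrightarrow> x + y \<in> I"
    and Imult: "\<And>r x. vars r \<subseteq> indices \<Longrightarrow> x \<in> I \<Longrightarrow> r * x \<in> I"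
    and Ibr: "\<And>a x. vars a \<subseteq> indices \<Longrightarrow> x \<in> I \<Longrightarrow> lie_poisson br a x \<in> I"
    and f: "f \<in> I" "f \<noteq> 0" "vars f \<subseteq> \<epsilon> ` N"
    and T: "T \<subseteq> indices" "card T = Suc (card (window f))"
  shows "\<exists>q. q \<noteq> 0 \<and> vars q \<subseteq> T \<and> q \<in> I"
proof (rule ccontr)
  assume none: "\<not> ?thesis"
  interpret differential_subring "{p. vars p \<subseteq> indices}" "{lie_poisson br a |a. vars a \<subseteq> indices}"
    by (rule lie_poisson_differential_subring)
  define S where "S = {q :: ('i,'k) spoly. q \<noteq> 0 \<and> vars q \<subseteq> T}"
  have I: "diff_ideal I"
    unfolding diff_ideal_def using IJ I0 Iadd Imult Ibr by blast
  have S1: "1 \<in> S" by (simp add: S_def)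
  have Smult: "s * t \<in> S" if "s \<in> S" "t \<in> S" for s t
    using that vars_mult[of s t] spoly_mult_nonzero by (auto simp: S_def)
  have SJ: "S \<subseteq> {p. vars p \<subseteq> indices}" using T by (auto simp: S_def)
  have disj: "I \<inter> S = {}" using none by (auto simp: S_def)
  obtain P where P: "diff_ideal P" "I \<subseteq> P" "P \<inter> S = {}"
    "\<forall>a\<in>{p. vars p \<subseteq> indices}. \<forall>b\<in>{p. vars p \<subseteq> indices}. a * b \<in> P \<longrightarrow> a \<in> P \<or> b \<in> P"
    using prime_diff_ideal_exists[OF I S1 Smult SJ disj] by blast
  have PJ: "\<And>x. x \<in> P \<Longrightarrow> vars x \<subseteq> indices" and P0: "0 \<in> P"
    and Padd: "\<And>x y. x \<in> P \<Longrightarrow> y \<in> P \<Longrightarrow> x + y \<in> P"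
    and Pmult: "\<And>r x. vars r \<subseteq> indices \<Longrightarrow> x \<in> P \<Longrightarrow> r * x \<in> P"
    and Pbr: "\<And>a x. vars a \<subseteq> indices \<Longrightarrow> x \<in> P \<Longrightarrow> lie_poisson br a x \<in> P"
    using P(1) unfolding diff_ideal_def by blast+
  have Pprime: "\<And>a b. vars a \<subseteq> indices \<Longrightarrow> vars b \<subseteq> indices \<Longrightarrow> a * b \<in> P \<Longrightarrow> a \<in> P \<or> b \<in> P"
    using P(4) by simp
  have one: "1 \<notin> P" using P(3) S1 by blast
  have fP: "f \<in> P" using f P(2) by blast
  obtain H where H: "vars H \<subseteq> window f" "H \<notin> P"
    "\<And>j. j \<in> indices \<Longrightarrow> \<exists>r p. vars p \<subseteq> window f \<and> H ^ r * Var j - p \<in> P"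
    using localisation_generated_by_window[OF PJ P0 Padd Pmult Pprime one Pbr fP f(2,3)] by blast
  have "finite T" using T(2) by (metis card.infinite nat.distinct(1))
  then have "\<exists>q. q \<noteq> 0 \<and> vars q \<subseteq> T \<and> q \<in> P"
    using T H(3)
    by (intro prime_ideal_meets_subring[OF P0 Padd Pmult Pprime one finite_window window_subset H(1,2)]) auto
  then show False using P(3) by (auto simp: S_def)
qed

end

section \<open>Poisson quotients of the three symmetric algebras\<close>

lemma vir_index_exhausted: "x \<in> {Vir_c} \<union> range Vir_e"
  by (cases x) auto

interpretation witt: witt_type witt_bracket id UNIV "{}"
  by unfold_locales (auto simp: witt_bracket_def lin_single intro!: exI[of _ 0])

interpretation wplus: witt_type witt_bracket id "{1..}" "{}"
  by unfold_locales (auto simp: witt_bracket_def lin_single intro!: exI[of _ 0])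

interpretation vir: witt_type vir_bracket Vir_e UNIV "{Vir_c}"
proof
  show "inj Vir_e" by (auto simp: inj_def)
  fix n i :: int
  show "\<exists>z. vars z \<subseteq> {Vir_c} \<and> lin (vir_bracket (Vir_e n) (Vir_e i)) =
      Const (of_int (i - n)) * Var (Vir_e (n + i)) + (z :: (vir_index, 'a) spoly)"
    unfolding lin_vir_bracket
    using vars_mult[of "Const (if n + i = 0 then of_int (n ^ 3 - n) / 12 else 0)" "Var Vir_c"]
    by (intro exI[of _ "Const (if n + i = 0 then of_int (n ^ 3 - n) / 12 else 0) * Var Vir_c"] conjI refl) simp
next
  fix x y
  show "Poly_Mapping.keys (vir_bracket x y) \<subseteq> {Vir_c} \<union> range Vir_e"
    using vir_index_exhausted by blast
qed simp_all

context poisson_algebra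
begin

lemma presentation_quot:
  fixes \<phi> :: "('i, 'k) spoly \<Rightarrow> 'a"
  assumes I: "poisson_ideal A I" and A: "polynomial_presentation A \<phi> J"
  shows "polynomial_presentation (poisson_quot A I) (\<lambda>p. I +>\<^bsub>A\<^esub> \<phi> p) J"
proof -
  interpret p: polynomial_presentation A \<phi> J by (rule A)
  interpret Q: cring "poisson_quot A I" by (rule poisson_quot_cring[OF I])
  show ?thesis
  proof unfold_locales
    show "carrier (poisson_quot A I) = (\<lambda>p. I +> \<phi> p) ` {p. vars p \<subseteq> J}"
      unfolding poisson_quot_simps(1)[OF I] p.onto image_image ..
  next
    fix p q :: "('i, 'k) spoly" assume pq: "vars p \<subseteq> J" "vars q \<subseteq> J"
    note c = p.phi_closed[OF pq(1)] p.phi_closed[OF pq(2)]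
    show "I +> \<phi> (p + q) = (I +> \<phi> p) \<oplus>\<^bsub>poisson_quot A I\<^esub> (I +> \<phi> q)"
      unfolding p.add_hom[OF pq] by (rule poisson_quot_simps(4)[OF I c, symmetric])
    show "I +> \<phi> (p * q) = (I +> \<phi> p) \<otimes>\<^bsub>poisson_quot A I\<^esub> (I +> \<phi> q)"
      unfolding p.mult_hom[OF pq] by (rule poisson_quot_simps(5)[OF I c, symmetric])
  next
    show one: "I +> \<phi> 1 = \<one>\<^bsub>poisson_quot A I\<^esub>"
      by (simp add: poisson_quot_simps(3)[OF I] p.one_hom)
    show "I +> \<phi> (Const c) = c \<odot>\<^bsub>poisson_quot A I\<^esub> \<one>\<^bsub>poisson_quot A I\<^esub>" for c
      by (simp add: poisson_quot_simps(3)[OF I] poisson_quot_smult[OF I] p.Const_hom)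
  qed
qed

lemma coset_eq_zero_iff:
  assumes I: "poisson_ideal A I" and x: "x \<in> carrier A"
  shows "I +>\<^bsub>A\<^esub> x = \<zero>\<^bsub>poisson_quot A I\<^esub> \<longleftrightarrow> x \<in> I"
proof -
  interpret I: ideal I A using I by (simp add: poisson_ideal_def)
  have "\<zero>\<^bsub>poisson_quot A I\<^esub> = I"
    unfolding poisson_quot_simps(2)[OF I] by (rule I.a_rcos_const) (rule additive_subgroup.zero_closed[OF I.is_additive_subgroup])
  then show ?thesis using x I.a_rcos_const I.a_rcos_self by metis
qed

end

lemma presentation_sym_poisson: "polynomial_presentation (sym_poisson br J) (\<lambda>p. p) J"
proof -
  interpret cring "sym_poisson br J" by (rule sym_poisson_cring)
  show ?thesis by unfold_locales (auto simp: sym_poisson_def)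
qed

lemma sym_poisson_ideal:
  assumes I: "poisson_ideal (sym_poisson br J) I"
  shows "x \<in> I \<Longrightarrow> vars x \<subseteq> J" "0 \<in> I" "x \<in> I \<Longrightarrow> y \<in> I \<Longrightarrow> x + y \<in> I"
    "vars r \<subseteq> J \<Longrightarrow> x \<in> I \<Longrightarrow> r * x \<in> I"
    "vars r \<subseteq> J \<Longrightarrow> x \<in> I \<Longrightarrow> lie_poisson br r x \<in> I"
proof -
  let ?S = "sym_poisson br J"
  interpret I: ideal I ?S using I by (simp add: poisson_ideal_def)
  have S: "carrier ?S = {p. vars p \<subseteq> J}" "\<zero>\<^bsub>?S\<^esub> = 0" "monoid.mult ?S = (*)"
    "ring.add ?S = (+)" "pbracket ?S = lie_poisson br"
    by (simp_all add: sym_poisson_def)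
  show "x \<in> I \<Longrightarrow> vars x \<subseteq> J" using I.Icarr[of x] by (simp add: S)
  show "0 \<in> I" using additive_subgroup.zero_closed[OF I.is_additive_subgroup] by (simp add: S)
  show "x \<in> I \<Longrightarrow> y \<in> I \<Longrightarrow> x + y \<in> I" 
    using additive_subgroup.a_closed[OF I.is_additive_subgroup, of x y] by (simp add: S)
  show "vars r \<subseteq> J \<Longrightarrow> x \<in> I \<Longrightarrow> r * x \<in> I" using I.I_l_closed[of x r] by (simp add: S)
  show "vars r \<subseteq> J \<Longrightarrow> x \<in> I \<Longrightarrow> lie_poisson br r x \<in> I"
    using I by (auto simp: poisson_ideal_def S)
qed

theorem (in witt_type) polynomial_growth_quot:
  fixes A :: "('k, 'a, 'm) module_scheme"
  assumes A: "polynomial_presentation A \<phi> indices"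
    and I: "poisson_ideal (sym_poisson br indices) {p. vars p \<subseteq> indices \<and> \<phi> p = \<zero>\<^bsub>A\<^esub>}"
    and f: "f \<noteq> 0" "vars f \<subseteq> \<epsilon> ` N" "\<phi> f = \<zero>\<^bsub>A\<^esub>"
  shows "polynomial_growth A"
proof (rule polynomial_presentation.polynomial_growth_if_dependent[OF A])
  fix T assume T: "T \<subseteq> indices" "card T = Suc (card (window f))"
  have fI: "f \<in> {p. vars p \<subseteq> indices \<and> \<phi> p = \<zero>\<^bsub>A\<^esub>}" using f by (auto simp: indices_def)
  from ideal_meets_subring[OF sym_poisson_ideal[OF I] fI f(1,2) T]
  show "\<exists>q. q \<noteq> 0 \<and> vars q \<subseteq> T \<and> \<phi> q = \<zero>\<^bsub>A\<^esub>" by blast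
qed

theorem (in witt_type) polynomial_growth_poisson_quot:
  assumes PA: "poisson_algebra (sym_poisson br indices)"
    and I: "poisson_ideal (sym_poisson br indices) I"
    and f: "f \<in> I" "f \<noteq> 0" "vars f \<subseteq> \<epsilon> ` N"
  shows "polynomial_growth (poisson_quot (sym_poisson br indices) I)"
proof -
  let ?S = "sym_poisson br indices"
  interpret poisson_algebra ?S by (rule PA)
  have pr: "polynomial_presentation (poisson_quot ?S I) (\<lambda>p. I +>\<^bsub>?S\<^esub> p) indices"
    by (rule presentation_quot[OF I presentation_sym_poisson])
  have car: "x \<in> carrier ?S \<longleftrightarrow> vars x \<subseteq> indices" for x by (simp add: sym_poisson_def)
  have ker: "{p. vars p \<subseteq> indices \<and> I +>\<^bsub>?S\<^esub> p = \<zero>\<^bsub>poisson_quot ?S I\<^esub>} = I"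
  proof -
    have "vars p \<subseteq> indices \<and> I +>\<^bsub>?S\<^esub> p = \<zero>\<^bsub>poisson_quot ?S I\<^esub> \<longleftrightarrow> p \<in> I" for p
      using coset_eq_zero_iff[OF I, of p] sym_poisson_ideal(1)[OF I, of p] car[of p] by blast
    then show ?thesis by simp
  qed
  show ?thesis
  proof (rule polynomial_growth_quot[OF pr _ f(2,3)])
    show "poisson_ideal ?S {p. vars p \<subseteq> indices \<and> I +>\<^bsub>?S\<^esub> p = \<zero>\<^bsub>poisson_quot ?S I\<^esub>}"
      unfolding ker by (rule I)
    show "I +>\<^bsub>?S\<^esub> f = \<zero>\<^bsub>poisson_quot ?S I\<^esub>" using ker f(1) by blast
  qed
qed

lemma polynomial_growth_S_W:
  fixes I :: "(int, 'k::field_char_0) spoly set"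
  assumes I: "poisson_ideal S_W I" and ne: "I \<noteq> {\<zero>\<^bsub>S_W\<^esub>}"
  shows "polynomial_growth (poisson_quot S_W I)"
proof -
  have eq: "S_W = sym_poisson witt_bracket witt.indices" by (simp add: S_W_def witt.indices_def)
  have "0 \<in> I" using sym_poisson_ideal(2) I unfolding S_W_def by blast
  moreover have "I \<noteq> {0}" using ne by (simp add: S_W_def sym_poisson_def)
  ultimately obtain f where "f \<in> I" "f \<noteq> 0" by blast
  then show ?thesis
    using poisson_algebra_S_W I unfolding eq by (intro witt.polynomial_growth_poisson_quot) auto
qed

lemma polynomial_growth_S_Wplus:
  fixes I :: "(int, 'k::field_char_0) spoly set"
  assumes I: "poisson_ideal S_Wplus I" and ne: "I \<noteq> {\<zero>\<^bsub>S_Wplus\<^esub>}"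
  shows "polynomial_growth (poisson_quot S_Wplus I)"
proof -
  have eq: "S_Wplus = sym_poisson witt_bracket wplus.indices" by (simp add: S_Wplus_def wplus.indices_def)
  have "0 \<in> I" using sym_poisson_ideal(2) I unfolding S_Wplus_def by blast
  moreover have "I \<noteq> {0}" using ne by (simp add: S_Wplus_def sym_poisson_def)
  ultimately obtain f where f: "f \<in> I" "f \<noteq> 0" by blast
  moreover have "vars f \<subseteq> {1..}" using sym_poisson_ideal(1) I f unfolding S_Wplus_def by blast
  ultimately show ?thesis
    using poisson_algebra_S_Wplus I unfolding eq by (intro wplus.polynomial_growth_poisson_quot) auto
qed

text \<open>
  Substituting \<open>\<kappa>\<close> for \<open>c\<close>.
\<close>

lemma ex_central_reduction:
  fixes p :: "(vir_index, 'k::field_char_0) spoly"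
  shows "\<exists>q. vars q \<subseteq> range Vir_e \<and> p - q \<in> Idl\<^bsub>S_Vir\<^esub> {Var Vir_c - Const \<kappa>}"
proof -
  let ?S = "S_Vir :: ('k, (vir_index, 'k) spoly) poisson"
  define I where "I = Idl\<^bsub>?S\<^esub> {Var Vir_c - Const \<kappa>}"
  have "poisson_ideal ?S I" unfolding I_def by (rule poisson_ideal_central)
  note I = sym_poisson_ideal[OF this[unfolded S_Vir_def]]
  interpret poisson_algebra ?S by (rule poisson_algebra_S_Vir)
  have z: "Var Vir_c - Const \<kappa> \<in> I"
    unfolding I_def by (rule genideal_self') (simp add: S_Vir_def sym_poisson_def)
  have "\<exists>q. vars q \<subseteq> range Vir_e \<and> p - q \<in> I"
  proof (induction p rule: spoly_induct)
    case (Const c)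
    show ?case using I(2) by (intro exI[of _ "Const c"]) simp
  next
    case (Var i)
    show ?case
    proof (cases i)
      case (Vir_e n)
      then show ?thesis using I(2) by (intro exI[of _ "Var i"]) simp
    next
      case Vir_c
      then show ?thesis using z by (intro exI[of _ "Const \<kappa>"]) simp
    qed
  next
    case (add p p')
    then obtain q q' where q: "vars q \<subseteq> range Vir_e" "p - q \<in> I" "vars q' \<subseteq> range Vir_e" "p' - q' \<in> I"
      by blast
    have "(p + p') - (q + q') = (p - q) + (p' - q')" by simp
    also have "\<dots> \<in> I" using I(3) q by blast
    finally show ?case using vars_add[of q q'] q by blast
  next
    case (mult p p')
    then obtain q q' where q: "vars q \<subseteq> range Vir_e" "p - q \<in> I" "vars q' \<subseteq> range Vir_e" "p' - q' \<in> I"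
      by blast
    have "p * p' - q * q' = p' * (p - q) + q * (p' - q')" by (simp add: algebra_simps)
    also have "\<dots> \<in> I" using q by (intro I(3,4)) auto
    finally show ?case using vars_mult[of q q'] q by blast
  qed
  then show ?thesis by (simp add: I_def)
qed

text \<open>
  The double quotient is presented by the polynomials in all variables, with kernel the preimage of
  \<open>I\<close> in \<open>S(Vir)\<close>.  An element of the kernel that is not in \<open>(c - \<kappa>)\<close> stays nonzero when \<open>c\<close> is
  replaced by \<open>\<kappa>\<close>, and it then involves variables \<open>e\<^sub>n\<close> only, as the recurrence argument requires.
\<close>

lemma polynomial_growth_S_Vir_mod:
  fixes \<kappa> :: "'k::field_char_0"
  assumes I: "poisson_ideal (S_Vir_mod \<kappa>) I" and ne: "I \<noteq> {\<zero>\<^bsub>S_Vir_mod \<kappa>\<^esub>}"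
  shows "polynomial_growth (poisson_quot (S_Vir_mod \<kappa>) I)"
proof -
  let ?S = "S_Vir :: ('k, (vir_index, 'k) spoly) poisson"
  define I0 where "I0 = Idl\<^bsub>?S\<^esub> {Var Vir_c - Const \<kappa>}"
  define \<pi> where "\<pi> p = I0 +>\<^bsub>?S\<^esub> p" for p
  let ?R = "S_Vir_mod \<kappa>"
  have I0: "poisson_ideal ?S I0" unfolding I0_def by (rule poisson_ideal_central)
  have R: "?R = poisson_quot ?S I0" by (simp add: S_Vir_mod_def I0_def)
  interpret S: poisson_algebra ?S by (rule poisson_algebra_S_Vir)
  interpret R: poisson_algebra ?R by (rule poisson_algebra_S_Vir_mod)
  interpret I: ideal I ?R using I by (simp add: poisson_ideal_def)
  have I0_mem: "\<zero>\<^bsub>?R\<^esub> \<in> I" by (rule additive_subgroup.zero_closed[OF I.is_additive_subgroup])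
  have ind: "vir.indices = UNIV" using vir_index_exhausted by (auto simp: vir.indices_def)
  have SS: "?S = sym_poisson vir_bracket vir.indices" by (simp add: S_Vir_def ind)
  have Sops: "carrier ?S = UNIV" "monoid.mult ?S = (*)" "ring.add ?S = (+)" "\<zero>\<^bsub>?S\<^esub> = 0"
    "pbracket ?S = lie_poisson vir_bracket"
    by (simp_all add: S_Vir_def sym_poisson_def)
  have pS: "polynomial_presentation ?S (\<lambda>p. p) vir.indices"
    unfolding SS by (rule presentation_sym_poisson)
  have pR: "polynomial_presentation ?R \<pi> vir.indices"
    unfolding R \<pi>_def by (rule S.presentation_quot[OF I0 pS])
  interpret pR: polynomial_presentation ?R \<pi> vir.indices by (rule pR)
  have pQ: "polynomial_presentation (poisson_quot ?R I) (\<lambda>p. I +>\<^bsub>?R\<^esub> \<pi> p) vir.indices"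
    by (rule R.presentation_quot[OF I pR])
  have \<pi>car: "\<pi> p \<in> carrier ?R" for p by (rule pR.phi_closed) (simp add: ind)
  have ker: "I +>\<^bsub>?R\<^esub> \<pi> p = \<zero>\<^bsub>poisson_quot ?R I\<^esub> \<longleftrightarrow> \<pi> p \<in> I" for p
    by (rule R.coset_eq_zero_iff[OF I \<pi>car])
  have kereq: "{p. vars p \<subseteq> vir.indices \<and> I +>\<^bsub>?R\<^esub> \<pi> p = \<zero>\<^bsub>poisson_quot ?R I\<^esub>} = {p. \<pi> p \<in> I}"
    by (simp add: ker ind)
  have "poisson_ideal ?S {p. \<pi> p \<in> I}"
    unfolding poisson_ideal_def
  proof (intro conjI ballI)
    show "ideal {p. \<pi> p \<in> I} ?S"
    proof (rule idealI[OF S.ring_axioms])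
      show "subgroup {p. \<pi> p \<in> I} (add_monoid ?S)"
      proof (rule S.add.subgroupI)
        show "{p. \<pi> p \<in> I} \<subseteq> carrier ?S" by (simp add: Sops)
        have "\<pi> 0 \<in> I" unfolding pR.zero_hom by (rule I0_mem)
        then show "{p. \<pi> p \<in> I} \<noteq> {}" by blast
      next
        fix p assume "p \<in> {p. \<pi> p \<in> I}"
        moreover have "\<ominus>\<^bsub>?S\<^esub> p = - p" unfolding S_Vir_def by (rule sym_poisson_minus) (simp add: sym_poisson_def)
        ultimately show "\<ominus>\<^bsub>?S\<^esub> p \<in> {p. \<pi> p \<in> I}"
          using pR.uminus_hom[of p] I.a_inv_closed by (simp add: ind)
      next
        fix p q assume "p \<in> {p. \<pi> p \<in> I}" "q \<in> {p. \<pi> p \<in> I}"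
        then show "p \<oplus>\<^bsub>?S\<^esub> q \<in> {p. \<pi> p \<in> I}"
          using pR.add_hom[of p q] I.a_closed by (simp add: ind Sops)
      qed
    next
      fix p q assume "p \<in> {p. \<pi> p \<in> I}"
      then show "q \<otimes>\<^bsub>?S\<^esub> p \<in> {p. \<pi> p \<in> I}" "p \<otimes>\<^bsub>?S\<^esub> q \<in> {p. \<pi> p \<in> I}"
        using pR.mult_hom[of p q] pR.mult_hom[of q p] I.I_l_closed I.I_r_closed \<pi>car
        by (simp_all add: ind Sops)
    qed
  next
    fix p q assume "q \<in> {p. \<pi> p \<in> I}"
    moreover have "\<pi> (pbracket ?S p q) = pbracket ?R (\<pi> p) (\<pi> q)"
      unfolding R \<pi>_def by (rule S.poisson_quot_bracket[OF I0, symmetric]) (simp_all add: Sops)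
    ultimately show "pbracket ?S p q \<in> {p. \<pi> p \<in> I}"
      using R.poisson_ideal_bracket(1)[OF I \<pi>car] by simp
  qed
  then have ideal: "poisson_ideal (sym_poisson vir_bracket vir.indices)
      {p. vars p \<subseteq> vir.indices \<and> I +>\<^bsub>?R\<^esub> \<pi> p = \<zero>\<^bsub>poisson_quot ?R I\<^esub>}"
    unfolding kereq SS .
  obtain Y where Y: "Y \<in> I" "Y \<noteq> \<zero>\<^bsub>?R\<^esub>" using ne I0_mem by blast
  obtain p where p: "Y = \<pi> p" using I.Icarr[OF Y(1)] unfolding pR.onto by blast
  obtain q where q: "vars q \<subseteq> range Vir_e" "p - q \<in> I0"
    using ex_central_reduction[of p \<kappa>] by (auto simp: I0_def)
  have zero: "\<pi> x = \<zero>\<^bsub>?R\<^esub> \<longleftrightarrow> x \<in> I0" for x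
    unfolding R \<pi>_def by (rule S.coset_eq_zero_iff[OF I0]) (simp add: Sops)
  have "\<pi> p = \<pi> (p - q) \<oplus>\<^bsub>?R\<^esub> \<pi> q" using pR.add_hom[of "p - q" q] by (simp add: ind)
  also have "\<dots> = \<pi> q" using q(2) \<pi>car[of q] by (simp add: zero[of "p - q", THEN iffD2])
  finally have pq: "\<pi> p = \<pi> q" .
  have "q \<noteq> 0" using Y p pq pR.zero_hom by auto
  moreover have "I +>\<^bsub>?R\<^esub> \<pi> q = \<zero>\<^bsub>poisson_quot ?R I\<^esub>" using Y(1) p pq ker by simp
  ultimately show ?thesis
    using q(1) by (intro vir.polynomial_growth_quot[OF pQ ideal])
qed

theorem theorem1p3:
  shows
    "(\<forall>I :: (int, 'k::field_char_0) spoly set.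
        poisson_ideal S_Wplus I \<and> I \<noteq> {\<zero>\<^bsub>S_Wplus\<^esub>} \<longrightarrow>
        polynomial_growth (poisson_quot S_Wplus I)) \<and>
     (\<forall>I :: (int, 'k) spoly set.
        poisson_ideal S_W I \<and> I \<noteq> {\<zero>\<^bsub>S_W\<^esub>} \<longrightarrow>
        polynomial_growth (poisson_quot S_W I)) \<and>
     (\<forall>(\<kappa> :: 'k) I.
        poisson_ideal (S_Vir_mod \<kappa>) I \<and> I \<noteq> {\<zero>\<^bsub>S_Vir_mod \<kappa>\<^esub>} \<longrightarrow>
        polynomial_growth (poisson_quot (S_Vir_mod \<kappa>) I))"
  using polynomial_growth_S_Wplus polynomial_growth_S_W polynomial_growth_S_Vir_mod by blast

end
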